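(* Let $S\subset\operatorname{Sym}^d\mathbf k^2$ be an $(r+1)$-dimensional subspace. The closure $\operatorname{Orb}(S)\subset\operatorname{Gr}(r+1,\operatorname{Sym}^d\mathbf k^2)$ of the $\operatorname{GL}(2)$-orbit of $[S]$ is a union of finitely many orbits. In addition to the orbit of $S$, these are the orbits of subspaces of the form $$\langle w_1^{d-a_0}w_2^{a_0},\dots,w_1^{d-a_r}w_2^{a_r}\rangle,$$ where $a_0<\dots<a_r$ is the vanishing sequence of $S$ at some point of $\mathbf P^1$ and $w_1,w_2$ is a basis of $\mathbf k^2$.
   Context: $\mathbf k$ is an algebraically closed field of characteristic $0$ or of characteristic $>d$. $\operatorname{Gr}(r+1,\operatorname{Sym}^d\mathbf k^2)$ is the Grassmannian of $(r+1)$-dimensional subspaces, with its natural $\operatorname{GL}(2)$-action. Let $\mathbf P^1$ be the space of lines in $\mathbf k^2$, with tautological sub-bundle $O(-1)\subset\underline{\mathbf k^2}$ and quotient $Q=\underline{\mathbf k^2}/O(-1)$; identify $\operatorname{Sym}^d\mathbf k^2=H^0(\mathbf P^1,Q^{d})$. Concretely, the order of vanishing of $F\in\operatorname{Sym}^d\mathbf k^2$ at $[v]\in\mathbf P^1$ is the largest $a$ such that $v^a$ divides $F$. The vanishing sequence of $S$ at $p\in\mathbf P^1$ is the unique sequence $a_0(p)<\dots<a_r(p)$ such that for each $i$, $S$ contains a section vanishing to order exactly $a_i(p)$ at $p$. *)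

theory Defs
  imports
    "HOL-Analysis.Analysis"
    "HOL-Library.Poly_Mapping"
    "HOL-Computational_Algebra.Computational_Algebra"
    "Jordan_Normal_Form.Determinant"
begin

hide_const (open) Module.module.smult

text \<open>
  The symmetric algebra of \<open>k\<^sup>2\<close> is the polynomial ring \<open>k[e\<^sub>1, e\<^sub>2]\<close> on the standard basis of \<open>k\<^sup>2\<close>,
  encoded as \<^typ>\<open>'k poly poly\<close> with \<open>e\<^sub>1\<close> the inner and \<open>e\<^sub>2\<close> the outer variable:
  \<open>coeff (coeff F i) j\<close> is the coefficient of \<open>e\<^sub>1\<^sup>j e\<^sub>2\<^sup>i\<close>.
\<close>

definition form_scale :: "'k::field \<Rightarrow> 'k poly poly \<Rightarrow> 'k poly poly" where
  "form_scale c F = smult [:c:] F"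

interpretation form: vector_space "form_scale :: 'k::field \<Rightarrow> 'k poly poly \<Rightarrow> 'k poly poly"
  by unfold_locales
    (simp_all add: form_scale_def smult_add_right mult.commute flip: smult_add_left one_pCons)

definition Sym :: "nat \<Rightarrow> 'k::field poly poly set" where
  "Sym d = {F. \<forall>i j. coeff (coeff F i) j \<noteq> 0 \<longrightarrow> i + j = d}"

text \<open>The inclusion of \<open>k\<^sup>2\<close> as the degree-one part of its symmetric algebra.\<close>

definition lin :: "'k::field ^ 2 \<Rightarrow> 'k poly poly" where
  "lin v = [:[:0, v $ 1:], [:v $ 2:]:]"


text \<open>
  The algebra endomorphism of \<open>k[e\<^sub>1, e\<^sub>2]\<close> sending \<open>e\<^sub>1\<close>, \<open>e\<^sub>2\<close> to \<open>g e\<^sub>1\<close>, \<open>g e\<^sub>2\<close>.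
\<close>

definition sym_act :: "'k::field ^ 2 ^ 2 \<Rightarrow> 'k poly poly \<Rightarrow> 'k poly poly" where
  "sym_act g F = (\<Sum>i\<le>degree F. \<Sum>j\<le>degree (coeff F i).
     form_scale (coeff (coeff F i) j) (lin (g *v axis 1 1) ^ j * lin (g *v axis 2 1) ^ i))"

definition GL2_orbit :: "'k::field poly poly set \<Rightarrow> 'k poly poly set set" where
  "GL2_orbit S = {sym_act g ` S | g. invertible g}"


definition Grassmannian :: "nat \<Rightarrow> 'k::field poly poly set \<Rightarrow> 'k poly poly set set" where
  "Grassmannian n V = {S. form.subspace S \<and> S \<subseteq> V \<and> form.dim S = n}"

definition ordered_basis :: "nat \<Rightarrow> 'k::field poly poly set \<Rightarrow> (nat \<Rightarrow> 'k poly poly) \<Rightarrow> bool" where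
  "ordered_basis n S f \<longleftrightarrow>
     inj_on f {..<n} \<and> form.independent (f ` {..<n}) \<and> form.span (f ` {..<n}) = S"

text \<open>
  Pluecker coordinates on \<open>Gr(n, Sym\<^sup>d k\<^sup>2)\<close>, with respect to the monomial basis
  \<open>e\<^sub>1\<^sup>d\<^sup>-\<^sup>m e\<^sub>2\<^sup>m\<close> (\<open>0 \<le> m \<le> d\<close>), are indexed by the \<open>n\<close>-element subsets of \<open>{0..d}\<close>.
\<close>

definition pluecker_index :: "nat \<Rightarrow> nat \<Rightarrow> nat set set" where
  "pluecker_index n d = {I. I \<subseteq> {..d} \<and> card I = n}"

definition pluecker ::
    "nat \<Rightarrow> nat \<Rightarrow> (nat \<Rightarrow> 'k::field poly poly) \<Rightarrow> nat set \<Rightarrow> 'k" where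
  "pluecker n d f I = Determinant.det (Matrix.mat n n
     (\<lambda>(i, j). let m = sorted_list_of_set I ! j in coeff (coeff (f i) m) (d - m)))"

text \<open>
  \<^typ>\<open>('x \<Rightarrow>\<^sub>0 nat) \<Rightarrow>\<^sub>0 'k\<close> is the polynomial ring over \<open>'k\<close> with variables \<open>'x\<close>: finitely supported
  functions from monomials (finitely supported exponent functions) to coefficients.
\<close>

definition mpoly_eval :: "(('x \<Rightarrow>\<^sub>0 nat) \<Rightarrow>\<^sub>0 'k::field) \<Rightarrow> ('x \<Rightarrow> 'k) \<Rightarrow> 'k" where
  "mpoly_eval P x = (\<Sum>m\<in>Poly_Mapping.keys P.
     Poly_Mapping.lookup P m * (\<Prod>i\<in>Poly_Mapping.keys m. x i ^ Poly_Mapping.lookup m i))"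

definition homogeneous_in :: "'x set \<Rightarrow> (('x \<Rightarrow>\<^sub>0 nat) \<Rightarrow>\<^sub>0 'k::field) \<Rightarrow> bool" where
  "homogeneous_in X P \<longleftrightarrow>
     (\<exists>e. \<forall>m\<in>Poly_Mapping.keys P. Poly_Mapping.keys m \<subseteq> X \<and>
       (\<Sum>i\<in>Poly_Mapping.keys m. Poly_Mapping.lookup m i) = e)"

text \<open>
  Different ordered bases of \<open>S\<close> give proportional Pluecker vectors, so for homogeneous \<open>P\<close> the
  choice of basis below is immaterial.
\<close>

definition principal_open ::
    "nat \<Rightarrow> nat \<Rightarrow> ((nat set \<Rightarrow>\<^sub>0 nat) \<Rightarrow>\<^sub>0 'k::field) \<Rightarrow> 'k poly poly set set" where
  "principal_open n d P = {S \<in> Grassmannian n (Sym d).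
     \<exists>f. ordered_basis n S f \<and> mpoly_eval P (pluecker n d f) \<noteq> 0}"

text \<open>
  The Zariski topology on \<open>Gr(n, Sym\<^sup>d k\<^sup>2)\<close>, induced by the Pluecker embedding. The principal open
  sets are closed under finite intersection (products of polynomials), hence form a basis; the
  constant polynomial 1 gives the whole Grassmannian.
\<close>

definition zariski_Gr :: "nat \<Rightarrow> nat \<Rightarrow> 'k::field poly poly set topology" where
  "zariski_Gr n d = topology_generated_by
     {principal_open n d P | P. homogeneous_in (pluecker_index n d) P}"


text \<open>
  The point \<open>[v]\<close> of the projective line is represented by a nonzero vector \<open>v\<close>.
\<close>

definition vanishes_to_order :: "'k::field poly poly \<Rightarrow> 'k ^ 2 \<Rightarrow> nat \<Rightarrow> bool" where
  "vanishes_to_order F v a \<longleftrightarrow>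
     F \<noteq> 0 \<and> lin v ^ a dvd F \<and> (\<forall>b. lin v ^ b dvd F \<longrightarrow> b \<le> a)"

definition vanishing_sequence ::
    "nat \<Rightarrow> 'k::field poly poly set \<Rightarrow> 'k ^ 2 \<Rightarrow> (nat \<Rightarrow> nat) \<Rightarrow> bool" where
  "vanishing_sequence r S v a \<longleftrightarrow>
     strict_mono_on {..r} a \<and> (\<forall>i\<le>r. \<exists>F\<in>S. vanishes_to_order F v (a i))"

definition is_basis2 :: "'k::field ^ 2 \<Rightarrow> 'k ^ 2 \<Rightarrow> bool" where
  "is_basis2 w1 w2 \<longleftrightarrow>
     w1 \<noteq> w2 \<and> vec.independent {w1, w2} \<and> vec.span {w1, w2} = UNIV"

definition monomial_subspace ::
    "nat \<Rightarrow> nat \<Rightarrow> (nat \<Rightarrow> nat) \<Rightarrow> 'k::field ^ 2 \<Rightarrow> 'k ^ 2 \<Rightarrow> 'k poly poly set" where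
  "monomial_subspace d r a w1 w2 =
     form.span ((\<lambda>i. lin w1 ^ (d - a i) * lin w2 ^ a i) ` {..r})"

end

theory Submission
  imports Defs
begin

text \<open>
  Suppose \<open>T\<close> lies in the closure of the orbit of \<open>S\<close>. A matrix \<open>g\<close> with four independent
  indeterminates as entries translates \<open>S\<close> to a subspace over the field \<open>K\<close> of rational functions.
  Every homogeneous polynomial in the Pluecker coordinates that vanishes at \<open>g S\<close> vanishes on the
  orbit, hence at \<open>T\<close>, so mapping the ratios of the Pluecker coordinates of \<open>g S\<close> to those of \<open>T\<close>
  is a well-defined ring homomorphism. By Zorn's lemma it extends to a place of \<open>K\<close> with residue
  field \<open>k\<close>, and \<open>T\<close> is the reduction of \<open>g S\<close> at this place. Elimination writes \<open>g\<close>, up to a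
  scalar, as the product of a matrix that is invertible over the valuation ring, one of the matrices
  \<open>1\<close>, \<open>diag(1, s)\<close>, \<open>(1, s; 0, s t)\<close> with \<open>s\<close>, \<open>t\<close> in the maximal ideal, and a constant matrix.
  Up to translation, the reduction in these three cases is \<open>S\<close>, the monomial subspace of the
  vanishing sequence at a point, and the monomial subspace with exponents \<open>0, \<dots>, r\<close>, which is the
  vanishing sequence at a general point. Only the third case uses the assumption on the
  characteristic: it makes the binomial determinants \<open>det (a\<^sub>i choose j)\<close> nonzero. Conversely, the
  monomial subspaces are limits of one-parameter families of translates of \<open>S\<close>.
\<close>

section \<open>Homomorphisms defined on subrings\<close>

text \<open>The elimination is asymmetric. A left factor invertible over the valuation ring only
  translates the reduction, but a right factor acts on \<open>S\<close> before reduction, and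
  \<open>S\<close> has constant coefficients: only a constant right factor turns \<open>S\<close>
  into another subspace of the same kind. A decomposition with a diagonal middle factor and two
  integral outer factors is therefore of no help, and (1, s; 0, s t) is what remains when neither
  side can clear the off-diagonal entry. It is the product of diag(1, t), a constant unipotent
  matrix and diag(1, s), so its reduction consists of two successive degenerations.

  The place does not construct a limit. The reduction of \<open>g S\<close> is found by explicit
  frames, for every invertible matrix over \<open>K\<close>; the place only ensures that the ratios
  of Pluecker coordinates reduce to those of \<open>T\<close>, and proportional Pluecker coordinates
  determine the same subspace. An abstract place thus replaces a curve through \<open>T\<close>, at
  the price of an arbitrary value group: entries are compared only by asking which quotients lie in
  \<open>V\<close>.\<close>

locale subring_hom =
  fixes A :: "'a::comm_ring_1 set" and h :: "'a \<Rightarrow> 'b::comm_ring_1"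
  assumes one_mem: "1 \<in> A"
    and add_mem: "x \<in> A \<Longrightarrow> y \<in> A \<Longrightarrow> x + y \<in> A"
    and neg_mem: "x \<in> A \<Longrightarrow> - x \<in> A"
    and mult_mem: "x \<in> A \<Longrightarrow> y \<in> A \<Longrightarrow> x * y \<in> A"
    and hom_one: "h 1 = 1"
    and hom_add: "x \<in> A \<Longrightarrow> y \<in> A \<Longrightarrow> h (x + y) = h x + h y"
    and hom_mult: "x \<in> A \<Longrightarrow> y \<in> A \<Longrightarrow> h (x * y) = h x * h y"
begin

lemma zero_mem: "0 \<in> A"
  using add_mem[OF one_mem neg_mem[OF one_mem]] by simp

lemma hom_zero: "h 0 = 0"
  using hom_add[OF zero_mem zero_mem] by simp

lemma hom_neg: "x \<in> A \<Longrightarrow> h (- x) = - h x"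
  using hom_add[of x "- x"] neg_mem[of x] hom_zero by (simp add: eq_neg_iff_add_eq_0 add.commute)

lemma diff_mem: "x \<in> A \<Longrightarrow> y \<in> A \<Longrightarrow> x - y \<in> A"
  using add_mem[of x "- y"] neg_mem[of y] by simp

lemma hom_diff: "x \<in> A \<Longrightarrow> y \<in> A \<Longrightarrow> h (x - y) = h x - h y"
  using hom_add[of x "- y"] neg_mem[of y] hom_neg[of y] by simp

lemma sum_mem_hom:
  "(\<And>i. i \<in> I \<Longrightarrow> f i \<in> A) \<Longrightarrow> sum f I \<in> A \<and> h (sum f I) = (\<Sum>i\<in>I. h (f i))"
  by (induction I rule: infinite_finite_induct) (auto simp: zero_mem hom_zero add_mem hom_add)

lemmas sum_mem = sum_mem_hom[THEN conjunct1]
lemmas hom_sum = sum_mem_hom[THEN conjunct2]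

lemma prod_mem_hom:
  "(\<And>i. i \<in> I \<Longrightarrow> f i \<in> A) \<Longrightarrow> prod f I \<in> A \<and> h (prod f I) = (\<Prod>i\<in>I. h (f i))"
  by (induction I rule: infinite_finite_induct) (auto simp: one_mem hom_one mult_mem hom_mult)

lemmas prod_mem = prod_mem_hom[THEN conjunct1]
lemmas hom_prod = prod_mem_hom[THEN conjunct2]

lemma power_mem_hom: "x \<in> A \<Longrightarrow> x ^ n \<in> A \<and> h (x ^ n) = h x ^ n"
  by (induction n) (auto simp: one_mem hom_one mult_mem hom_mult)

lemmas power_mem = power_mem_hom[THEN conjunct1]
lemmas hom_power = power_mem_hom[THEN conjunct2]

lemma of_nat_mem_hom: "of_nat n \<in> A \<and> h (of_nat n) = of_nat n"
  by (induction n) (auto simp: zero_mem hom_zero one_mem hom_one add_mem hom_add)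

text \<open>By the Leibniz formula a determinant is a signed sum of products of entries, so it
  commutes with \<open>h\<close>. This makes Pluecker coordinates compatible with every change of
  scalars below.\<close>

lemma det_mem_hom:
  assumes "M \<in> carrier_mat n n" and ent: "\<And>i j. i < n \<Longrightarrow> j < n \<Longrightarrow> M $$ (i, j) \<in> A"
  shows "Determinant.det M \<in> A \<and> h (Determinant.det M) = Determinant.det (map_mat h M)"
proof -
  have sgn: "(signof p :: 'a) \<in> A \<and> h (signof p) = signof p" for p :: "nat \<Rightarrow> nat"
    by (auto simp: sign_def one_mem hom_one neg_mem hom_neg)
  have p: "M $$ (i, p i) \<in> A" if "p permutes {0..<n}" "i < n" for p i
    using that ent[OF that(2), of "p i"] permutes_in_image[OF that(1), of i] by simp
  have pr: "(\<Prod>i = 0..<n. M $$ (i, p i)) \<in> A \<and>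
      h (\<Prod>i = 0..<n. M $$ (i, p i)) = (\<Prod>i = 0..<n. map_mat h M $$ (i, p i))"
    if q: "p permutes {0..<n}" for p
  proof -
    have "h (M $$ (i, p i)) = map_mat h M $$ (i, p i)" if "i \<in> {0..<n}" for i
      using assms(1) that permutes_in_image[OF q, of i] by auto
    then show ?thesis
      using prod_mem_hom[of "{0..<n}" "\<lambda>i. M $$ (i, p i)"] p[OF q]
      by (auto intro!: prod.cong)
  qed
  have M': "map_mat h M \<in> carrier_mat n n"
    using assms(1) by simp
  show ?thesis
    unfolding det_def'[OF assms(1)] det_def'[OF M']
    using sum_mem_hom[of "{p. p permutes {0..<n}}" "\<lambda>p. signof p * (\<Prod>i = 0..<n. M $$ (i, p i))"]
      sgn pr by (auto simp: mult_mem hom_mult intro!: sum.cong)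
qed

end

definition coeffs_in :: "'a::zero set \<Rightarrow> 'a poly set" where
  "coeffs_in A = {p. \<forall>i. coeff p i \<in> A}"

lemma subring_hom_map_poly:
  assumes "subring_hom A h"
  shows "subring_hom (coeffs_in A) (map_poly h)"
proof -
  interpret subring_hom A h by fact
  have c: "coeff (map_poly h p) i = h (coeff p i)" for p i
    by (rule coeff_map_poly) (rule hom_zero)
  show ?thesis
  proof
    show "(1 :: 'a poly) \<in> coeffs_in A"
      by (auto simp: coeffs_in_def coeff_1 zero_mem one_mem)
    show "map_poly h 1 = 1"
      by (rule poly_eqI) (simp add: c coeff_1 hom_zero hom_one)
  next
    fix p q assume "p \<in> coeffs_in A" "q \<in> coeffs_in A"
    then have pq: "coeff p i \<in> A" "coeff q i \<in> A" for i
      by (auto simp: coeffs_in_def)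
    show "p + q \<in> coeffs_in A" "p * q \<in> coeffs_in A" "- p \<in> coeffs_in A"
      by (auto simp: coeffs_in_def coeff_mult pq intro!: add_mem neg_mem sum_mem mult_mem)
    show "map_poly h (p + q) = map_poly h p + map_poly h q"
      by (rule poly_eqI) (simp add: c hom_add pq)
    show "map_poly h (p * q) = map_poly h p * map_poly h q"
      by (rule poly_eqI) (simp add: c coeff_mult hom_sum hom_mult mult_mem pq)
  qed
qed

section \<open>Extension of homomorphisms to valuation rings\<close>

text \<open>A homomorphism on a subring is kept as its graph, single-valued by \<open>zeroD\<close>.
  Extension is then inclusion, and the union of a chain is again a graph, as Zorn's lemma
  requires.\<close>

locale hom_graph =
  fixes G :: "('a::comm_ring_1 \<times> 'b::comm_ring_1) set"
  assumes one: "(1, 1) \<in> G"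
    and add: "(x, y) \<in> G \<Longrightarrow> (x', y') \<in> G \<Longrightarrow> (x + x', y + y') \<in> G"
    and neg: "(x, y) \<in> G \<Longrightarrow> (- x, - y) \<in> G"
    and mult: "(x, y) \<in> G \<Longrightarrow> (x', y') \<in> G \<Longrightarrow> (x * x', y * y') \<in> G"
    and zeroD: "(0, y) \<in> G \<Longrightarrow> y = 0"
begin

lemma zero: "(0, 0) \<in> G"
  using add[OF one neg[OF one]] by simp

lemma diff: "(x, y) \<in> G \<Longrightarrow> (x', y') \<in> G \<Longrightarrow> (x - x', y - y') \<in> G"
  using add[of x y "- x'" "- y'"] neg[of x' y'] by simp

lemma unique: "(x, y) \<in> G \<Longrightarrow> (x, y') \<in> G \<Longrightarrow> y = y'"
  using diff[of x y x y'] zeroD[of "y - y'"] by simp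

lemma sum: "(\<And>i. i \<in> I \<Longrightarrow> (f i, g i) \<in> G) \<Longrightarrow> (sum f I, sum g I) \<in> G"
  by (induction I rule: infinite_finite_induct) (auto simp: zero add)

lemma power: "(x, y) \<in> G \<Longrightarrow> (x ^ n, y ^ n) \<in> G"
  by (induction n) (auto simp: one mult)

end

text \<open>The graph of the homomorphism applied to coefficients; the image \<open>q\<close> may
  have smaller degree than \<open>p\<close>.\<close>

definition poly_graph :: "('a::comm_ring_1 \<times> 'b::comm_ring_1) set \<Rightarrow> ('a poly \<times> 'b poly) set" where
  "poly_graph G = {(p, q). \<forall>i. (coeff p i, coeff q i) \<in> G}"

lemma poly_graph_mult:
  "hom_graph G \<Longrightarrow> (p, q) \<in> poly_graph G \<Longrightarrow> (p', q') \<in> poly_graph G \<Longrightarrow> (p * p', q * q') \<in> poly_graph G"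
  by (auto simp: poly_graph_def coeff_mult intro!: hom_graph.sum hom_graph.mult)

lemma poly_graph_add:
  "hom_graph G \<Longrightarrow> (p, q) \<in> poly_graph G \<Longrightarrow> (p', q') \<in> poly_graph G \<Longrightarrow> (p + p', q + q') \<in> poly_graph G"
  by (auto simp: poly_graph_def intro!: hom_graph.add)

lemma poly_graph_diff:
  "hom_graph G \<Longrightarrow> (p, q) \<in> poly_graph G \<Longrightarrow> (p', q') \<in> poly_graph G \<Longrightarrow> (p - p', q - q') \<in> poly_graph G"
  by (auto simp: poly_graph_def intro!: hom_graph.diff)

lemma poly_graph_neg:
  "hom_graph G \<Longrightarrow> (p, q) \<in> poly_graph G \<Longrightarrow> (- p, - q) \<in> poly_graph G"
  by (auto simp: poly_graph_def intro!: hom_graph.neg)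

lemma poly_graph_pCons:
  "(a, b) \<in> G \<Longrightarrow> (p, q) \<in> poly_graph G \<Longrightarrow> (pCons a p, pCons b q) \<in> poly_graph G"
  by (auto simp: poly_graph_def coeff_pCons split: nat.splits)

lemma poly_graph_zero: "hom_graph G \<Longrightarrow> (0, 0) \<in> poly_graph G"
  by (auto simp: poly_graph_def hom_graph.zero)

lemma poly_graph_monom: "hom_graph G \<Longrightarrow> (a, b) \<in> G \<Longrightarrow> (monom a n, monom b n) \<in> poly_graph G"
  by (auto simp: poly_graph_def hom_graph.zero)

definition adjoin_graph ::
    "('a::comm_ring_1 \<times> 'b::comm_ring_1) set \<Rightarrow> 'a \<Rightarrow> 'b \<Rightarrow> ('a \<times> 'b) set" where
  "adjoin_graph G x c = {(poly p x, poly q c) | p q. (p, q) \<in> poly_graph G}"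

text \<open>\<open>x\<close> can be sent to \<open>c\<close> as soon as every polynomial relation of
  \<open>x\<close> goes to a relation of \<open>c\<close>: this is \<open>ker\<close>, and it gives
  single-valuedness on the polynomials in \<open>x\<close>.\<close>

lemma adjoin_graph:
  assumes G: "hom_graph G"
    and ker: "\<And>p q. (p, q) \<in> poly_graph G \<Longrightarrow> poly p x = 0 \<Longrightarrow> poly q c = 0"
  shows "hom_graph (adjoin_graph G x c)" "G \<subseteq> adjoin_graph G x c" "(x, c) \<in> adjoin_graph G x c"
proof -
  have mem: "(poly p x, poly q c) \<in> adjoin_graph G x c" if "(p, q) \<in> poly_graph G" for p q
    using that by (auto simp: adjoin_graph_def)
  have const: "(a, b) \<in> adjoin_graph G x c" if "(a, b) \<in> G" for a b
    using mem[OF poly_graph_pCons[OF that poly_graph_zero[OF G]]] by simp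
  show "G \<subseteq> adjoin_graph G x c"
    using const by auto
  show "(x, c) \<in> adjoin_graph G x c"
    using mem[OF poly_graph_monom[OF G hom_graph.one[OF G], of 1]] by (simp add: poly_monom)
  show "hom_graph (adjoin_graph G x c)"
  proof
    show "(1, 1) \<in> adjoin_graph G x c"
      using const hom_graph.one[OF G] by blast
  next
    fix a b a' b' assume "(a, b) \<in> adjoin_graph G x c" "(a', b') \<in> adjoin_graph G x c"
    then obtain p q p' q' where pq: "(p, q) \<in> poly_graph G" "a = poly p x" "b = poly q c"
       "(p', q') \<in> poly_graph G" "a' = poly p' x" "b' = poly q' c"
      by (auto simp: adjoin_graph_def)
    show "(a + a', b + b') \<in> adjoin_graph G x c"
      using mem[OF poly_graph_add[OF G pq(1) pq(4)]] pq by simp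
    show "(a * a', b * b') \<in> adjoin_graph G x c"
      using mem[OF poly_graph_mult[OF G pq(1) pq(4)]] pq by simp
  next
    fix a b assume "(a, b) \<in> adjoin_graph G x c"
    then obtain p q where pq: "(p, q) \<in> poly_graph G" "a = poly p x" "b = poly q c"
      by (auto simp: adjoin_graph_def)
    show "(- a, - b) \<in> adjoin_graph G x c"
      using mem[OF poly_graph_neg[OF G pq(1)]] pq by simp
  next
    fix y assume "(0, y) \<in> adjoin_graph G x c"
    then show "y = 0"
      using ker by (auto simp: adjoin_graph_def)
  qed
qed

lemma poly_inverse_reflect:
  fixes u :: "'a::field"
  assumes "u \<noteq> 0" "degree p \<le> n"
  shows "u ^ n * poly p (inverse u) = (\<Sum>i\<le>n. coeff p i * u ^ (n - i))"
proof -
  have "poly p (inverse u) = (\<Sum>i\<le>n. coeff p i * inverse u ^ i)"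
    unfolding poly_altdef using assms(2)
    by (intro sum.mono_neutral_left) (auto simp: coeff_eq_0)
  moreover have "u ^ n * (coeff p i * inverse u ^ i) = coeff p i * u ^ (n - i)" if "i \<le> n" for i
    using assms(1) that by (simp add: power_diff field_simps)
  then have "(\<Sum>i\<le>n. u ^ n * (coeff p i * inverse u ^ i)) = (\<Sum>i\<le>n. coeff p i * u ^ (n - i))"
    by (intro sum.cong) auto
  ultimately show ?thesis
    by (simp only: sum_distrib_left)
qed

text \<open>Multiplying a relation of \<open>inverse u\<close> by a power of \<open>u\<close> gives
  a relation inside the domain of \<open>G\<close>, where \<open>zeroD\<close> applies. Hence
  elements of nonzero value are units in a maximal domain.\<close>

lemma adjoin_inverse_ker:
  fixes G :: "('a::field \<times> 'b::field) set"
  assumes G: "hom_graph G" and ub: "(u, b) \<in> G" "b \<noteq> 0"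
    and pq: "(p, q) \<in> poly_graph G" and p0: "poly p (inverse u) = 0"
  shows "poly q (inverse b) = 0"
proof -
  define n where "n = max (degree p) (degree q)"
  have u0: "u \<noteq> 0"
    using ub hom_graph.zeroD[OF G] by auto
  have "(\<Sum>i\<le>n. coeff p i * u ^ (n - i), \<Sum>i\<le>n. coeff q i * b ^ (n - i)) \<in> G"
    using pq by (intro hom_graph.sum[OF G] hom_graph.mult[OF G] hom_graph.power[OF G] ub)
      (auto simp: poly_graph_def)
  moreover have "(\<Sum>i\<le>n. coeff p i * u ^ (n - i)) = 0"
    using poly_inverse_reflect[OF u0, of p n] p0 by (simp add: n_def)
  ultimately have "(\<Sum>i\<le>n. coeff q i * b ^ (n - i)) = 0"
    using hom_graph.zeroD[OF G] by simp
  then show ?thesis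
    using poly_inverse_reflect[OF ub(2), of q n] ub(2) by (simp add: n_def)
qed

text \<open>
  If the kernel of the homomorphism generates the unit ideal both after adjoining \<open>x\<close> and after
  adjoining \<open>x\<^sup>-\<^sup>1\<close>, then one of the two relations of minimal degree can be used to shorten the other.
\<close>

lemma unit_relation_shorten:
  fixes G :: "('a::field \<times> 'b::field) set"
  assumes G: "hom_graph G" and x: "x \<noteq> 0"
    and p: "(p, 1) \<in> poly_graph G" "poly p x = 0"
    and p': "(p', 1) \<in> poly_graph G" "poly p' (inverse x) = 0"
    and le: "degree p' \<le> degree p"
  shows "\<exists>r. (r, 1) \<in> poly_graph G \<and> poly r x = 0 \<and> degree r < degree p"
proof -
  interpret hom_graph G by fact
  define n where "n = degree p"
  define m where "m = degree p'"
  have cp: "(coeff p i, if i = 0 then 1 else 0) \<in> G" for i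
    using p(1) by (auto simp: poly_graph_def coeff_1 split: if_splits dest: spec[of _ i])
  have cp': "(coeff p' i, if i = 0 then 1 else 0) \<in> G" for i
    using p'(1) by (auto simp: poly_graph_def coeff_1 split: if_splits dest: spec[of _ i])
  have n: "n > 0"
  proof (rule ccontr)
    assume "\<not> n > 0"
    then obtain a where "p = [:a:]"
      by (auto simp: n_def elim: degree_eq_zeroE)
    with p(2) cp[of 0] zeroD[of 1] show False
      by simp
  qed
  \<comment> \<open>\<open>q\<close> is \<open>x ^ n * p' (1/x)\<close> as a polynomial in
    \<open>x\<close>, with coefficient \<open>coeff p' 0\<close> in degree \<open>n\<close>, so the
    terms of degree \<open>n\<close> cancel in \<open>r\<close>. As \<open>coeff p' 0\<close> has
    value 1 and \<open>coeff p n\<close> has value 0, the image of \<open>r\<close> is still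
    1.\<close>
  define q where "q = monom 1 (n - m) * reflect_poly p'"
  define r where "r = smult (coeff p' 0) p - smult (coeff p n) q"
  have cq: "coeff q i = (if i < n - m \<or> i > n then 0 else coeff p' (n - i))" for i
    using le by (auto simp: q_def coeff_monom_mult coeff_reflect_poly n_def m_def)
  have "poly r x = 0"
    using p(2) p'(2) x by (simp add: r_def q_def poly_reflect_poly_nz)
  moreover have "(r, 1) \<in> poly_graph G"
    unfolding poly_graph_def mem_Collect_eq prod.case
  proof
    fix i
    have "\<exists>z. (coeff q i, z) \<in> G"
      unfolding cq using cp' zero by auto
    then obtain z where z: "(coeff q i, z) \<in> G" ..
    have "(coeff p n, 0) \<in> G" "(coeff p' 0, 1) \<in> G"
      using cp[of n] cp'[of 0] n by auto
    then have "(coeff p' 0 * coeff p i - coeff p n * coeff q i, 1 * (if i = 0 then 1 else 0) - 0 * z) \<in> G"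
      by (intro diff mult cp z)
    then show "(coeff r i, coeff 1 i) \<in> G"
      by (cases "i = 0") (simp_all add: r_def coeff_1)
  qed
  moreover have "degree r < n"
  proof -
    have "coeff r i = 0" if "i \<ge> n" for i
    proof (cases "i = n")
      case True
      then show ?thesis using n by (simp add: r_def cq)
    next
      case False
      then show ?thesis using that by (simp add: r_def cq coeff_eq_0 n_def)
    qed
    then show ?thesis
      using n by (metis degree_0 leading_coeff_neq_0 not_le)
  qed
  ultimately show ?thesis
    unfolding n_def by blast
qed

text \<open>Infinite descent on the sum of the degrees: the relation of larger degree is shortened
  by means of the other, and \<open>x\<close> and \<open>inverse x\<close> play symmetric
  roles.\<close>

lemma no_unit_relations:
  fixes G :: "('a::field \<times> 'b::field) set"
  assumes G: "hom_graph G" and "x \<noteq> 0"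
    and "(p, 1) \<in> poly_graph G" "poly p x = 0"
    and "(p', 1) \<in> poly_graph G" "poly p' (inverse x) = 0"
  shows False
  using assms(2-)
proof (induction "degree p + degree p'" arbitrary: p p' rule: less_induct)
  case less
  show ?case
  proof (cases "degree p' \<le> degree p")
    case True
    then obtain r where "(r, 1) \<in> poly_graph G" "poly r x = 0" "degree r < degree p"
      using unit_relation_shorten[OF G less.prems] by blast
    then show ?thesis
      using less.hyps[of r p'] less.prems by simp
  next
    case False
    then obtain r where "(r, 1) \<in> poly_graph G" "poly r (inverse x) = 0" "degree r < degree p'"
      using unit_relation_shorten[OF G, of "inverse x" p' p] less.prems by auto
    then show ?thesis
      using less.hyps[of p r] less.prems by simp
  qed
qed

text \<open>
  A value for \<open>x\<close> is a common root of the polynomials obtained by applying the homomorphism to the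
  coefficients of the relations satisfied by \<open>x\<close>.
\<close>

lemma adjoin_value:
  fixes G :: "('a::field \<times> 'b::alg_closed_field) set"
  assumes G: "hom_graph G" and const: "\<And>c. (\<iota> c, c) \<in> G"
    and nounit: "\<nexists>p. (p, 1) \<in> poly_graph G \<and> poly p x = 0"
  shows "\<exists>c. \<forall>p q. (p, q) \<in> poly_graph G \<longrightarrow> poly p x = 0 \<longrightarrow> poly q c = 0"
proof -
  define I where "I = {q. \<exists>p. (p, q) \<in> poly_graph G \<and> poly p x = 0}"
  \<comment> \<open>Every element of the target field is the value of a constant, so polynomials
    over it lift. Hence \<open>I\<close> is an ideal of the full polynomial ring, not merely of an
    image.\<close>
  have lift: "\<exists>p. (p, q) \<in> poly_graph G" for q
  proof (induction q)
    case 0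
    then show ?case using poly_graph_zero[OF G] by blast
  next
    case (pCons c q)
    then show ?case using poly_graph_pCons[OF const[of c]] by blast
  qed
  have mult_I: "s * q \<in> I" if q: "q \<in> I" for s q
  proof -
    obtain p where "(p, q) \<in> poly_graph G" "poly p x = 0"
      using q by (auto simp: I_def)
    moreover obtain p' where "(p', s) \<in> poly_graph G"
      using lift by blast
    ultimately show ?thesis
      unfolding I_def using poly_graph_mult[OF G, of p' s p q] by fastforce
  qed
  have diff_I: "q - q' \<in> I" if qq: "q \<in> I" "q' \<in> I" for q q'
  proof -
    obtain p p' where "(p, q) \<in> poly_graph G" "poly p x = 0" "(p', q') \<in> poly_graph G" "poly p' x = 0"
      using qq by (auto simp: I_def)
    then show ?thesis
      unfolding I_def using poly_graph_diff[OF G, of p q p' q'] by fastforce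
  qed
  have one: "1 \<notin> I"
    using nounit by (simp add: I_def)
  have "\<exists>c. \<forall>q\<in>I. poly q c = 0"
  proof (cases "I \<subseteq> {0}")
    case True
    then have "poly q 0 = 0" if "q \<in> I" for q
      using that by auto
    then show ?thesis by blast
  next
    case False
    then obtain q1 where "q1 \<in> I \<and> q1 \<noteq> 0" by blast
    then obtain q0 where q0: "q0 \<in> I" "q0 \<noteq> 0" and min: "\<And>q. q \<in> I \<Longrightarrow> q \<noteq> 0 \<Longrightarrow> degree q0 \<le> degree q"
      using ex_has_least_nat[of "\<lambda>q. q \<in> I \<and> q \<noteq> 0" q1 degree] by blast
    have dvd: "q0 dvd q" if "q \<in> I" for q
    proof -
      have "q mod q0 = q - q div q0 * q0"
        by (simp add: minus_div_mult_eq_mod)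
      then have "q mod q0 \<in> I"
        using diff_I[OF that mult_I[OF q0(1)]] by simp
      then have "q mod q0 = 0"
        using min[of "q mod q0"] degree_mod_less[OF q0(2), of q] by force
      then show ?thesis by auto
    qed
    \<comment> \<open>The generator of a proper ideal is not constant, so it has a root, and this is
      a common root of the whole ideal.\<close>
    have "degree q0 > 0"
    proof (rule ccontr)
      assume "\<not> degree q0 > 0"
      then obtain a where a: "q0 = [:a:]"
        by (auto elim: degree_eq_zeroE)
      then have "[:inverse a:] * q0 = 1"
        using q0(2) by (simp add: one_pCons)
      with mult_I[OF q0(1), of "[:inverse a:]"] one show False by simp
    qed
    then obtain c where "poly q0 c = 0"
      using alg_closed_imp_poly_has_root by blast
    then have "poly q c = 0" if "q \<in> I" for q
      using dvd[OF that] by (auto elim!: dvdE)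
    then show ?thesis by blast
  qed
  then show ?thesis
    unfolding I_def by blast
qed

text \<open>\<open>h\<close> is reduction to the residue field and \<open>\<iota>\<close> splits it,
  so the residue field is the field of constants. By \<open>inverse_mem\<close> the kernel of
  \<open>h\<close> is the set of non-units of \<open>V\<close>.\<close>

locale place =
  subring_hom V h for V :: "'K::field set" and h :: "'K \<Rightarrow> 'k::field" +
  fixes \<iota> :: "'k \<Rightarrow> 'K"
  assumes const_mem: "\<iota> c \<in> V"
    and hom_const: "h (\<iota> c) = c"
    and const_hom: "subring_hom UNIV \<iota>"
    and inverse_mem: "x \<in> V \<Longrightarrow> h x \<noteq> 0 \<Longrightarrow> inverse x \<in> V"
    and valuation: "x \<notin> V \<Longrightarrow> inverse x \<in> V"

text \<open>Chevalley's extension theorem; the residue field is already algebraically closed and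
  does not have to grow. In a maximal graph, any element for which a value can be found lies in the
  domain. An \<open>x\<close> outside therefore satisfies a relation whose image is 1; then
  \<open>inverse x\<close> satisfies none, and a value for it exists.\<close>

theorem place_extension:
  fixes G0 :: "('K::field \<times> 'k::alg_closed_field) set"
  assumes G0: "hom_graph G0" and \<iota>: "subring_hom UNIV \<iota>" and const: "\<And>c. (\<iota> c, c) \<in> G0"
  obtains V h where "place V h \<iota>" "\<And>x y. (x, y) \<in> G0 \<Longrightarrow> x \<in> V \<and> h x = y"
proof -
  define \<A> where "\<A> = {G :: ('K \<times> 'k) set. hom_graph G \<and> G0 \<subseteq> G}"
  have "\<exists>M\<in>\<A>. \<forall>X\<in>\<A>. M \<subseteq> X \<longrightarrow> X = M"
  proof (rule subset_Zorn_nonempty)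
    show "\<A> \<noteq> {}"
      using G0 by (auto simp: \<A>_def)
  next
    fix \<C> assume ne: "\<C> \<noteq> {}" and ch: "subset.chain \<A> \<C>"
    have in_A: "hom_graph G" "G0 \<subseteq> G" if "G \<in> \<C>" for G
      using ch that by (auto simp: subset.chain_def \<A>_def)
    have joint: "\<exists>G\<in>\<C>. a \<in> G \<and> b \<in> G" if "a \<in> \<Union>\<C>" "b \<in> \<Union>\<C>" for a b
      using that ch unfolding subset_chain_def by blast
    have "hom_graph (\<Union>\<C>)"
    proof
      show "(1, 1) \<in> \<Union>\<C>"
        using ne in_A hom_graph.one by blast
    next
      fix x y x' y' assume "(x, y) \<in> \<Union>\<C>" "(x', y') \<in> \<Union>\<C>"
      then obtain G where "G \<in> \<C>" "(x, y) \<in> G" "(x', y') \<in> G"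
        using joint by blast
      then show "(x + x', y + y') \<in> \<Union>\<C>" "(x * x', y * y') \<in> \<Union>\<C>"
        using hom_graph.add hom_graph.mult in_A by blast+
    next
      fix x y assume "(x, y) \<in> \<Union>\<C>"
      then show "(- x, - y) \<in> \<Union>\<C>"
        using hom_graph.neg in_A by blast
    next
      fix y assume "(0, y) \<in> \<Union>\<C>"
      then show "y = 0"
        using hom_graph.zeroD in_A by blast
    qed
    then show "\<Union>\<C> \<in> \<A>"
      unfolding \<A>_def using ne in_A by blast
  qed
  then obtain G where G: "hom_graph G" "G0 \<subseteq> G"
    and max: "\<And>X. hom_graph X \<Longrightarrow> G \<subseteq> X \<Longrightarrow> X = G"
    unfolding \<A>_def by (smt (verit, ccfv_threshold) mem_Collect_eq subset_trans)
  interpret hom_graph G by fact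
  have adjoin: "(x, c) \<in> G"
    if "\<And>p q. (p, q) \<in> poly_graph G \<Longrightarrow> poly p x = 0 \<Longrightarrow> poly q c = 0" for x c
    using adjoin_graph[OF G(1), of x c] that max[of "adjoin_graph G x c"] by blast
  define V where "V = fst ` G"
  define h where "h x = (THE y. (x, y) \<in> G)" for x
  have hI: "h x = y" if "(x, y) \<in> G" for x y
    unfolding h_def using that unique by blast
  have mem: "x \<in> V \<and> h x = y" if "(x, y) \<in> G" for x y
    using hI[OF that] that by (force simp: V_def)
  have memD: "(x, h x) \<in> G" if "x \<in> V" for x
    using that hI by (auto simp: V_def)
  have "place V h \<iota>"
  proof
    show "1 \<in> V" "h 1 = 1"
      using mem[OF one] by auto
  next
    fix x y assume xy: "x \<in> V" "y \<in> V"
    show "x + y \<in> V" "h (x + y) = h x + h y"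
      using mem[OF add[OF memD memD]] xy by auto
    show "x * y \<in> V" "h (x * y) = h x * h y"
      using mem[OF mult[OF memD memD]] xy by auto
  next
    fix x assume "x \<in> V"
    then show "- x \<in> V"
      using mem[OF neg[OF memD]] by auto
  next
    fix c show "\<iota> c \<in> V" "h (\<iota> c) = c"
      using mem const G(2) by blast+
  next
    fix x assume "x \<in> V" "h x \<noteq> 0"
    then have "(inverse x, inverse (h x)) \<in> G"
      using adjoin adjoin_inverse_ker[OF G(1) memD] by blast
    then show "inverse x \<in> V"
      using mem by blast
  next
    fix x assume x: "x \<notin> V"
    then have x0: "x \<noteq> 0"
      using mem[OF zero] by auto
    have G_const: "\<And>c. (\<iota> c, c) \<in> G"
      using const G(2) by blast
    have "\<exists>p. (p, 1) \<in> poly_graph G \<and> poly p x = 0"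
      using adjoin_value[where \<iota> = \<iota>, OF G(1) G_const] adjoin mem x by metis
    then have "\<nexists>p. (p, 1) \<in> poly_graph G \<and> poly p (inverse x) = 0"
      using no_unit_relations[OF G(1) x0] by blast
    then show "inverse x \<in> V"
      using adjoin_value[where \<iota> = \<iota>, OF G(1) G_const] adjoin mem by metis
  qed (use \<iota> in \<open>auto simp: subring_hom_def\<close>)
  then show ?thesis
    using that mem G(2) by blast
qed

section \<open>The action on forms\<close>

lemma poly_map_poly_sum:
  fixes h :: "'a::zero \<Rightarrow> 'b::comm_semiring_1"
  assumes "h 0 = 0"
  shows "poly (map_poly h p) X = (\<Sum>i\<le>degree p. h (coeff p i) * X ^ i)"
proof -
  have "poly (map_poly h p) X = (\<Sum>i\<le>degree p. coeff (map_poly h p) i * X ^ i)"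
    unfolding poly_altdef using map_poly_degree_leq[of h p]
    by (intro sum.mono_neutral_left) (auto simp: coeff_eq_0)
  then show ?thesis
    by (simp add: coeff_map_poly assms)
qed

lemma subring_hom_poly_eval:
  assumes "subring_hom UNIV h"
  shows "subring_hom UNIV (\<lambda>p. poly (map_poly h p) X)"
proof -
  interpret H: subring_hom "coeffs_in UNIV" "map_poly h"
    using assms by (rule subring_hom_map_poly)
  show ?thesis
    using H.hom_add H.hom_mult H.hom_one by unfold_locales (auto simp: coeffs_in_def)
qed

lemma form_scale_altdef: "form_scale c F = [:[:c:]:] * F"
  by (simp add: form_scale_def)

lemma coeff_form_scale: "coeff (coeff (form_scale c F) i) j = c * coeff (coeff F i) j"
  by (simp add: form_scale_def)

text \<open>The double sum is the evaluation of \<open>F\<close> at the images of the two variables,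
  the inner variable before the outer one. Multiplicativity, invisible in the sum, is that of
  polynomial evaluation.\<close>

lemma sym_act_hom: "subring_hom UNIV (sym_act g :: 'k::field poly poly \<Rightarrow> _)"
proof -
  let ?X = "lin (g *v axis 1 1)" and ?Y = "lin (g *v axis 2 1)"
  let ?c = "\<lambda>a :: 'k. [:[:a:]:]"
  let ?f = "\<lambda>p. poly (map_poly ?c p) ?X"
  have c: "subring_hom UNIV ?c"
    by unfold_locales (auto simp: one_pCons)
  have f: "subring_hom UNIV ?f"
    using c by (rule subring_hom_poly_eval)
  have "sym_act g F = poly (map_poly ?f F) ?Y" for F
    by (subst poly_map_poly_sum)
      (simp_all add: poly_map_poly_sum sym_act_def form_scale_altdef sum_distrib_left sum_distrib_right mult_ac)
  then show ?thesis
    using subring_hom_poly_eval[OF f, of ?Y] by presburger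
qed

lemma
  shows sym_act_add: "sym_act g (F + F') = sym_act g F + sym_act g F'"
    and sym_act_mult: "sym_act g (F * F') = sym_act g F * sym_act g F'"
    and sym_act_zero: "sym_act g 0 = 0"
    and sym_act_power: "sym_act g (F ^ n) = sym_act g F ^ n"
    and sym_act_sum: "sym_act g (sum \<phi> I) = (\<Sum>i\<in>I. sym_act g (\<phi> i))"
  using subring_hom.hom_add[OF sym_act_hom] subring_hom.hom_mult[OF sym_act_hom]
    subring_hom.hom_zero[OF sym_act_hom]
    subring_hom.hom_power[OF sym_act_hom]
    subring_hom.hom_sum[OF sym_act_hom, of I \<phi>]
  by auto

lemma sym_act_scale: "sym_act g (form_scale c F) = form_scale c (sym_act g F)"
proof -
  have "sym_act g [:[:c:]:] = [:[:c:]:]"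
    by (simp add: sym_act_def form_scale_def)
  then show ?thesis
    by (simp only: form_scale_altdef sym_act_mult)
qed

lemma lin_axis: "lin (axis 1 1) = [:[:0, 1:]:]" "lin (axis 2 1) = [:0, 1:]"
  by (simp_all add: lin_def axis_def one_pCons)

lemma lin_add: "lin (v + w) = lin v + lin w"
  by (simp add: lin_def)

lemma lin_scale: "lin (c *s v) = form_scale c (lin v)"
  by (simp add: lin_def form_scale_def)

lemma lin_basis: "lin v = form_scale (v $ 1) (lin (axis 1 1)) + form_scale (v $ 2) (lin (axis 2 1))"
  by (simp add: lin_axis) (simp add: lin_def form_scale_def)

lemma vec2_basis: "(v :: 'a::field ^ 2) = (v $ 1) *s axis 1 1 + (v $ 2) *s axis 2 1"
  by (simp add: Finite_Cartesian_Product.vec_eq_iff forall_2 axis_def)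

lemma sym_act_lin: "sym_act g (lin v) = lin (g *v v)"
proof -
  have "sym_act g (lin (axis 1 1)) = lin (g *v axis 1 1)"
    unfolding lin_axis(1) sym_act_def by (simp add: form_scale_def flip: one_pCons)
  moreover have "sym_act g (lin (axis 2 1)) = lin (g *v axis 2 1)"
    unfolding lin_axis(2) sym_act_def by (simp add: form_scale_def flip: one_pCons)
  moreover have "g *v v = (v $ 1) *s (g *v axis 1 1) + (v $ 2) *s (g *v axis 2 1)"
    by (subst vec2_basis[of v]) (simp only: matrix_vector_right_distrib vector_scalar_commute)
  ultimately show ?thesis
    by (subst lin_basis) (simp add: sym_act_add sym_act_scale lin_add lin_scale)
qed

lemma sym_act_compose: "sym_act g (sym_act h F) = sym_act (g ** h) F"
  by (subst (2 3) sym_act_def)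
    (simp add: sym_act_sum sym_act_scale sym_act_mult sym_act_power sym_act_lin matrix_vector_mul_assoc)

lemma sym_act_id: "sym_act (Finite_Cartesian_Product.mat 1) F = F"
proof -
  have m: "form_scale c (lin (axis 1 1) ^ j * lin (axis 2 1) ^ i) = monom (monom c j) i" for c :: 'a and i j
  proof -
    have "[:[:0, 1 :: 'a:]:] ^ j = [:monom 1 j:]" for j
      by (induction j) (simp_all add: one_pCons monom_0 monom_Suc)
    moreover have "[:0, 1 :: 'a poly:] ^ i = monom 1 i" for i
      by (simp add: monom_altdef)
    ultimately show ?thesis
      by (simp add: lin_axis form_scale_def smult_monom)
  qed
  have "sym_act (Finite_Cartesian_Product.mat 1) F = (\<Sum>i\<le>degree F. \<Sum>j\<le>degree (coeff F i). monom (monom (coeff (coeff F i) j) j) i)"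
    by (simp only: sym_act_def m matrix_vector_mul_lid)
  also have "\<dots> = (\<Sum>i\<le>degree F. monom (\<Sum>j\<le>degree (coeff F i). monom (coeff (coeff F i) j) j) i)"
    by (simp add: monom_sum)
  finally show ?thesis
    by (simp add: poly_as_sum_of_monoms)
qed

lemma sym_act_inverse:
  assumes "g ** h = Finite_Cartesian_Product.mat 1"
  shows "sym_act g (sym_act h F) = F"
  by (simp add: sym_act_compose assms sym_act_id)

section \<open>Homogeneous forms and their coefficients\<close>

lemma SymD: "F \<in> Sym d \<Longrightarrow> coeff (coeff F i) j \<noteq> 0 \<Longrightarrow> i + j = d"
  by (auto simp: Sym_def)

lemma zero_Sym: "0 \<in> Sym d"
  by (simp add: Sym_def)

lemma Sym_add: "F \<in> Sym d \<Longrightarrow> G \<in> Sym d \<Longrightarrow> F + G \<in> Sym d"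
  unfolding Sym_def mem_Collect_eq coeff_add
  by (metis add.left_neutral)

lemma Sym_scale: "F \<in> Sym d \<Longrightarrow> form_scale c F \<in> Sym d"
  by (simp add: Sym_def form_scale_def)

lemma Sym_sum: "(\<And>i. i \<in> I \<Longrightarrow> \<phi> i \<in> Sym d) \<Longrightarrow> sum \<phi> I \<in> Sym d"
  by (induction I rule: infinite_finite_induct) (auto simp: zero_Sym Sym_add)

lemma subspace_Sym: "form.subspace (Sym d)"
  by (simp add: form.subspace_def zero_Sym Sym_add Sym_scale)

lemma Sym_mult: "F \<in> Sym a \<Longrightarrow> G \<in> Sym b \<Longrightarrow> F * G \<in> Sym (a + b)"
proof -
  assume FG: "F \<in> Sym a" "G \<in> Sym b"
  have "i + j = a + b" if "coeff (coeff (F * G) i) j \<noteq> 0" for i j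
  proof -
    have "(\<Sum>k\<le>i. \<Sum>l\<le>j. coeff (coeff F k) l * coeff (coeff G (i - k)) (j - l)) \<noteq> 0"
      using that by (simp add: coeff_mult coeff_sum)
    then obtain k where k: "k \<le> i" "(\<Sum>l\<le>j. coeff (coeff F k) l * coeff (coeff G (i - k)) (j - l)) \<noteq> 0"
      using sum.not_neutral_contains_not_neutral by blast
    then obtain l where l: "l \<le> j" "coeff (coeff F k) l * coeff (coeff G (i - k)) (j - l) \<noteq> 0"
      using sum.not_neutral_contains_not_neutral by blast
    have kl: "coeff (coeff F k) l \<noteq> 0" "coeff (coeff G (i - k)) (j - l) \<noteq> 0"
      using l(2) by auto
    show ?thesis
      using SymD[OF FG(1) kl(1)] SymD[OF FG(2) kl(2)] k(1) l(1) by linarith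
  qed
  then show ?thesis by (simp add: Sym_def)
qed

lemma Sym_one: "1 \<in> Sym 0"
  by (auto simp: Sym_def coeff_1 split: if_splits)

lemma Sym_power: "F \<in> Sym a \<Longrightarrow> F ^ n \<in> Sym (n * a)"
  by (induction n) (auto simp: Sym_one Sym_mult)

lemma lin_Sym: "lin v \<in> Sym 1"
  by (auto simp: Sym_def lin_def coeff_pCons split: nat.splits)

lemma lin_monomial_Sym: "m \<le> d \<Longrightarrow> lin v ^ (d - m) * lin w ^ m \<in> Sym d"
  using Sym_mult[OF Sym_power[OF lin_Sym, of v "d - m"] Sym_power[OF lin_Sym, of w m]] by simp

definition cf :: "nat \<Rightarrow> 'k::field poly poly \<Rightarrow> nat \<Rightarrow> 'k" where
  "cf d F m = coeff (coeff F m) (d - m)"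

lemma
  shows cf_add: "cf d (F + G) m = cf d F m + cf d G m"
    and cf_scale: "cf d (form_scale c F) m = c * cf d F m"
    and cf_zero: "cf d 0 m = 0"
    and cf_sum: "cf d (sum \<phi> I) m = (\<Sum>i\<in>I. cf d (\<phi> i) m)"
  by (simp_all add: cf_def form_scale_def coeff_sum)

lemma Sym_eqI:
  assumes "F \<in> Sym d" "G \<in> Sym d" "\<And>m. m \<le> d \<Longrightarrow> cf d F m = cf d G m"
  shows "F = G"
proof (intro poly_eqI)
  fix i j
  show "coeff (coeff F i) j = coeff (coeff G i) j"
  proof (cases "i + j = d")
    case True
    then show ?thesis using assms(3)[of i] by (auto simp: cf_def)
  next
    case False
    then show ?thesis using SymD[OF assms(1), of i j] SymD[OF assms(2), of i j] by metis
  qed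
qed

definition monoform :: "nat \<Rightarrow> nat \<Rightarrow> 'k::field poly poly" where
  "monoform d m = lin (axis 1 1) ^ (d - m) * lin (axis 2 1) ^ m"

lemma monoform_Sym: "m \<le> d \<Longrightarrow> monoform d m \<in> Sym d"
  by (simp add: monoform_def lin_monomial_Sym)

lemma monoform_altdef: "(monoform d m :: 'a::field poly poly) = monom (monom 1 (d - m)) m"
proof -
  have "[:[:0, 1 :: 'a:]:] ^ j = [:monom 1 j:]" for j
    by (induction j) (simp_all add: one_pCons monom_0 monom_Suc)
  moreover have "[:0, 1 :: 'a poly:] ^ i = monom 1 i" for i
    by (simp add: monom_altdef)
  ultimately show ?thesis
    by (simp add: monoform_def lin_axis smult_monom)
qed

lemma cf_monoform: "m \<le> d \<Longrightarrow> cf d (monoform d m') m = (if m = m' then 1 else 0)"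
  by (auto simp: cf_def monoform_altdef)

lemma cf_sum_monoform:
  assumes "m \<le> d" "d' \<le> d"
  shows "cf d (\<Sum>k\<le>d'. form_scale (c k) (monoform d k)) m = (if m \<le> d' then c m else 0)"
proof -
  have "cf d (\<Sum>k\<le>d'. form_scale (c k) (monoform d k)) m = (\<Sum>k\<le>d'. if m = k then c k else 0)"
    unfolding cf_sum cf_scale using assms by (intro sum.cong) (auto simp: cf_monoform)
  then show ?thesis
    by simp
qed

lemma Sym_expand: 
  assumes "F \<in> Sym d" 
  shows "F = (\<Sum>m\<le>d. form_scale (cf d F m) (monoform d m))"
proof (rule Sym_eqI[OF assms])
  show "(\<Sum>m\<le>d. form_scale (cf d F m) (monoform d m)) \<in> Sym d"
    by (rule Sym_sum) (simp add: Sym_scale monoform_Sym)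
qed (simp add: cf_sum_monoform)

lemma sym_act_Sym:
  assumes "F \<in> Sym d" shows "sym_act g F \<in> Sym d"
  by (subst Sym_expand[OF assms])
    (auto simp: sym_act_sum sym_act_scale monoform_def sym_act_mult sym_act_power sym_act_lin
      intro!: Sym_sum Sym_scale lin_monomial_Sym)

lemma sym_act_expand:
  assumes "F \<in> Sym d"
  shows "sym_act g F = (\<Sum>m\<le>d. form_scale (cf d F m) (lin (g *v axis 1 1) ^ (d - m) * lin (g *v axis 2 1) ^ m))"
  by (subst Sym_expand[OF assms])
    (simp add: sym_act_sum sym_act_scale monoform_def sym_act_mult sym_act_power sym_act_lin)

section \<open>Explicit two-by-two matrices and their action on coefficients\<close>

definition mat2 :: "'a \<Rightarrow> 'a \<Rightarrow> 'a \<Rightarrow> 'a \<Rightarrow> 'a ^ 2 ^ 2" where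
  "mat2 a b c e = (\<chi> i j. if i = 1 then (if j = 1 then a else b) else (if j = 1 then c else e))"

lemma mat2_nth [simp]:
  "(mat2 a b c e) $ 1 $ 1 = a" "(mat2 a b c e) $ 1 $ 2 = b"
  "(mat2 a b c e) $ 2 $ 1 = c" "(mat2 a b c e) $ 2 $ 2 = e"
  by (simp_all add: mat2_def)

lemma mat2_eq: "g = mat2 (g $ 1 $ 1) (g $ 1 $ 2) (g $ 2 $ 1) (g $ 2 $ 2)"
  by (simp add: Finite_Cartesian_Product.vec_eq_iff forall_2)

lemma mat2_mult:
  "mat2 a b c e ** mat2 a' b' c' e' =
    mat2 (a * a' + b * c') (a * b' + b * e') (c * a' + e * c') (c * b' + e * (e' :: 'a::field))"
  by (simp add: Finite_Cartesian_Product.vec_eq_iff forall_2 matrix_matrix_mult_def sum_2)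

lemma mat2_one: "(Finite_Cartesian_Product.mat 1 :: 'a::field ^ 2 ^ 2) = mat2 1 0 0 1"
  by (simp add: Finite_Cartesian_Product.vec_eq_iff forall_2 Finite_Cartesian_Product.mat_def)

lemma mat2_axis: "mat2 a b c e *v axis 1 1 = vector [a, c]" "mat2 a b c e *v axis 2 1 = vector [b, e :: 'a::field]"
  by (simp_all add: Finite_Cartesian_Product.vec_eq_iff forall_2 matrix_vector_mult_def sum_2 axis_def)

lemma invertible_mat2: "invertible (mat2 a b c e) \<longleftrightarrow> a * e - b * c \<noteq> (0 :: 'a::field)"
  by (simp add: invertible_det_nz det_2)

lemma lin_vector: "lin (vector [a, b]) = form_scale a (lin (axis 1 1)) + form_scale b (lin (axis 2 1))"
  by (subst lin_basis) simp

lemma form_scale_power: "form_scale c F ^ n = form_scale (c ^ n) (F ^ n)"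
  by (simp add: form_scale_def smult_power) (metis (no_types, lifting) mult.commute power_mult_distrib poly_const_pow)

lemma form_scale_mult:
  "form_scale c F * G = form_scale c (F * G)" "F * form_scale c G = form_scale c (F * G)"
  by (simp_all add: form_scale_def)

lemma of_nat_form: "of_nat n * F = form_scale (of_nat n) F"
  by (simp add: form_scale_def of_nat_poly)

lemma cf_diag:
  assumes "F \<in> Sym d" "m \<le> d"
  shows "cf d (sym_act (mat2 1 0 0 s) F) m = s ^ m * cf d F m"
proof -
  have "sym_act (mat2 1 0 0 s) F = (\<Sum>k\<le>d. form_scale (s ^ k * cf d F k) (monoform d k))"
    unfolding sym_act_expand[OF assms(1)]
    by (simp add: mat2_axis lin_vector form_scale_power form_scale_mult monoform_def mult.commute)
  then show ?thesis
    using assms(2) by (simp add: cf_sum_monoform)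
qed

text \<open>\<open>e\<^sub>2\<close> goes to \<open>q e\<^sub>1 + e\<^sub>2\<close>, so the
  coefficients come from the binomial expansion. For \<open>j > m\<close> the binomial coefficient
  vanishes, which makes the truncated exponent \<open>m - j\<close> harmless.\<close>

lemma cf_unipotent:
  assumes "F \<in> Sym d" "j \<le> d"
  shows "cf d (sym_act (mat2 1 q 0 1) F) j = (\<Sum>m\<le>d. of_nat (m choose j) * q ^ (m - j) * cf d F m)"
proof -
  have "cf d (lin (axis 1 1) ^ (d - m) * lin (vector [q, 1]) ^ m) j = of_nat (m choose j) * q ^ (m - j)"
    if m: "m \<le> d" for m
  proof -
    let ?x = "lin (axis 1 1) :: 'a poly poly" and ?y = "lin (axis 2 1) :: 'a poly poly"
    have "?x ^ (d - m) * lin (vector [q, 1]) ^ m = ?x ^ (d - m) * (?y + form_scale q ?x) ^ m"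
      by (simp add: lin_vector add.commute)
    also have "\<dots> = (\<Sum>k\<le>m. form_scale (of_nat (m choose k) * q ^ (m - k)) (monoform d k))"
      unfolding binomial_ring sum_distrib_left
    proof (rule sum.cong[OF refl])
      fix k assume k: "k \<in> {..m}"
      have x: "?x ^ (d - m) * (?y ^ k * ?x ^ (m - k)) = monoform d k"
      proof -
        have "d - m + (m - k) = d - k"
          using k m by simp
        then have "monoform d k = ?x ^ (d - m) * ?x ^ (m - k) * ?y ^ k"
          by (metis monoform_def power_add)
        then show ?thesis
          by (simp only: mult_ac)
      qed
      show "?x ^ (d - m) * (of_nat (m choose k) * ?y ^ k * form_scale q ?x ^ (m - k)) =
          form_scale (of_nat (m choose k) * q ^ (m - k)) (monoform d k)"
        by (simp add: form_scale_power form_scale_mult of_nat_form x)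
    qed
    finally show ?thesis
      using assms(2) m by (auto simp: cf_sum_monoform binomial_eq_0)
  qed
  then show ?thesis
    unfolding sym_act_expand[OF assms(1)] mat2_axis
    by (auto simp: cf_sum cf_scale lin_vector mult_ac intro!: sum.cong)
qed

section \<open>Frames\<close>

text \<open>Independence of the family, not of its image: a repeated form makes the family
  dependent. Reduction at a place may identify members, so sets of forms would lose the
  count.\<close>

definition frame_indep :: "nat \<Rightarrow> (nat \<Rightarrow> 'k::field poly poly) \<Rightarrow> bool" where
  "frame_indep n f \<longleftrightarrow> (\<forall>c. (\<Sum>i<n. form_scale (c i) (f i)) = 0 \<longrightarrow> (\<forall>i<n. c i = 0))"

lemma frame_indepD:
  "frame_indep n f \<Longrightarrow> (\<Sum>i<n. form_scale (c i) (f i)) = 0 \<Longrightarrow> i < n \<Longrightarrow> c i = 0"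
  by (auto simp: frame_indep_def)

lemma frame_indep_inj:
  assumes "frame_indep n f"
  shows "inj_on f {..<n}"
proof (rule inj_onI, rule ccontr)
  fix i j assume ij: "i \<in> {..<n}" "j \<in> {..<n}" "f i = f j" "i \<noteq> j"
  define c where "c l = (if l = i then 1 else 0) - (if l = j then 1 else (0::'a))" for l
  have "(\<Sum>l<n. form_scale (c l) (f l)) = (\<Sum>l<n. (if l = i then f i else 0) - (if l = j then f j else 0))"
    by (intro sum.cong) (auto simp: c_def form.scale_left_diff_distrib)
  also have "\<dots> = 0"
    using ij by (simp add: sum_subtractf)
  finally have "c i = 0"
    using frame_indepD[OF assms] ij by auto
  then show False
    using ij by (simp add: c_def)
qed

lemma frame_span:
  fixes n :: nat
  assumes "inj_on f {..<n}"
  shows "form.span (f ` {..<n}) = {\<Sum>i<n. form_scale (c i) (f i) | c. True}"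
proof -
  have "(\<Sum>v\<in>f ` {..<n}. form_scale (u v) v) = (\<Sum>i<n. form_scale (u (f i)) (f i))" for u
    by (simp add: sum.reindex[OF assms])
  moreover have "\<exists>u. (\<Sum>i<n. form_scale (c i) (f i)) = (\<Sum>i<n. form_scale (u (f i)) (f i))" for c
    using assms by (intro exI[of _ "\<lambda>v. c (the_inv_into {..<n} f v)"])
      (auto intro!: sum.cong simp: the_inv_into_f_f)
  ultimately show ?thesis
    unfolding form.span_finite[OF finite_imageI[OF finite_lessThan]] by (auto simp: image_iff)
qed

lemma independent_frame:
  assumes inj: "inj_on f {..<n}"
  shows "form.independent (f ` {..<n}) \<longleftrightarrow> frame_indep n f"
proof -
  have s: "(\<Sum>v\<in>f ` {..<n}. form_scale (u v) v) = (\<Sum>i<n. form_scale (u (f i)) (f i))" for u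
    by (simp add: sum.reindex[OF inj])
  have "frame_indep n f" if *: "\<And>u. (\<Sum>i<n. form_scale (u (f i)) (f i)) = 0 \<Longrightarrow> \<forall>i<n. u (f i) = 0"
    unfolding frame_indep_def
  proof (intro allI impI)
    fix c i assume "(\<Sum>i<n. form_scale (c i) (f i)) = 0" "i < n"
    then show "c i = 0"
      using *[of "\<lambda>v. c (the_inv_into {..<n} f v)"] the_inv_into_f_f[OF inj] by auto
  qed
  then show ?thesis
    unfolding form.dependent_finite[OF finite_imageI[OF finite_lessThan]] s
    by (auto dest: frame_indepD)
qed

lemma ordered_basis_iff:
  "ordered_basis n S f \<longleftrightarrow> frame_indep n f \<and> S = {\<Sum>i<n. form_scale (c i) (f i) | c. True}"
proof (cases "inj_on f {..<n}")
  case True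
  show ?thesis
    unfolding ordered_basis_def independent_frame[OF True] frame_span[OF True] using True by blast
next
  case False
  then have "\<not> frame_indep n f"
    using frame_indep_inj by blast
  with False show ?thesis
    by (simp add: ordered_basis_def)
qed

lemma ordered_basis_indep: "ordered_basis n S f \<Longrightarrow> frame_indep n f"
  by (simp add: ordered_basis_iff)

lemma ordered_basis_span: "ordered_basis n S f \<Longrightarrow> G \<in> S \<Longrightarrow> \<exists>c. G = (\<Sum>i<n. form_scale (c i) (f i))"
  by (auto simp: ordered_basis_iff)

lemma ordered_basis_subspace: "ordered_basis n S f \<Longrightarrow> form.subspace S"
  by (auto simp: ordered_basis_def)

lemma ordered_basis_mem: "ordered_basis n S f \<Longrightarrow> i < n \<Longrightarrow> f i \<in> S"
  by (auto simp: ordered_basis_def intro: form.span_base)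

lemma ordered_basis_dim: "ordered_basis n S f \<Longrightarrow> form.dim S = n"
  unfolding ordered_basis_def using form.dim_span_eq_card_independent[of "f ` {..<n}"] card_image[of f "{..<n}"]
  by (metis card_lessThan)

lemma ordered_basis_cong: "ordered_basis n S f \<Longrightarrow> (\<And>i. i < n \<Longrightarrow> f i = g i) \<Longrightarrow> ordered_basis n S g"
  unfolding ordered_basis_def
  by (smt (verit, best) image_cong inj_on_cong lessThan_iff)

lemma ordered_basis_Grassmannian:
  "ordered_basis n S f \<Longrightarrow> S \<subseteq> V \<Longrightarrow> S \<in> Grassmannian n V"
  by (auto simp: Grassmannian_def ordered_basis_subspace ordered_basis_dim)

lemma frame_span_subset:
  assumes "\<And>i. i < n \<Longrightarrow> f i \<in> V" "form.subspace V"
  shows "{\<Sum>i<n. form_scale (c i) (f i) | c. True} \<subseteq> V"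
  using assms by (auto intro!: form.subspace_sum form.subspace_scale)

lemma ordered_basis_frame: "frame_indep n f \<Longrightarrow> ordered_basis n {\<Sum>i<n. form_scale (c i) (f i) | c. True} f"
  by (simp add: ordered_basis_iff)

lemma Grassmannian_ordered_basis:
  assumes "S \<in> Grassmannian n V" "n > 0"
  obtains f where "ordered_basis n S f"
proof -
  have S: "form.subspace S" "form.dim S = n"
    using assms by (auto simp: Grassmannian_def)
  obtain B where B: "B \<subseteq> S" "form.independent B" "S \<subseteq> form.span B" "card B = n"
    using form.basis_exists[of S] S(2) by metis
  have "finite B"
    using B(4) assms(2) by (metis card.infinite less_numeral_extra(3))
  then obtain f where "bij_betw f {..<n} B"
    using ex_bij_betw_nat_finite B(4) lessThan_atLeast0 by metis
  moreover have "form.span B = S"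
    using B S(1) by (metis form.span_subspace)
  ultimately have "ordered_basis n S f"
    using B(2) by (auto simp: ordered_basis_def bij_betw_def)
  then show ?thesis
    using that by blast
qed

definition comb :: "nat \<Rightarrow> 'k::field mat \<Rightarrow> (nat \<Rightarrow> 'k poly poly) \<Rightarrow> nat \<Rightarrow> 'k poly poly" where
  "comb n M f i = (\<Sum>j<n. form_scale (M $$ (i, j)) (f j))"

lemma comb_comb:
  assumes "M \<in> carrier_mat n n" "N \<in> carrier_mat n n" "i < n"
  shows "comb n M (comb n N f) i = comb n (M * N) f i"
proof -
  have "comb n M (comb n N f) i = (\<Sum>j<n. \<Sum>l<n. form_scale (M $$ (i, j) * N $$ (j, l)) (f l))"
    by (simp add: comb_def form.scale_sum_right)
  also have "\<dots> = (\<Sum>l<n. \<Sum>j<n. form_scale (M $$ (i, j) * N $$ (j, l)) (f l))"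
    by (rule sum.swap)
  also have "\<dots> = (\<Sum>l<n. form_scale ((M * N) $$ (i, l)) (f l))"
    using assms by (intro sum.cong) (auto simp: scalar_prod_def form.scale_sum_left lessThan_atLeast0)
  finally show ?thesis
    by (simp add: comb_def)
qed

lemma comb_one: "i < n \<Longrightarrow> comb n (1\<^sub>m n) f i = f i"
proof -
  assume i: "i < n"
  have "comb n (1\<^sub>m n) f i = (\<Sum>j<n. if i = j then f j else 0)"
    unfolding comb_def using i by (intro sum.cong) auto
  then show ?thesis
    using i by simp
qed

lemma comb_cong: "(\<And>j. j < n \<Longrightarrow> f j = g j) \<Longrightarrow> comb n M f i = comb n M g i"
  by (simp add: comb_def)

lemma comb_mem:
  "form.subspace V \<Longrightarrow> (\<And>j. j < n \<Longrightarrow> f j \<in> V) \<Longrightarrow> comb n M f i \<in> V"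
  by (auto simp: comb_def intro!: form.subspace_sum form.subspace_scale)

lemma sym_act_comb: "sym_act g (comb n M f i) = comb n M (\<lambda>j. sym_act g (f j)) i"
  by (simp add: comb_def sym_act_sum sym_act_scale)

lemma cf_comb: "cf d (comb n M f i) m = (\<Sum>j<n. M $$ (i, j) * cf d (f j) m)"
  by (simp add: comb_def cf_sum cf_scale)

lemma sum_comb:
  "(\<Sum>i<n. form_scale (c i) (comb n M f i)) = (\<Sum>j<n. form_scale (\<Sum>i<n. c i * M $$ (i, j)) (f j))"
  unfolding comb_def form.scale_sum_right form.scale_sum_left form.scale_scale by (rule sum.swap)

lemma det_eq_0_left_kernel:
  assumes M: "(M :: 'a::field mat) \<in> carrier_mat n n" 
  shows "Determinant.det M = 0 \<longleftrightarrow> (\<exists>c. (\<exists>i<n. c i \<noteq> 0) \<and> (\<forall>j<n. (\<Sum>i<n. c i * M $$ (i, j)) = 0))"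
proof -
  have Mt: "transpose_mat M \<in> carrier_mat n n"
    using M by simp
  have r: "transpose_mat M *\<^sub>v v = 0\<^sub>v n \<longleftrightarrow> (\<forall>j<n. (\<Sum>i<n. vec_index v i * M $$ (i, j)) = 0)"
    if "v \<in> carrier_vec n" for v
    using M that by (auto simp: Matrix.vec_eq_iff scalar_prod_def lessThan_atLeast0 mult.commute)
  have "Determinant.det M = 0 \<longleftrightarrow>
      (\<exists>v. v \<in> carrier_vec n \<and> v \<noteq> 0\<^sub>v n \<and> (\<forall>j<n. (\<Sum>i<n. vec_index v i * M $$ (i, j)) = 0))"
    using det_0_iff_vec_prod_zero_field[OF Mt] det_transpose[OF M] r by auto
  also have "\<dots> \<longleftrightarrow> (\<exists>c. (\<exists>i<n. c i \<noteq> 0) \<and> (\<forall>j<n. (\<Sum>i<n. c i * M $$ (i, j)) = 0))"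
  proof safe
    fix v assume v: "v \<in> carrier_vec n" "v \<noteq> 0\<^sub>v n" "\<forall>j<n. (\<Sum>i<n. vec_index v i * M $$ (i, j)) = 0"
    then have "\<exists>i<n. vec_index v i \<noteq> 0"
      by (auto simp: Matrix.vec_eq_iff)
    with v(3) show "\<exists>c. (\<exists>i<n. c i \<noteq> 0) \<and> (\<forall>j<n. (\<Sum>i<n. c i * M $$ (i, j)) = 0)"
      by (intro exI[of _ "vec_index v"]) auto
  next
    fix c i assume c: "i < n" "c i \<noteq> 0" "\<forall>j<n. (\<Sum>i<n. c i * M $$ (i, j)) = 0"
    then show "\<exists>v. v \<in> carrier_vec n \<and> v \<noteq> 0\<^sub>v n \<and> (\<forall>j<n. (\<Sum>i<n. vec_index v i * M $$ (i, j)) = 0)"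
      by (intro exI[of _ "Matrix.vec n c"]) (auto simp: Matrix.vec_eq_iff)
  qed
  finally show ?thesis .
qed

lemma comb_indep_det:
  assumes M: "M \<in> carrier_mat n n" and "frame_indep n (comb n M f)"
  shows "Determinant.det M \<noteq> 0"
proof
  assume "Determinant.det M = 0"
  then obtain c i where "i < n" "c i \<noteq> 0" "\<forall>j<n. (\<Sum>i<n. c i * M $$ (i, j)) = 0"
    using det_eq_0_left_kernel[OF M] by blast
  then show False
    using frame_indepD[OF assms(2), of c i] by (simp add: sum_comb)
qed

lemma comb_det_indep:
  assumes M: "M \<in> carrier_mat n n" and det: "Determinant.det M \<noteq> 0" and f: "frame_indep n f"
  shows "frame_indep n (comb n M f)"
  unfolding frame_indep_def
proof (intro allI impI, rule ccontr)
  fix c i assume "(\<Sum>i<n. form_scale (c i) (comb n M f i)) = 0" and i: "i < n" "c i \<noteq> 0"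
  then have "\<forall>j<n. (\<Sum>i<n. c i * M $$ (i, j)) = 0"
    using frame_indepD[OF f, of "\<lambda>j. \<Sum>i<n. c i * M $$ (i, j)"] by (simp add: sum_comb)
  then show False
    using det det_eq_0_left_kernel[OF M] i by blast
qed

lemma smult_smult_mat: "a \<cdot>\<^sub>m (b \<cdot>\<^sub>m M) = (a * b :: 'a::semigroup_mult) \<cdot>\<^sub>m M"
  by (rule eq_matI) (auto simp: mult.assoc)

lemma smult_one_mat: "(1 :: 'a::monoid_mult) \<cdot>\<^sub>m M = M"
  by (rule eq_matI) auto

text \<open>The adjugate formula is kept as a conclusion because it shows that the inverse has
  entries in a valuation ring as soon as the determinant is a unit there.\<close>

lemma inverse_mat:
  assumes "(M :: 'a::field mat) \<in> carrier_mat n n" "Determinant.det M \<noteq> 0"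
  obtains N where "N \<in> carrier_mat n n" "N * M = 1\<^sub>m n" "M * N = 1\<^sub>m n" "Determinant.det N \<noteq> 0"
    "N = inverse (Determinant.det M) \<cdot>\<^sub>m adj_mat M"
proof -
  let ?N = "inverse (Determinant.det M) \<cdot>\<^sub>m adj_mat M"
  note adj = adj_mat[OF assms(1)]
  have N: "?N \<in> carrier_mat n n"
    using adj(1) by simp
  have MN: "M * ?N = 1\<^sub>m n"
    using assms adj by (simp add: mult_smult_distrib smult_smult_mat smult_one_mat)
  have NM: "?N * M = 1\<^sub>m n"
    using assms adj by (simp add: mult_smult_assoc_mat smult_smult_mat smult_one_mat)
  have "Determinant.det ?N * Determinant.det M = 1"
    using det_mult[OF N assms(1)] by (simp add: NM)
  then have "Determinant.det ?N \<noteq> 0"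
    by auto
  with N MN NM show ?thesis
    using that by blast
qed

lemma ordered_basis_coords:
  assumes f: "ordered_basis n S f" and "\<And>i. i < n \<Longrightarrow> F i \<in> S"
  obtains M where "M \<in> carrier_mat n n" "\<And>i. i < n \<Longrightarrow> F i = comb n M f i"
proof -
  have "\<forall>i<n. \<exists>c. F i = (\<Sum>j<n. form_scale (c j) (f j))"
    using ordered_basis_span[OF f] assms(2) by blast
  then obtain C where C: "\<And>i. i < n \<Longrightarrow> F i = (\<Sum>j<n. form_scale (C i j) (f j))"
    by metis
  show ?thesis
    by (rule that[of "Matrix.mat n n (\<lambda>(i, j). C i j)"]) (auto simp: comb_def C)
qed

lemma frame_indep_cong: "(\<And>i. i < n \<Longrightarrow> f i = g i) \<Longrightarrow> frame_indep n f \<longleftrightarrow> frame_indep n g"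
  by (simp add: frame_indep_def)

lemma ordered_basis_change:
  assumes f: "ordered_basis n S f" and F: "\<And>i. i < n \<Longrightarrow> F i \<in> S" "frame_indep n F"
  obtains M where "M \<in> carrier_mat n n" "Determinant.det M \<noteq> 0" "\<And>i. i < n \<Longrightarrow> F i = comb n M f i"
proof -
  obtain M where M: "M \<in> carrier_mat n n" "\<And>i. i < n \<Longrightarrow> F i = comb n M f i"
    using ordered_basis_coords[of n S f F, OF f F(1)] by blast
  moreover have "frame_indep n (comb n M f)"
    using F(2) frame_indep_cong[of n F "comb n M f"] M(2) by blast
  ultimately show ?thesis
    using comb_indep_det that by blast
qed

lemma ordered_basis_comb:
  assumes f: "ordered_basis n S f" and M: "M \<in> carrier_mat n n" "Determinant.det M \<noteq> 0"
  shows "ordered_basis n S (comb n M f)"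
proof -
  let ?F = "comb n M f"
  obtain N where N: "N \<in> carrier_mat n n" "N * M = 1\<^sub>m n"
    using inverse_mat[OF M] by metis
  have f_eq: "f i = comb n N ?F i" if "i < n" for i
    using that comb_comb[OF N(1) M(1) that, of f] N(2) comb_one[OF that, of f] by simp
  have "S = {\<Sum>i<n. form_scale (c i) (?F i) | c. True}" (is "_ = ?T")
  proof
    have "frame_indep n ?F"
      using comb_det_indep[OF M ordered_basis_indep[OF f]] .
    then have T: "ordered_basis n ?T ?F"
      by (rule ordered_basis_frame)
    have "f i \<in> ?T" if "i < n" for i
      using f_eq[OF that] comb_mem[OF ordered_basis_subspace[OF T], of n ?F N i] ordered_basis_mem[OF T]
      by simp
    then show "S \<subseteq> ?T"
      using f frame_span_subset[OF _ ordered_basis_subspace[OF T], of n f] by (simp add: ordered_basis_iff)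
    show "?T \<subseteq> S"
      using comb_mem[OF ordered_basis_subspace[OF f] ordered_basis_mem[OF f]]
      by (intro frame_span_subset ordered_basis_subspace[OF f]) auto
  qed
  then show ?thesis
    using comb_det_indep[OF M ordered_basis_indep[OF f]] by (simp add: ordered_basis_iff)
qed

lemma ordered_basis_indepI:
  assumes f: "ordered_basis n S f" and F: "\<And>i. i < n \<Longrightarrow> F i \<in> S" "frame_indep n F"
  shows "ordered_basis n S F"
proof -
  obtain M where M: "M \<in> carrier_mat n n" "Determinant.det M \<noteq> 0" "\<And>i. i < n \<Longrightarrow> F i = comb n M f i"
    using ordered_basis_change[OF f F] by blast
  then show ?thesis
    using ordered_basis_cong[OF ordered_basis_comb[OF f M(1,2)], of F] by metis
qed

lemma sym_act_inj: "invertible g \<Longrightarrow> sym_act g F = sym_act g G \<Longrightarrow> F = G"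
  by (metis invertible_def sym_act_inverse)

lemma ordered_basis_sym_act:
  assumes "ordered_basis n S f" "invertible g"
  shows "ordered_basis n (sym_act g ` S) (\<lambda>i. sym_act g (f i))"
proof -
  have s: "(\<Sum>i<n. form_scale (c i) (sym_act g (f i))) = sym_act g (\<Sum>i<n. form_scale (c i) (f i))" for c
    by (simp add: sym_act_sum sym_act_scale)
  have "frame_indep n (\<lambda>i. sym_act g (f i))"
    unfolding frame_indep_def s using sym_act_inj[OF assms(2), of _ 0] frame_indepD[OF ordered_basis_indep[OF assms(1)]]
    by (auto simp: sym_act_zero)
  then show ?thesis
    using assms(1) unfolding ordered_basis_iff s by auto
qed

section \<open>Pluecker coordinates of frames\<close>

lemma pluecker_mat:
  "pluecker n d f I = Determinant.det (Matrix.mat n n (\<lambda>(i, j). cf d (f i) (sorted_list_of_set I ! j)))"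
  by (simp add: pluecker_def cf_def Let_def)

lemma pluecker_cong: "(\<And>i. i < n \<Longrightarrow> f i = g i) \<Longrightarrow> pluecker n d f I = pluecker n d g I"
  unfolding pluecker_mat by (intro arg_cong[of _ _ Determinant.det] eq_matI) auto

lemma pluecker_comb:
  assumes "M \<in> carrier_mat n n"
  shows "pluecker n d (comb n M f) I = Determinant.det M * pluecker n d f I"
proof -
  let ?P = "\<lambda>f. Matrix.mat n n (\<lambda>(i, j). cf d (f i) (sorted_list_of_set I ! j))"
  have "?P (comb n M f) = M * ?P f"
    using assms by (intro eq_matI) (auto simp: cf_comb scalar_prod_def lessThan_atLeast0)
  then show ?thesis
    unfolding pluecker_mat using det_mult[OF assms, of "?P f"] by simp
qed

lemma pluecker_dependent:
  assumes "\<not> frame_indep n f"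
  shows "pluecker n d f I = 0"
proof -
  obtain c i where c: "(\<Sum>i<n. form_scale (c i) (f i)) = 0" "i < n" "c i \<noteq> 0"
    using assms by (auto simp: frame_indep_def)
  have "(\<Sum>i<n. c i * cf d (f i) m) = 0" for m
    using arg_cong[OF c(1), of "\<lambda>F. cf d F m"] by (simp add: cf_sum cf_scale cf_zero)
  then show ?thesis
    unfolding pluecker_mat using c(2,3)
    by (subst det_eq_0_left_kernel[of _ n]) auto
qed

text \<open>This is the order of vanishing at the point \<open>[e\<^sub>2]\<close>.\<close>

definition lowest :: "nat \<Rightarrow> 'k::field poly poly \<Rightarrow> nat \<Rightarrow> bool" where
  "lowest d F a \<longleftrightarrow> a \<le> d \<and> cf d F a \<noteq> 0 \<and> (\<forall>m<a. cf d F m = 0)"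

text \<open>The family is in echelon form: in a relation, the first form with nonzero coefficient is
  the only one that contributes at its own lowest index.\<close>

lemma lowest_indep:
  assumes "strict_mono_on {..<n} a" "\<And>i. i < n \<Longrightarrow> lowest d (F i) (a i)"
  shows "frame_indep n F"
  unfolding frame_indep_def
proof (intro allI impI, rule ccontr)
  fix c i assume c: "(\<Sum>i<n. form_scale (c i) (F i)) = 0" "i < n" and "c i \<noteq> 0"
  then obtain k where k: "k < n" "c k \<noteq> 0" "\<And>i. i < k \<Longrightarrow> c i = 0"
    using exists_least_iff[of "\<lambda>i. i < n \<and> c i \<noteq> 0"] by (metis order.strict_trans)
  have "c i * cf d (F i) (a k) = 0" if "i < n" "i \<noteq> k" for i
  proof (cases "i < k")
    case True
    then show ?thesis using k(3) by simp
  next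
    case False
    then have "a k < a i"
      using that assms(1) k(1) by (auto simp: strict_mono_on_def)
    then show ?thesis
      using assms(2)[OF that(1)] by (simp add: lowest_def)
  qed
  then have "(\<Sum>i<n. c i * cf d (F i) (a k)) = (\<Sum>i<n. if i = k then c k * cf d (F k) (a k) else 0)"
    by (intro sum.cong) auto
  also have "\<dots> = c k * cf d (F k) (a k)"
    using k(1) by simp
  also have "\<dots> \<noteq> 0"
    using k assms(2)[OF k(1)] by (simp add: lowest_def)
  finally show False
    using arg_cong[OF c(1), of "\<lambda>F. cf d F (a k)"] by (simp add: cf_sum cf_scale cf_zero)
qed

text \<open>\<open>a\<close> lists all orders of vanishing at \<open>[e\<^sub>2]\<close> that occur
  in \<open>S\<close>, and \<open>F\<close> realizes them. These forms span \<open>S\<close>,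
  because subtracting a multiple of one of them removes the lowest term of a given element and
  raises its order. Comparing dimensions then shows that there are exactly \<open>n\<close>
  orders.\<close>

lemma adapted_basis:
  assumes f: "ordered_basis n S f" and S: "S \<subseteq> Sym d"
  obtains a F where "strict_mono_on {..<n} a" "\<And>i. i < n \<Longrightarrow> lowest d (F i) (a i)"
    "\<And>i. i < n \<Longrightarrow> cf d (F i) (a i) = 1" "ordered_basis n S F"
proof -
  note sub = ordered_basis_subspace[OF f]
  define Or where "Or = {a. \<exists>F\<in>S. lowest d F a}"
  have fin: "finite Or"
    by (rule finite_subset[of _ "{..d}"]) (auto simp: Or_def lowest_def)
  define N where "N = card Or"
  define a where "a i = sorted_list_of_set Or ! i" for i
  have a_mono: "strict_mono_on {..<N} a"
    unfolding strict_mono_on_def a_def N_def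
    using sorted_wrt_nth_less[OF strict_sorted_list_of_set[of Or]] fin by (auto simp: length_sorted_list_of_set)
  have a_img: "a ` {..<N} = Or"
  proof -
    have "a ` {..<N} = set (sorted_list_of_set Or)"
      unfolding a_def[abs_def] N_def by (force simp: set_conv_nth)
    then show ?thesis
      using fin by simp
  qed
  have "\<exists>F\<in>S. lowest d F (a i) \<and> cf d F (a i) = 1" if "i < N" for i
  proof -
    have "a i \<in> Or"
      using a_img that by blast
    then obtain F where F: "F \<in> S" "lowest d F (a i)"
      by (auto simp: Or_def)
    then show ?thesis
      by (intro bexI[of _ "form_scale (inverse (cf d F (a i))) F"])
        (auto simp: lowest_def cf_scale form.subspace_scale[OF sub])
  qed
  then obtain F where F: "\<And>i. i < N \<Longrightarrow> F i \<in> S" "\<And>i. i < N \<Longrightarrow> lowest d (F i) (a i)"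
      "\<And>i. i < N \<Longrightarrow> cf d (F i) (a i) = 1"
    by metis
  have ind: "frame_indep N F"
    using lowest_indep[OF a_mono F(2)] .
  let ?T = "{\<Sum>i<N. form_scale (c i) (F i) | c. True}"
  note T = ordered_basis_frame[OF ind]
  note subT = ordered_basis_subspace[OF T]
  \<comment> \<open>Induction on the number \<open>k\<close> of top coefficients that may be
    nonzero: \<open>k = 0\<close> forces \<open>G = 0\<close>, and \<open>k = Suc d\<close> imposes
    no condition on \<open>G\<close>.\<close>
  have "G \<in> ?T" if "G \<in> S" "\<And>m. m + k < d + 1 \<Longrightarrow> cf d G m = 0" for G k
    using that
  proof (induction k arbitrary: G)
    case 0
    then have "G = 0"
      using S by (intro Sym_eqI[of G d]) (auto simp: zero_Sym cf_zero)
    then show ?case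
      using form.subspace_0[OF subT] by simp
  next
    case (Suc k)
    show ?case
    proof (cases "k \<le> d \<and> cf d G (d - k) \<noteq> 0")
      case False
      have "cf d G m = 0" if "m + k < d + 1" for m
        using Suc.prems(2)[of m] False that by (cases "m = d - k") auto
      then show ?thesis
        using Suc.IH Suc.prems(1) by blast
    next
      case True
      let ?m = "d - k"
      have "lowest d G ?m"
        using True Suc.prems(2) by (auto simp: lowest_def)
      then have "?m \<in> Or"
        using Suc.prems(1) by (auto simp: Or_def)
      then obtain i where i: "i < N" "a i = ?m"
        using a_img by (metis image_iff lessThan_iff)
      let ?H = "form_scale (cf d G ?m) (F i)"
      have "cf d (G - ?H) m = 0" if "m + k < d + 1" for m
      proof -
        have "cf d (G - ?H) m = cf d G m - cf d G ?m * cf d (F i) m"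
          using cf_add[of d "G - ?H" ?H m] by (simp add: cf_scale)
        moreover have "m = ?m \<or> m < ?m" 
          using that by auto
        ultimately show ?thesis
          using F(2,3)[OF i(1)] Suc.prems(2)[of m] i(2) True by (auto simp: lowest_def)
      qed
      moreover have "G - ?H \<in> S"
        using Suc.prems(1) F(1)[OF i(1)] by (intro form.subspace_diff[OF sub] form.subspace_scale[OF sub])
      ultimately have "G - ?H \<in> ?T"
        using Suc.IH by blast
      moreover have "?H \<in> ?T"
        using ordered_basis_mem[OF T i(1)] by (intro form.subspace_scale[OF subT])
      ultimately show ?thesis
        using form.subspace_add[OF subT, of "G - ?H" ?H] by simp
    qed
  qed
  from this[of _ "Suc d"] have "S \<subseteq> ?T"
    by auto
  moreover have "?T \<subseteq> S"
    by (rule frame_span_subset[OF F(1) sub])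
  ultimately have "S = ?T" by blast
  then have ob: "ordered_basis N S F"
    using T by simp
  then have "N = n"
    using ordered_basis_dim[OF ob] ordered_basis_dim[OF f] by simp
  then show ?thesis
    using that a_mono F ob by blast
qed

text \<open>In the columns \<open>a 0 < a 1 < ...\<close> the coefficient matrix is upper triangular
  with the lowest coefficients on the diagonal.\<close>

lemma lowest_pluecker:
  assumes a: "strict_mono_on {..<n} a" and F: "\<And>i. i < n \<Longrightarrow> lowest d (F i) (a i)"
  shows "pluecker n d F (a ` {..<n}) \<noteq> 0"
proof -
  have "sorted_list_of_set (a ` {..<n}) = map a [0..<n]"
  proof (rule sorted_list_of_set_unique[THEN iffD1])
    show "sorted_wrt (<) (map a [0..<n]) \<and> set (map a [0..<n]) = a ` {..<n} \<and> length (map a [0..<n]) = card (a ` {..<n})"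
      using a by (auto simp: sorted_wrt_iff_nth_less strict_mono_on_def card_image strict_mono_on_imp_inj_on)
  qed simp
  then have nth: "sorted_list_of_set (a ` {..<n}) ! j = a j" if "j < n" for j
    using that by simp
  let ?M = "Matrix.mat n n (\<lambda>(i, j). cf d (F i) (sorted_list_of_set (a ` {..<n}) ! j))"
  have ut: "upper_triangular ?M"
    unfolding upper_triangular_def
  proof (intro allI impI)
    fix i j assume ij: "i < dim_row ?M" "j < i"
    then have "a j < a i"
      using a by (auto simp: strict_mono_on_def)
    then show "?M $$ (i, j) = 0"
      using F[of i] ij by (simp add: nth lowest_def)
  qed
  have diag: "0 \<notin> set (diag_mat ?M)"
    using F by (auto simp: diag_mat_def nth lowest_def)
  show ?thesis
    unfolding pluecker_mat using upper_triangular_imp_det_eq_0_iff[OF _ ut] diag by force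
qed

text \<open>The orders of vanishing of an adapted basis form an index set at which the coordinate is
  nonzero; passing between bases only multiplies it by a determinant.\<close>

lemma pluecker_nonzero:
  assumes f: "ordered_basis n S f" and S: "S \<subseteq> Sym d"
  shows "\<exists>I\<in>pluecker_index n d. pluecker n d f I \<noteq> 0"
proof -
  obtain a F where a: "strict_mono_on {..<n} a" and F: "\<And>i. i < n \<Longrightarrow> lowest d (F i) (a i)"
      and ob: "ordered_basis n S F"
    by (rule adapted_basis[OF assms]) (rule that; assumption)
  obtain M where M: "M \<in> carrier_mat n n" "\<And>i. i < n \<Longrightarrow> F i = comb n M f i"
    using ordered_basis_coords[of n S f F, OF f ordered_basis_mem[OF ob]] by blast
  have "pluecker n d F I = Determinant.det M * pluecker n d f I" for I
    using pluecker_comb[OF M(1)] pluecker_cong[of n F "comb n M f"] M(2) by simp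
  then have "pluecker n d f (a ` {..<n}) \<noteq> 0"
    using lowest_pluecker[OF a F] by auto
  moreover have "a ` {..<n} \<in> pluecker_index n d"
    using F strict_mono_on_imp_inj_on[OF a] by (auto simp: pluecker_index_def lowest_def card_image)
  ultimately show ?thesis by blast
qed

text \<open>
  Membership in \<open>S\<close> is expressed by Laplace expansion in terms of the Pluecker coordinates, so
  that \<open>S\<close> can be recovered from them.
\<close>

lemma pluecker_extend:
  assumes I: "I \<in> pluecker_index (Suc n) d"
  shows "pluecker (Suc n) d (f(n := G)) I =
    (\<Sum>j\<le>n. cf d G (sorted_list_of_set I ! j) * ((-1) ^ (n + j) * pluecker n d f (I - {sorted_list_of_set I ! j})))"
proof -
  define l where "l = sorted_list_of_set I"
  have I': "finite I" "card I = Suc n"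
    using I finite_subset by (auto simp: pluecker_index_def)
  have l: "length l = Suc n" "sorted l" "distinct l" "set l = I"
    using I' by (auto simp: l_def)
  let ?M = "Matrix.mat (Suc n) (Suc n) (\<lambda>(i, j). cf d ((f(n := G)) i) (l ! j))"
  have cof: "cofactor ?M n j = (-1) ^ (n + j) * pluecker n d f (I - {l ! j})" if j: "j \<le> n" for j
  proof -
    have "sorted_list_of_set (I - {l ! j}) = remove1 (l ! j) l"
      using I'(1) by (simp add: l_def sorted_list_of_set_remove)
    also have "\<dots> = take j l @ drop (Suc j) l"
    proof -
      have "l = take j l @ l ! j # drop (Suc j) l"
        using j l(1) by (simp add: id_take_nth_drop)
      moreover have "l ! j \<notin> set (take j l)"
        using l(1,3) j by (auto simp: in_set_conv_nth nth_eq_iff_index_eq)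
      ultimately show ?thesis
        by (metis remove1_append remove1.simps(2))
    qed
    finally have nth: "sorted_list_of_set (I - {l ! j}) ! i = l ! (if i < j then i else Suc i)" if "i < n" for i
      using that j l(1) by (auto simp: nth_append min_def)
    have "mat_delete ?M n j = Matrix.mat n n (\<lambda>(i, k). cf d (f i) (sorted_list_of_set (I - {l ! j}) ! k))"
      by (rule eq_matI) (auto simp: mat_delete_def nth)
    then show ?thesis
      by (simp add: cofactor_def pluecker_mat)
  qed
  have "pluecker (Suc n) d (f(n := G)) I = (\<Sum>j<Suc n. ?M $$ (n, j) * cofactor ?M n j)"
    unfolding pluecker_mat l_def by (rule laplace_expansion_row) auto
  also have "\<dots> = (\<Sum>j\<le>n. cf d G (l ! j) * ((-1) ^ (n + j) * pluecker n d f (I - {l ! j})))"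
    unfolding lessThan_Suc_atMost using cof by (intro sum.cong) auto
  finally show ?thesis
    by (simp add: l_def)
qed

text \<open>Extending a basis by \<open>G\<close> gives a dependent family exactly when
  \<open>G\<close> lies in \<open>S\<close>, and a family of forms is dependent exactly when all its
  maximal minors vanish.\<close>

lemma mem_iff_pluecker_extend:
  assumes f: "ordered_basis n S f" and S: "S \<subseteq> Sym d" and G: "G \<in> Sym d"
  shows "G \<in> S \<longleftrightarrow> (\<forall>I\<in>pluecker_index (Suc n) d. pluecker (Suc n) d (f(n := G)) I = 0)"
proof -
  let ?f = "f(n := G)"
  have sum_Suc: "(\<Sum>i<Suc n. form_scale (c i) (?f i)) = (\<Sum>i<n. form_scale (c i) (f i)) + form_scale (c n) G" for c
    by simp
  have "\<not> frame_indep (Suc n) ?f" if GS: "G \<in> S"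
  proof
    assume ind: "frame_indep (Suc n) ?f"
    obtain c where c: "G = (\<Sum>i<n. form_scale (c i) (f i))"
      using ordered_basis_span[OF f GS] by blast
    have "(\<Sum>i<Suc n. form_scale ((c(n := -1)) i) (?f i)) = 0"
      unfolding sum_Suc by (simp add: c)
    from frame_indepD[OF ind this, of n] show False by simp
  qed
  moreover have "frame_indep (Suc n) ?f" if GS: "G \<notin> S"
    unfolding frame_indep_def
  proof (intro allI impI)
    fix c i assume c: "(\<Sum>i<Suc n. form_scale (c i) (?f i)) = 0" and i: "i < Suc n"
    have cn: "c n = 0"
    proof (rule ccontr)
      assume nz: "c n \<noteq> 0"
      have "form_scale (c n) G = - (\<Sum>i<n. form_scale (c i) (f i))"
        using c unfolding sum_Suc by (simp add: eq_neg_iff_add_eq_0 add.commute)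
      also have "\<dots> \<in> S"
        using ordered_basis_mem[OF f] ordered_basis_subspace[OF f]
        by (intro form.subspace_neg form.subspace_sum form.subspace_scale) auto
      finally have "form_scale (inverse (c n)) (form_scale (c n) G) \<in> S"
        by (rule form.subspace_scale[OF ordered_basis_subspace[OF f]])
      moreover have "form_scale (inverse (c n)) (form_scale (c n) G) = G"
        using nz by simp
      ultimately show False
        using GS by simp
    qed
    then have "(\<Sum>i<n. form_scale (c i) (f i)) = 0"
      using c unfolding sum_Suc by simp
    then show "c i = 0"
      using frame_indepD[OF ordered_basis_indep[OF f]] cn i by (cases "i = n") auto
  qed
  moreover have "\<exists>I\<in>pluecker_index (Suc n) d. pluecker (Suc n) d ?f I \<noteq> 0" if ind: "frame_indep (Suc n) ?f"
  proof (rule pluecker_nonzero[OF ordered_basis_frame[OF ind]])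
    show "{\<Sum>i<Suc n. form_scale (c i) (?f i) | c. True} \<subseteq> Sym d"
      using ordered_basis_mem[OF f] S G by (intro frame_span_subset subspace_Sym) auto
  qed
  ultimately show ?thesis
    using pluecker_dependent by metis
qed

text \<open>Injectivity of the Pluecker embedding: by \<open>pluecker_extend\<close> the equations
  for \<open>G\<close> to lie in \<open>S\<close> and in \<open>T\<close> are proportional. The
  factor is nonzero because \<open>T\<close> has a nonzero coordinate.\<close>

lemma pluecker_proportional:
  assumes f: "ordered_basis n S f" "S \<subseteq> Sym d" and h: "ordered_basis n T h" "T \<subseteq> Sym d"
    and eq: "\<And>I. I \<in> pluecker_index n d \<Longrightarrow> pluecker n d h I = \<mu> * pluecker n d f I"
  shows "S = T"
proof -
  have \<mu>: "\<mu> \<noteq> 0"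
    using pluecker_nonzero[OF h] eq by auto
  have "pluecker (Suc n) d (h(n := G)) I = \<mu> * pluecker (Suc n) d (f(n := G)) I"
    if I: "I \<in> pluecker_index (Suc n) d" for G I
  proof -
    have "I - {sorted_list_of_set I ! j} \<in> pluecker_index n d" if "j \<le> n" for j
    proof -
      have "finite I" "card I = Suc n" "I \<subseteq> {..d}"
        using I finite_subset by (auto simp: pluecker_index_def)
      moreover from this have "sorted_list_of_set I ! j \<in> I"
        using that nth_mem[of j "sorted_list_of_set I"] by simp
      ultimately show ?thesis
        by (auto simp: pluecker_index_def)
    qed
    then show ?thesis
      unfolding pluecker_extend[OF I] sum_distrib_left by (intro sum.cong) (auto simp: eq mult_ac)
  qed
  then have "G \<in> S \<longleftrightarrow> G \<in> T" if "G \<in> Sym d" for G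
    using mem_iff_pluecker_extend[OF f that] mem_iff_pluecker_extend[OF h that] \<mu> by simp
  then show ?thesis
    using f(2) h(2) by blast
qed

section \<open>Polynomials in the Pluecker coordinates\<close>

text \<open>Polynomials over \<open>k\<close> are evaluated at points with coordinates in
  \<open>k\<close>, in the function field, and in the polynomials over \<open>k\<close>;
  \<open>\<iota>\<close> is the embedding of \<open>k\<close> in each case.\<close>

definition mpoly_eval_hom ::
    "('k::field \<Rightarrow> 'a::comm_ring_1) \<Rightarrow> (('x \<Rightarrow>\<^sub>0 nat) \<Rightarrow>\<^sub>0 'k) \<Rightarrow> ('x \<Rightarrow> 'a) \<Rightarrow> 'a" where
  "mpoly_eval_hom \<iota> P x = (\<Sum>m\<in>Poly_Mapping.keys P.
     \<iota> (Poly_Mapping.lookup P m) * (\<Prod>i\<in>Poly_Mapping.keys m. x i ^ Poly_Mapping.lookup m i))"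

lemma mpoly_eval_hom_id: "mpoly_eval_hom (\<lambda>c. c) = mpoly_eval"
  by (simp add: fun_eq_iff mpoly_eval_hom_def mpoly_eval_def)

definition power_prod :: "('x \<Rightarrow> 'a::comm_ring_1) \<Rightarrow> ('x \<Rightarrow>\<^sub>0 nat) \<Rightarrow> 'a" where
  "power_prod x m = (\<Prod>i\<in>Poly_Mapping.keys m. x i ^ Poly_Mapping.lookup m i)"

lemma power_prod_superset:
  assumes "finite A" "Poly_Mapping.keys m \<subseteq> A"
  shows "power_prod x m = (\<Prod>i\<in>A. x i ^ Poly_Mapping.lookup m i)"
  unfolding power_prod_def using assms
  by (intro prod.mono_neutral_left) (auto simp: in_keys_iff)

lemma power_prod_add: "power_prod x (m + m') = power_prod x m * power_prod x m'"
proof -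
  let ?A = "Poly_Mapping.keys m \<union> Poly_Mapping.keys m'"
  have "Poly_Mapping.keys (m + m') \<subseteq> ?A"
    by (rule Poly_Mapping.keys_add)
  then show ?thesis
    by (simp add: power_prod_superset[of ?A] lookup_add power_add prod.distrib)
qed

lemma mpoly_eval_hom_superset:
  assumes "\<iota> 0 = 0" "finite A" "Poly_Mapping.keys P \<subseteq> A"
  shows "mpoly_eval_hom \<iota> P x = (\<Sum>m\<in>A. \<iota> (Poly_Mapping.lookup P m) * power_prod x m)"
  unfolding mpoly_eval_hom_def power_prod_def using assms
  by (intro sum.mono_neutral_left) (auto simp: in_keys_iff)

lemma mpoly_eval_hom_single:
  assumes "\<iota> 0 = 0"
  shows "mpoly_eval_hom \<iota> (Poly_Mapping.single m c) x = \<iota> c * power_prod x m"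
  using mpoly_eval_hom_superset[of \<iota> "{m}" "Poly_Mapping.single m c" x] assms by (simp add: lookup_single)

lemma mpoly_eval_hom_add:
  assumes "subring_hom UNIV \<iota>"
  shows "mpoly_eval_hom \<iota> (P + Q) x = mpoly_eval_hom \<iota> P x + mpoly_eval_hom \<iota> Q x"
proof -
  interpret subring_hom UNIV \<iota> by fact
  let ?A = "Poly_Mapping.keys P \<union> Poly_Mapping.keys Q"
  have "Poly_Mapping.keys (P + Q) \<subseteq> ?A"
    by (rule Poly_Mapping.keys_add)
  then show ?thesis
    by (simp add: mpoly_eval_hom_superset[of \<iota> ?A] lookup_add hom_zero hom_add distrib_right sum.distrib)
qed

lemma mpoly_eval_hom_sum:
  assumes "subring_hom UNIV \<iota>"
  shows "mpoly_eval_hom \<iota> (sum \<phi> I) x = (\<Sum>i\<in>I. mpoly_eval_hom \<iota> (\<phi> i) x)"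
  by (induction I rule: infinite_finite_induct)
    (auto simp: mpoly_eval_hom_add[OF assms] mpoly_eval_hom_def[of _ 0])

lemma mpoly_sum_single: "P = (\<Sum>m\<in>Poly_Mapping.keys P. Poly_Mapping.single m (Poly_Mapping.lookup P m))"
  for P :: "'a \<Rightarrow>\<^sub>0 'b::comm_monoid_add"
proof (rule poly_mapping_eqI)
  fix k
  show "Poly_Mapping.lookup P k = Poly_Mapping.lookup (\<Sum>m\<in>Poly_Mapping.keys P. Poly_Mapping.single m (Poly_Mapping.lookup P m)) k"
    by (auto simp: lookup_sum lookup_single when_def in_keys_iff)
qed

lemma mpoly_eval_hom_mult:
  assumes "subring_hom UNIV \<iota>"
  shows "mpoly_eval_hom \<iota> (P * Q) x = mpoly_eval_hom \<iota> P x * mpoly_eval_hom \<iota> Q x"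
proof -
  interpret subring_hom UNIV \<iota> by fact
  have "P * Q = (\<Sum>m\<in>Poly_Mapping.keys P. Poly_Mapping.single m (Poly_Mapping.lookup P m)) *
      (\<Sum>m\<in>Poly_Mapping.keys Q. Poly_Mapping.single m (Poly_Mapping.lookup Q m))"
    by (rule arg_cong2[OF mpoly_sum_single mpoly_sum_single])
  then have PQ: "P * Q = (\<Sum>m\<in>Poly_Mapping.keys P. \<Sum>m'\<in>Poly_Mapping.keys Q.
      Poly_Mapping.single (m + m') (Poly_Mapping.lookup P m * Poly_Mapping.lookup Q m'))"
    by (simp only: sum_product mult_single)
  have "mpoly_eval_hom \<iota> (P * Q) x = (\<Sum>m\<in>Poly_Mapping.keys P. \<Sum>m'\<in>Poly_Mapping.keys Q.
      (\<iota> (Poly_Mapping.lookup P m) * power_prod x m) * (\<iota> (Poly_Mapping.lookup Q m') * power_prod x m'))"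
    unfolding PQ
    by (simp add: mpoly_eval_hom_sum[OF assms] mpoly_eval_hom_single hom_zero hom_mult power_prod_add mult_ac)
  then show ?thesis
    by (simp only: mpoly_eval_hom_def sum_product flip: power_prod_def)
qed

text \<open>The degree is a parameter because the homomorphism on ratios of Pluecker coordinates
  divides by a power of one coordinate that depends on it. The zero polynomial has every
  degree.\<close>

definition homogeneous_degree :: "'x set \<Rightarrow> nat \<Rightarrow> (('x \<Rightarrow>\<^sub>0 nat) \<Rightarrow>\<^sub>0 'k::field) \<Rightarrow> bool" where
  "homogeneous_degree X e P \<longleftrightarrow> (\<forall>m\<in>Poly_Mapping.keys P. Poly_Mapping.keys m \<subseteq> X \<and>
       (\<Sum>i\<in>Poly_Mapping.keys m. Poly_Mapping.lookup m i) = e)"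

lemma homogeneous_in_iff: "homogeneous_in X P \<longleftrightarrow> (\<exists>e. homogeneous_degree X e P)"
  by (simp add: homogeneous_in_def homogeneous_degree_def)

lemma homogeneous_degree_add:
  "homogeneous_degree X e P \<Longrightarrow> homogeneous_degree X e Q \<Longrightarrow> homogeneous_degree X e (P + Q)"
  using Poly_Mapping.keys_add[of P Q] unfolding homogeneous_degree_def by blast

lemma homogeneous_degree_const: "homogeneous_degree X 0 (Poly_Mapping.single 0 c)"
  by (simp add: homogeneous_degree_def)

lemma homogeneous_degree_mult:
  assumes "homogeneous_degree X e P" "homogeneous_degree X e' Q"
  shows "homogeneous_degree X (e + e') (P * Q)"
  unfolding homogeneous_degree_def
proof
  fix m assume "m \<in> Poly_Mapping.keys (P * Q)"
  then obtain a b where ab: "m = a + b" "a \<in> Poly_Mapping.keys P" "b \<in> Poly_Mapping.keys Q"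
    using keys_mult[of P Q] by blast
  have deg: "(\<Sum>i\<in>Poly_Mapping.keys c. Poly_Mapping.lookup c i) =
      (\<Sum>i\<in>Poly_Mapping.keys a \<union> Poly_Mapping.keys b. Poly_Mapping.lookup c i)"
    if "Poly_Mapping.keys c \<subseteq> Poly_Mapping.keys a \<union> Poly_Mapping.keys b" for c
    using that by (intro sum.mono_neutral_left) (auto simp: in_keys_iff)
  have m: "Poly_Mapping.keys m \<subseteq> Poly_Mapping.keys a \<union> Poly_Mapping.keys b"
    unfolding ab(1) by (rule Poly_Mapping.keys_add)
  have "(\<Sum>i\<in>Poly_Mapping.keys m. Poly_Mapping.lookup m i) =
      (\<Sum>i\<in>Poly_Mapping.keys a. Poly_Mapping.lookup a i) + (\<Sum>i\<in>Poly_Mapping.keys b. Poly_Mapping.lookup b i)"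
    unfolding deg[OF m] by (simp add: deg ab(1) lookup_add sum.distrib)
  then show "Poly_Mapping.keys m \<subseteq> X \<and> (\<Sum>i\<in>Poly_Mapping.keys m. Poly_Mapping.lookup m i) = e + e'"
    using assms ab(2,3) m unfolding homogeneous_degree_def by (metis (no_types, lifting) Un_least order_trans)
qed

lemma power_prod_scale:
  "power_prod (\<lambda>i. c * x i) m = c ^ (\<Sum>i\<in>Poly_Mapping.keys m. Poly_Mapping.lookup m i) * power_prod x m"
  by (simp add: power_prod_def power_mult_distrib prod.distrib power_sum)

lemma mpoly_eval_hom_scale:
  assumes "homogeneous_degree X e P"
  shows "mpoly_eval_hom \<iota> P (\<lambda>i. c * x i) = c ^ e * mpoly_eval_hom \<iota> P x"
  unfolding mpoly_eval_hom_def sum_distrib_left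
proof (rule sum.cong[OF refl])
  fix m assume "m \<in> Poly_Mapping.keys P"
  then have "(\<Sum>i\<in>Poly_Mapping.keys m. Poly_Mapping.lookup m i) = e"
    using assms by (auto simp: homogeneous_degree_def)
  then show "\<iota> (Poly_Mapping.lookup P m) * (\<Prod>i\<in>Poly_Mapping.keys m. (c * x i) ^ Poly_Mapping.lookup m i) =
      c ^ e * (\<iota> (Poly_Mapping.lookup P m) * (\<Prod>i\<in>Poly_Mapping.keys m. x i ^ Poly_Mapping.lookup m i))"
    using power_prod_scale[of c x m] by (simp add: power_prod_def mult_ac)
qed

lemma (in subring_hom) mpoly_eval_hom_mem_hom:
  assumes "\<And>c. \<iota> c \<in> A" "\<And>c. h (\<iota> c) = \<kappa> c" "\<And>i. x i \<in> A"
  shows "mpoly_eval_hom \<iota> P x \<in> A \<and> h (mpoly_eval_hom \<iota> P x) = mpoly_eval_hom \<kappa> P (\<lambda>i. h (x i))"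
  unfolding mpoly_eval_hom_def using assms
  by (simp add: sum_mem hom_sum mult_mem hom_mult prod_mem hom_prod power_mem hom_power)

section \<open>Specialization of forms\<close>

abbreviation map_form :: "('a::zero \<Rightarrow> 'b::zero) \<Rightarrow> 'a poly poly \<Rightarrow> 'b poly poly" where
  "map_form h \<equiv> map_poly (map_poly h)"

definition forms_in :: "'a::zero set \<Rightarrow> 'a poly poly set" where
  "forms_in A = {F. \<forall>i j. coeff (coeff F i) j \<in> A}"

lemma forms_in_eq: "forms_in A = coeffs_in (coeffs_in A)"
  by (simp add: forms_in_def coeffs_in_def)

definition map_mat2 :: "('a \<Rightarrow> 'b) \<Rightarrow> 'a ^ 2 ^ 2 \<Rightarrow> 'b ^ 2 ^ 2" where
  "map_mat2 h g = (\<chi> i j. h (g $ i $ j))"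

lemma map_mat2_mat2: "map_mat2 h (mat2 a b c e) = mat2 (h a) (h b) (h c) (h e)"
  by (simp add: map_mat2_def mat2_def Finite_Cartesian_Product.vec_eq_iff)

locale field_subring_hom = subring_hom A h for A :: "'K::field set" and h :: "'K \<Rightarrow> 'k::field"
begin

sublocale P: subring_hom "coeffs_in A" "map_poly h"
  by (rule subring_hom_map_poly) (rule subring_hom_axioms)

sublocale F: subring_hom "forms_in A" "map_form h"
  unfolding forms_in_eq by (rule subring_hom_map_poly) (rule P.subring_hom_axioms)

lemma coeff_map_form: "coeff (coeff (map_form h F) i) j = h (coeff (coeff F i) j)"
  by (simp add: coeff_map_poly hom_zero)

lemma cf_map_form: "cf d (map_form h F) m = h (cf d F m)"
  by (simp add: cf_def coeff_map_form)

lemma cf_mem: "F \<in> forms_in A \<Longrightarrow> cf d F m \<in> A"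
  by (simp add: forms_in_def cf_def)

lemma map_form_Sym: "F \<in> Sym d \<Longrightarrow> map_form h F \<in> Sym d"
  by (auto simp: Sym_def coeff_map_form) (metis hom_zero)

lemma Sym_forms_in:
  assumes "F \<in> Sym d" "\<And>m. m \<le> d \<Longrightarrow> cf d F m \<in> A"
  shows "F \<in> forms_in A"
  unfolding forms_in_def
proof safe
  fix i j
  show "coeff (coeff F i) j \<in> A"
    using SymD[OF assms(1), of i j] assms(2)[of i] zero_mem by (cases "coeff (coeff F i) j = 0") (auto simp: cf_def)
qed

lemma form_scale_mem_hom:
  assumes "c \<in> A" "F \<in> forms_in A"
  shows "form_scale c F \<in> forms_in A \<and> map_form h (form_scale c F) = form_scale (h c) (map_form h F)"
  using assms by (auto simp: forms_in_def coeff_form_scale mult_mem hom_mult poly_eq_iff coeff_map_form)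

lemma lin_mem_hom:
  fixes v :: "'K ^ 2"
  assumes "v $ 1 \<in> A" "v $ 2 \<in> A"
  shows "lin v \<in> forms_in A \<and> map_form h (lin v) = lin (\<chi> i. h (v $ i))"
  using assms by (auto simp: forms_in_def lin_def coeff_pCons poly_eq_iff coeff_map_form zero_mem hom_zero split: nat.splits)

lemma sym_act_mem_hom:
  fixes g :: "'K ^ 2 ^ 2"
  assumes g: "\<And>i j. g $ i $ j \<in> A" and F: "F \<in> Sym d" "F \<in> forms_in A"
  shows "sym_act g F \<in> forms_in A \<and> map_form h (sym_act g F) = sym_act (map_mat2 h g) (map_form h F)"
proof -
  have e: "g *v axis k 1 = (\<chi> i. g $ i $ k)" for g :: "'c::field ^ 2 ^ 2" and k
    using exhaust_2[of k] by (auto simp: Finite_Cartesian_Product.vec_eq_iff matrix_vector_mult_def sum_2 axis_def)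
  have l: "lin (g *v axis k 1) \<in> forms_in A \<and>
      map_form h (lin (g *v axis k 1)) = lin (map_mat2 h g *v axis k 1)" for k
    using lin_mem_hom[of "g *v axis k 1"] g by (simp add: e map_mat2_def)
  show ?thesis
    unfolding sym_act_expand[OF F(1)] sym_act_expand[OF map_form_Sym[OF F(1)]]
    using l by (simp add: F.sum_mem F.hom_sum form_scale_mem_hom cf_mem[OF F(2)] cf_map_form
        F.mult_mem F.hom_mult F.power_mem F.hom_power)
qed

lemma pluecker_mem_hom:
  assumes "\<And>i. i < n \<Longrightarrow> f i \<in> forms_in A"
  shows "pluecker n d f I \<in> A \<and> h (pluecker n d f I) = pluecker n d (\<lambda>i. map_form h (f i)) I"
proof -
  let ?M = "Matrix.mat n n (\<lambda>(i, j). cf d (f i) (sorted_list_of_set I ! j))"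
  have "map_mat h ?M = Matrix.mat n n (\<lambda>(i, j). cf d (map_form h (f i)) (sorted_list_of_set I ! j))"
    by (rule eq_matI) (auto simp: cf_map_form)
  then show ?thesis
    unfolding pluecker_mat using det_mem_hom[of ?M n] assms by (simp add: cf_mem)
qed

lemma comb_mem_hom:
  assumes "\<And>j. j < n \<Longrightarrow> M $$ (i, j) \<in> A" "\<And>j. j < n \<Longrightarrow> f j \<in> forms_in A" "M \<in> carrier_mat n n" "i < n"
  shows "comb n M f i \<in> forms_in A \<and> map_form h (comb n M f i) = comb n (map_mat h M) (\<lambda>j. map_form h (f j)) i"
  unfolding comb_def
  using F.sum_mem_hom[of "{..<n}" "\<lambda>j. form_scale (M $$ (i, j)) (f j)"] assms form_scale_mem_hom
  by (auto intro!: sum.cong)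

end

section \<open>Monomial subspaces and vanishing sequences\<close>

lemma invertible_inverse:
  fixes g :: "'a::field ^ 2 ^ 2"
  assumes "invertible g"
  obtains g' where "g ** g' = Finite_Cartesian_Product.mat 1" "g' ** g = Finite_Cartesian_Product.mat 1" "invertible g'"
  using assms unfolding invertible_def by blast

lemma invertible_one: "invertible (Finite_Cartesian_Product.mat 1 :: 'a::field ^ 2 ^ 2)"
  unfolding invertible_def by (rule exI[of _ "Finite_Cartesian_Product.mat 1"]) simp

lemma GL2_orbitI: "invertible g \<Longrightarrow> sym_act g ` S \<in> GL2_orbit S"
  by (auto simp: GL2_orbit_def)

lemma GL2_orbitE:
  assumes "T \<in> GL2_orbit S"
  obtains g where "invertible g" "T = sym_act g ` S"
  using assms by (auto simp: GL2_orbit_def)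

lemma GL2_orbit_self: "S \<in> GL2_orbit S"
  using GL2_orbitI[OF invertible_one, of S] by (simp add: sym_act_id)

lemma sym_act_image_compose: "sym_act g ` sym_act h ` S = sym_act (g ** h) ` S"
  by (simp add: image_image sym_act_compose)

lemma GL2_orbit_act: "invertible g \<Longrightarrow> T \<in> GL2_orbit S \<Longrightarrow> sym_act g ` T \<in> GL2_orbit S"
  by (elim GL2_orbitE) (simp add: sym_act_image_compose GL2_orbitI invertible_mult)

lemma GL2_orbit_eq:
  assumes "invertible g"
  shows "GL2_orbit (sym_act g ` S) = GL2_orbit S"
proof -
  obtain g' where g': "g' ** g = Finite_Cartesian_Product.mat 1" "invertible g'"
    using invertible_inverse[OF assms] by blast
  have S: "S \<in> GL2_orbit (sym_act g ` S)"
    using GL2_orbitI[OF g'(2), of "sym_act g ` S"] g'(1) by (simp add: sym_act_image_compose sym_act_id)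
  show ?thesis
  proof
    show "GL2_orbit (sym_act g ` S) \<subseteq> GL2_orbit S"
      using GL2_orbit_act GL2_orbitI[OF assms] by (blast elim: GL2_orbitE)
    show "GL2_orbit S \<subseteq> GL2_orbit (sym_act g ` S)"
      using GL2_orbit_act S by (blast elim: GL2_orbitE)
  qed
qed

text \<open>The orbits of the theorem are merged into one set of subspaces, so that a single limit
  can be discussed apart from the finiteness of the list of orbits.\<close>

definition limit_set :: "nat \<Rightarrow> nat \<Rightarrow> 'k::field poly poly set \<Rightarrow> 'k poly poly set set" where
  "limit_set d r S = GL2_orbit S \<union> \<Union> {GL2_orbit (monomial_subspace d r a w1 w2) | a w1 w2.
     (\<exists>v. v \<noteq> 0 \<and> vanishing_sequence r S v a) \<and> is_basis2 w1 w2}"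

lemma limit_set_self: "S \<in> limit_set d r S"
  by (simp add: limit_set_def GL2_orbit_self)

lemma limit_setI:
  "v \<noteq> 0 \<Longrightarrow> vanishing_sequence r S v a \<Longrightarrow> is_basis2 w1 w2 \<Longrightarrow>
    T \<in> GL2_orbit (monomial_subspace d r a w1 w2) \<Longrightarrow> T \<in> limit_set d r S"
  unfolding limit_set_def by blast

lemma limit_setE:
  assumes "T \<in> limit_set d r S"
  obtains "T \<in> GL2_orbit S"
  | a v w1 w2 where "v \<noteq> 0" "vanishing_sequence r S v a" "is_basis2 w1 w2"
      "T \<in> GL2_orbit (monomial_subspace d r a w1 w2)"
  using assms unfolding limit_set_def by blast

lemma limit_set_act:
  assumes "invertible g" "T \<in> limit_set d r S"
  shows "sym_act g ` T \<in> limit_set d r S"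
  using assms(2)
proof (cases rule: limit_setE)
  case 1
  then show ?thesis
    using GL2_orbit_act[OF assms(1)] by (simp add: limit_set_def)
next
  case (2 a v w1 w2)
  then show ?thesis
    using GL2_orbit_act[OF assms(1)] by (intro limit_setI) auto
qed

section \<open>Orders of vanishing under the action\<close>

lemma sym_act_dvd: "F dvd G \<Longrightarrow> sym_act g F dvd sym_act g G"
  by (auto simp: dvd_def sym_act_mult)

lemma vanishes_to_order_act:
  assumes "invertible g" "vanishes_to_order F v a"
  shows "vanishes_to_order (sym_act g F) (g *v v) a"
proof -
  obtain g' where g': "g' ** g = Finite_Cartesian_Product.mat 1"
    using assms(1) unfolding invertible_def by blast
  have "lin v ^ b dvd F" if "lin (g *v v) ^ b dvd sym_act g F" for b
    using sym_act_dvd[OF that, of g'] g'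
    by (simp add: sym_act_power sym_act_lin matrix_vector_mul_assoc sym_act_inverse)
  moreover have "lin (g *v v) ^ a dvd sym_act g F"
    using sym_act_dvd[of "lin v ^ a" F g] assms(2) by (simp add: vanishes_to_order_def sym_act_power sym_act_lin)
  moreover have "sym_act g F \<noteq> 0"
    using assms(2) sym_act_inj[OF assms(1), of F 0] by (auto simp: vanishes_to_order_def sym_act_zero)
  ultimately show ?thesis
    using assms(2) by (auto simp: vanishes_to_order_def)
qed

lemma vanishing_sequence_act:
  assumes "invertible g" "vanishing_sequence r S v a"
  shows "vanishing_sequence r (sym_act g ` S) (g *v v) a"
  using assms vanishes_to_order_act[OF assms(1)] unfolding vanishing_sequence_def by blast

lemma vanishing_sequence_act_iff:
  assumes "invertible g"
  shows "(\<exists>v. v \<noteq> 0 \<and> vanishing_sequence r (sym_act g ` S) v a) \<longleftrightarrow> (\<exists>v. v \<noteq> 0 \<and> vanishing_sequence r S v a)"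
proof -
  obtain g' where g': "g ** g' = Finite_Cartesian_Product.mat 1" "g' ** g = Finite_Cartesian_Product.mat 1"
    using assms unfolding invertible_def by blast
  then have inv: "invertible g'"
    unfolding invertible_def by blast
  have S: "sym_act g' ` sym_act g ` S = S"
    using g'(2) by (simp add: image_image sym_act_inverse)
  have nz: "g *v v \<noteq> 0" "g' *v v \<noteq> 0" if "v \<noteq> 0" for v
    using that g' by (metis matrix_vector_mul_assoc matrix_vector_mul_lid matrix_vector_mult_0_right)+
  show ?thesis
    using vanishing_sequence_act[OF assms, of r S] vanishing_sequence_act[OF inv, of r "sym_act g ` S"] nz
    unfolding S by blast
qed

text \<open>The vanishing sequence of \<open>S\<close> at \<open>v\<close> is that of the translate
  at \<open>g *v v\<close>, so the points of the line are only permuted. This allows constant right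
  factors to be absorbed into \<open>S\<close>.\<close>

lemma limit_set_eq:
  assumes "invertible g"
  shows "limit_set d r (sym_act g ` S) = limit_set d r S"
  unfolding limit_set_def GL2_orbit_eq[OF assms] vanishing_sequence_act_iff[OF assms] ..

lemma lin_e2_power: "lin (axis 2 1) ^ a = monom 1 a"
  by (simp add: lin_axis monom_altdef)

lemma lin_e2_power_dvd:
  assumes "F \<in> Sym d"
  shows "lin (axis 2 1) ^ a dvd F \<longleftrightarrow> (\<forall>m<a. cf d F m = 0)"
proof -
  have "coeff F m = 0 \<longleftrightarrow> cf d F m = 0" for m
  proof
    assume "cf d F m = 0"
    then have "coeff (coeff F m) j = 0" for j
      using SymD[OF assms, of m j] by (cases "m + j = d") (auto simp: cf_def)
    then show "coeff F m = 0"
      by (simp add: poly_eq_iff)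
  qed (simp add: cf_def)
  then show ?thesis
    by (simp add: lin_e2_power monom_1_dvd_iff')
qed

lemma vanishes_to_order_e2:
  assumes "F \<in> Sym d"
  shows "vanishes_to_order F (axis 2 1) a \<longleftrightarrow> lowest d F a"
proof
  assume v: "vanishes_to_order F (axis 2 1) a"
  then have "\<forall>m<a. cf d F m = 0" "\<not> (\<forall>m<Suc a. cf d F m = 0)"
    unfolding vanishes_to_order_def lin_e2_power_dvd[OF assms] by auto
  then have a: "\<forall>m<a. cf d F m = 0" "cf d F a \<noteq> 0"
    by (auto simp: less_Suc_eq)
  moreover have "a \<le> d"
  proof (rule ccontr)
    assume "\<not> a \<le> d"
    then have "F = 0"
      using a(1) by (intro Sym_eqI[OF assms zero_Sym]) (simp add: cf_zero)
    then show False
      using v by (simp add: vanishes_to_order_def)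
  qed
  ultimately show "lowest d F a"
    by (simp add: lowest_def)
next
  assume "lowest d F a"
  then show "vanishes_to_order F (axis 2 1) a"
    unfolding vanishes_to_order_def lin_e2_power_dvd[OF assms] lowest_def
    by (auto simp: cf_zero not_le[symmetric])
qed

definition mono_span :: "nat \<Rightarrow> nat \<Rightarrow> (nat \<Rightarrow> nat) \<Rightarrow> 'k::field poly poly set" where
  "mono_span d n a = form.span ((\<lambda>i. monoform d (a i)) ` {..<n})"

lemma lowest_monoform: "a \<le> d \<Longrightarrow> c \<noteq> 0 \<Longrightarrow> lowest d (form_scale c (monoform d a)) a"
  by (auto simp: lowest_def cf_scale cf_monoform)

lemma mono_span_basis:
  assumes a: "strict_mono_on {..<n} a" "\<And>i. i < n \<Longrightarrow> a i \<le> d" and c: "\<And>i. i < n \<Longrightarrow> c i \<noteq> 0"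
  shows "ordered_basis n (mono_span d n a) (\<lambda>i. form_scale (c i) (monoform d (a i)))"
proof -
  have "lowest d (monoform d (a i)) (a i)" if "i < n" for i
    using lowest_monoform[of "a i" d 1] a(2)[OF that] by simp
  then have ind: "frame_indep n (\<lambda>i. monoform d (a i))"
    by (rule lowest_indep[OF a(1)])
  then have ob: "ordered_basis n (mono_span d n a) (\<lambda>i. monoform d (a i))"
    unfolding ordered_basis_def mono_span_def
    using frame_indep_inj[OF ind] independent_frame[OF frame_indep_inj[OF ind]] by blast
  show ?thesis
  proof (rule ordered_basis_indepI[OF ob])
    show "form_scale (c i) (monoform d (a i)) \<in> mono_span d n a" if "i < n" for i
      using ordered_basis_mem[OF ob that] by (rule form.subspace_scale[OF ordered_basis_subspace[OF ob]])
    show "frame_indep n (\<lambda>i. form_scale (c i) (monoform d (a i)))"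
      using a c lowest_monoform by (intro lowest_indep[OF a(1), of d]) blast
  qed
qed

lemma monomial_subspace_standard: "monomial_subspace d r a (axis 1 1) (axis 2 1) = mono_span d (Suc r) a"
  by (simp add: monomial_subspace_def mono_span_def monoform_def lessThan_Suc_atMost)

lemma is_basis2_standard: "is_basis2 (axis 1 1) (axis 2 1 :: 'k::field ^ 2)"
proof -
  have ne: "axis 1 1 \<noteq> (axis 2 1 :: 'k ^ 2)"
    by (simp add: axis_eq_axis)
  have "v \<in> vec.span {axis 1 1, axis 2 1}" for v :: "'k ^ 2"
    by (subst vec2_basis[of v]) (intro vec.span_add vec.span_scale vec.span_base; simp)
  moreover have "vec.independent {axis 1 1 :: 'k ^ 2, axis 2 1}"
  proof -
    have "axis 1 1 \<noteq> c *s (axis 2 1 :: 'k ^ 2)" for c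
      by (auto simp: Finite_Cartesian_Product.vec_eq_iff forall_2 axis_def)
    then have "axis 1 1 \<notin> vec.span {axis 2 1 :: 'k ^ 2}"
      by (auto simp: vec.span_singleton)
    moreover have "axis 2 1 \<noteq> (0 :: 'k ^ 2)"
      by (simp add: axis_eq_0_iff)
    ultimately show ?thesis
      using ne by (simp add: vec.independent_insert)
  qed
  ultimately show ?thesis
    using ne by (auto simp: is_basis2_def)
qed

lemma monomial_limit:
  assumes "ordered_basis (Suc r) S f" "S \<subseteq> Sym d" "strict_mono_on {..<Suc r} a" "\<And>i. i < Suc r \<Longrightarrow> F i \<in> S \<and> lowest d (F i) (a i)"
  shows "mono_span d (Suc r) a \<in> limit_set d r S"
proof -
  have "\<exists>G\<in>S. vanishes_to_order G (axis 2 1) (a i)" if "i \<le> r" for i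
    using assms(2) assms(4)[of i] that vanishes_to_order_e2 by (intro bexI[of _ "F i"]) auto
  then have "vanishing_sequence r S (axis 2 1) a"
    using assms(3) by (simp add: vanishing_sequence_def lessThan_Suc_atMost)
  moreover have "axis 2 1 \<noteq> (0 :: 'a ^ 2)"
    by (simp add: axis_eq_0_iff)
  ultimately show ?thesis
    using is_basis2_standard GL2_orbit_self[of "mono_span d (Suc r) a"]
    by (intro limit_setI[of "axis 2 1" r S a "axis 1 1" "axis 2 1"]) (simp_all add: monomial_subspace_standard)
qed

section \<open>Specialization at a place\<close>

context place
begin

sublocale field_subring_hom V h
  by unfold_locales

sublocale C: field_subring_hom UNIV \<iota>
  unfolding field_subring_hom_def by (rule const_hom)

lemma const_nonzero: "c \<noteq> 0 \<Longrightarrow> \<iota> c \<noteq> 0"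
  using hom_const[of c] hom_zero by metis

lemma emb_forms_in: "map_form \<iota> F \<in> forms_in V"
  by (auto simp: forms_in_def C.coeff_map_form const_mem)

lemma red_emb: "map_form h (map_form \<iota> F) = F"
  by (simp add: poly_eq_iff coeff_map_form C.coeff_map_form hom_const)

text \<open>\<open>T\<close> is the limit of the subspace over \<open>K\<close> spanned by
  \<open>f\<close>: after a change of frame over \<open>K\<close> the forms have coefficients in
  \<open>V\<close>, and their reductions form a basis of \<open>T\<close>. The essential point is
  that independence survives the reduction.\<close>

definition specializes :: "nat \<Rightarrow> (nat \<Rightarrow> 'K poly poly) \<Rightarrow> 'k poly poly set \<Rightarrow> bool" where
  "specializes n f T \<longleftrightarrow> (\<exists>M\<in>carrier_mat n n. Determinant.det M \<noteq> 0 \<and>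
     (\<forall>i<n. comb n M f i \<in> forms_in V) \<and> ordered_basis n T (\<lambda>i. map_form h (comb n M f i)))"

lemma specializes_cong: "specializes n f T \<Longrightarrow> (\<And>i. i < n \<Longrightarrow> f i = g i) \<Longrightarrow> specializes n g T"
proof -
  assume s: "specializes n f T" and fg: "\<And>i. i < n \<Longrightarrow> f i = g i"
  have "comb n M f i = comb n M g i" for M i
    using fg by (rule comb_cong)
  then show "specializes n g T"
    using s unfolding specializes_def by simp
qed

lemma specializes_comb:
  assumes M: "M \<in> carrier_mat n n" "Determinant.det M \<noteq> 0" and "specializes n (comb n M f) T"
  shows "specializes n f T"
proof -
  obtain N where N: "N \<in> carrier_mat n n" "Determinant.det N \<noteq> 0"
      "\<forall>i<n. comb n N (comb n M f) i \<in> forms_in V"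
      "ordered_basis n T (\<lambda>i. map_form h (comb n N (comb n M f) i))"
    using assms(3) by (auto simp: specializes_def)
  have "N * M \<in> carrier_mat n n" "Determinant.det (N * M) \<noteq> 0"
    using M N det_mult[OF N(1) M(1)] by auto
  moreover have "comb n N (comb n M f) i = comb n (N * M) f i" if "i < n" for i
    using comb_comb[OF N(1) M(1) that] .
  moreover from this have "ordered_basis n T (\<lambda>i. map_form h (comb n (N * M) f i))"
    using ordered_basis_cong[OF N(4)] by simp
  ultimately show ?thesis
    unfolding specializes_def using N(3) by (intro bexI[of _ "N * M"]) simp_all
qed

lemma specializes_scale:
  assumes c: "\<And>i. i < n \<Longrightarrow> c i \<noteq> 0" and "specializes n (\<lambda>i. form_scale (c i) (f i)) T"
  shows "specializes n f T"
proof -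
  let ?D = "Matrix.mat n n (\<lambda>(i, j). if i = j then c i else 0)"
  have D: "comb n ?D f i = form_scale (c i) (f i)" if "i < n" for i
  proof -
    have "comb n ?D f i = (\<Sum>j<n. if i = j then form_scale (c i) (f i) else 0)"
      unfolding comb_def using that by (intro sum.cong) auto
    then show ?thesis
      using that by simp
  qed
  have ut: "upper_triangular ?D"
    by (auto simp: upper_triangular_def)
  have "0 \<notin> set (diag_mat ?D)"
    using c by (auto simp: diag_mat_def)
  then have "Determinant.det ?D \<noteq> 0"
    using upper_triangular_imp_det_eq_0_iff[OF _ ut, of n] by simp
  then show ?thesis
    using specializes_comb[of ?D n f T] specializes_cong[OF assms(2), of "comb n ?D f"] D by simp
qed

lemma specializes_basis_change:
  assumes f: "ordered_basis n S f" and F: "ordered_basis n S F"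
    and "specializes n (\<lambda>i. sym_act g (map_form \<iota> (F i))) T"
  shows "specializes n (\<lambda>i. sym_act g (map_form \<iota> (f i))) T"
proof -
  obtain M where M: "M \<in> carrier_mat n n" "Determinant.det M \<noteq> 0" "\<And>i. i < n \<Longrightarrow> F i = comb n M f i"
    using ordered_basis_change[of n S f F, OF f ordered_basis_mem[OF F] ordered_basis_indep[OF F]] by blast
  let ?M = "map_mat \<iota> M"
  have "Determinant.det ?M \<noteq> 0"
    using C.det_mem_hom[OF M(1)] M(2) const_nonzero by auto
  moreover have "sym_act g (map_form \<iota> (F i)) = comb n ?M (\<lambda>i. sym_act g (map_form \<iota> (f i))) i" if "i < n" for i
    using C.comb_mem_hom[OF _ _ M(1) that, of f] that by (simp add: M(3) forms_in_def sym_act_comb[symmetric])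
  ultimately show ?thesis
    using M(1) specializes_comb[of ?M n "\<lambda>i. sym_act g (map_form \<iota> (f i))" T]
      specializes_cong[OF assms(3), of "comb n ?M (\<lambda>i. sym_act g (map_form \<iota> (f i)))"] by simp
qed

text \<open>Over \<open>V\<close> the action commutes with reduction, and invertibility of the
  reduced matrix keeps the reduced frame independent.\<close>

lemma specializes_act:
  fixes g :: "'K ^ 2 ^ 2"
  assumes g: "\<And>i j. g $ i $ j \<in> V" "invertible (map_mat2 h g)"
    and f: "\<And>i. i < n \<Longrightarrow> f i \<in> Sym d" and "specializes n f T"
  shows "specializes n (\<lambda>i. sym_act g (f i)) (sym_act (map_mat2 h g) ` T)"
proof -
  obtain M where M: "M \<in> carrier_mat n n" "Determinant.det M \<noteq> 0" "\<forall>i<n. comb n M f i \<in> forms_in V"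
      "ordered_basis n T (\<lambda>i. map_form h (comb n M f i))"
    using assms(4) by (auto simp: specializes_def)
  have "comb n M (\<lambda>i. sym_act g (f i)) i \<in> forms_in V \<and>
      map_form h (comb n M (\<lambda>i. sym_act g (f i)) i) = sym_act (map_mat2 h g) (map_form h (comb n M f i))"
    if "i < n" for i
    using sym_act_mem_hom[OF g(1) comb_mem[OF subspace_Sym f]] M(3) that by (simp add: sym_act_comb)
  then show ?thesis
    unfolding specializes_def
    using M(1,2) ordered_basis_cong[OF ordered_basis_sym_act[OF M(4) g(2)]] by (intro bexI[of _ M]) auto
qed

lemma specializes_pluecker:
  assumes "specializes n f T"
  shows "\<exists>\<mu> b. ordered_basis n T b \<and>
    (\<forall>I. \<mu> * pluecker n d f I \<in> V \<and> h (\<mu> * pluecker n d f I) = pluecker n d b I)"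
proof -
  obtain M where M: "M \<in> carrier_mat n n" "\<forall>i<n. comb n M f i \<in> forms_in V"
      "ordered_basis n T (\<lambda>i. map_form h (comb n M f i))"
    using assms by (auto simp: specializes_def)
  then show ?thesis
    using pluecker_mem_hom[of n "comb n M f" d] pluecker_comb[OF M(1), of d f]
    by (intro exI[of _ "Determinant.det M"] exI[of _ "\<lambda>i. map_form h (comb n M f i)"]) simp
qed

text \<open>The matrix multiplies the coefficient of index \<open>m\<close> by \<open>t ^ m\<close>.
  After division by \<open>t ^ b\<close>, the coefficients of index above \<open>b\<close> keep a
  positive power of \<open>t\<close> and reduce to zero; only the monomial of index \<open>b\<close>
  survives.\<close>

lemma diag_form:
  assumes H: "H \<in> Sym d" "H \<in> forms_in V" and b: "b \<le> d" "\<And>m. m < b \<Longrightarrow> cf d H m = 0"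
    and t: "t \<in> V" "h t = 0" "t \<noteq> 0"
  defines "G \<equiv> form_scale (inverse t ^ b) (sym_act (mat2 1 0 0 t) H)"
  shows "G \<in> Sym d" "G \<in> forms_in V" "map_form h G = form_scale (h (cf d H b)) (monoform d b)"
proof -
  show S: "G \<in> Sym d"
    unfolding G_def by (intro Sym_scale sym_act_Sym H)
  have c: "cf d G m = (if m < b then 0 else t ^ (m - b) * cf d H m)" if "m \<le> d" for m
    using that b(2) t(3) unfolding G_def by (simp add: cf_scale cf_diag[OF H(1)] power_diff field_simps)
  show V: "G \<in> forms_in V"
    by (rule Sym_forms_in[OF S]) (simp add: c zero_mem mult_mem power_mem t cf_mem[OF H(2)])
  have "cf d (map_form h G) m = cf d (form_scale (h (cf d H b)) (monoform d b)) m" if "m \<le> d" for m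
    using that by (auto simp: cf_map_form c cf_scale cf_monoform hom_zero hom_mult power_mem t cf_mem[OF H(2)] hom_power)
  then show "map_form h G = form_scale (h (cf d H b)) (monoform d b)"
    by (intro Sym_eqI[of _ d] map_form_Sym S Sym_scale monoform_Sym b) auto
qed

text \<open>The forms may have coefficients in \<open>V\<close>, with a unit at index
  \<open>b i\<close>: the second of two successive degenerations starts from forms that are no
  longer constant.\<close>

lemma specializes_diag:
  assumes b: "strict_mono_on {..<n} b" and H: "\<And>i. i < n \<Longrightarrow> H i \<in> Sym d" "\<And>i. i < n \<Longrightarrow> H i \<in> forms_in V"
    and low: "\<And>i. i < n \<Longrightarrow> b i \<le> d" "\<And>i m. i < n \<Longrightarrow> m < b i \<Longrightarrow> cf d (H i) m = 0"
      "\<And>i. i < n \<Longrightarrow> h (cf d (H i) (b i)) \<noteq> 0"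
    and t: "t \<in> V" "h t = 0" "t \<noteq> 0"
  shows "specializes n (\<lambda>i. sym_act (mat2 1 0 0 t) (H i)) (mono_span d n b)"
proof (rule specializes_scale[of n "\<lambda>i. inverse t ^ b i"])
  let ?G = "\<lambda>i. form_scale (inverse t ^ b i) (sym_act (mat2 1 0 0 t) (H i))"
  note G = diag_form[OF H low(1,2) t]
  have "ordered_basis n (mono_span d n b) (\<lambda>i. map_form h (?G i))"
    by (rule ordered_basis_cong[OF mono_span_basis[of n b d "\<lambda>i. h (cf d (H i) (b i))"]])
      (use b low G in auto)
  then show "specializes n ?G (mono_span d n b)"
    unfolding specializes_def
    by (intro bexI[of _ "1\<^sub>m n"]) (auto simp: comb_one G intro: ordered_basis_cong)
qed (use t in auto)

end

section \<open>Binomial determinants and generic vanishing sequences\<close>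

text \<open>Over a finite field, one plus the product of all monic linear factors takes the value 1
  everywhere, so it has no root.\<close>

lemma infinite_alg_closed_field: "infinite (UNIV :: 'k::alg_closed_field set)"
proof
  assume fin: "finite (UNIV :: 'k set)"
  define p where "p = (\<Prod>a\<in>(UNIV :: 'k set). [:- a, 1:]) + 1"
  have deg: "degree (\<Prod>a\<in>(UNIV :: 'k set). [:- a, 1:]) = card (UNIV :: 'k set)"
    by (subst degree_prod_eq_sum_degree) auto
  have pos: "card (UNIV :: 'k set) > 0"
    using fin by (simp add: card_gt_0_iff)
  then have "degree p = card (UNIV :: 'k set)"
    unfolding p_def using deg by (subst degree_add_eq_left) auto
  then obtain x where "poly p x = 0"
    using alg_closed_imp_poly_has_root[of p] pos by auto
  moreover have "poly (\<Prod>a\<in>(UNIV :: 'k set). [:- a, 1:]) x = 0"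
    using fin by (simp add: poly_prod prod_zero_iff)
  ultimately show False
    by (simp add: p_def)
qed

lemma prod_diff_binomial: "(\<Prod>l<j. a - l) = fact j * (a choose j)" for a j :: nat
proof (induction j)
  case (Suc j)
  have "(\<Prod>l<Suc j. a - l) = fact j * ((a - j) * (a choose j))"
    using Suc by simp
  also have "(a - j) * (a choose j) = Suc j * (a choose Suc j)"
    using binomial_absorb_comp[of a j] binomial_absorption[of j a] by simp
  finally show ?case
    by (simp add: algebra_simps)
qed simp

lemma prod_diff_of_nat:
  "(\<Prod>l<j. of_nat a - of_nat l) = (of_nat (fact j) * of_nat (a choose j) :: 'k::field)"
proof -
  have "(\<Prod>l<j. of_nat a - of_nat l) = (of_nat (\<Prod>l<j. a - l) :: 'k)"
  proof (cases "a < j")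
    case True
    then have e: "(\<Prod>l<j. of_nat a - of_nat l) = (0 :: 'k)" "(\<Prod>l<j. a - l) = 0"
      by (auto simp: prod_zero_iff intro!: bexI[of _ a])
    show ?thesis by (simp only: e of_nat_0)
  next
    case False
    then show ?thesis
      unfolding of_nat_prod by (intro prod.cong) (auto simp: of_nat_diff)
  qed
  then show ?thesis
    by (simp add: prod_diff_binomial)
qed

text \<open>A relation among the columns is a polynomial of degree below \<open>n\<close>, written
  in the basis of binomial polynomials, that vanishes at the \<open>n\<close> integers
  \<open>a i\<close>. These remain distinct in the field because their differences are at most
  \<open>d\<close>, so the polynomial is zero.\<close>

lemma binomial_det_nonzero:
  assumes char: "\<And>m. 0 < m \<Longrightarrow> m \<le> d \<Longrightarrow> (of_nat m :: 'k::field) \<noteq> 0"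
    and a: "strict_mono_on {..<n} a" "\<And>i. i < n \<Longrightarrow> a i \<le> d"
  shows "Determinant.det (Matrix.mat n n (\<lambda>(i, j). of_nat (a i choose j) :: 'k)) \<noteq> 0" (is "Determinant.det ?M \<noteq> 0")
proof
  assume "Determinant.det ?M = 0"
  then have "Determinant.det (transpose_mat ?M) = 0"
    by (subst det_transpose) auto
  then obtain c i0 where i0: "i0 < n" "c i0 \<noteq> 0"
    and c: "\<forall>i<n. (\<Sum>j<n. c j * transpose_mat ?M $$ (j, i)) = 0"
    using det_eq_0_left_kernel[of "transpose_mat ?M" n] by auto
  \<comment> \<open>\<open>p\<close> is the sum of the \<open>c j\<close> times the binomial
    polynomials of degree \<open>j\<close>. Since \<open>n \<le> d + 1\<close>, only factorials of
    numbers up to \<open>d\<close> occur in the denominators.\<close>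
  define p :: "'k poly" where "p = (\<Sum>j<n. smult (c j / of_nat (fact j)) (\<Prod>l<j. [:- of_nat l, 1:]))"
  have inj: "inj_on a {..<n}"
    using a(1) by (rule strict_mono_on_imp_inj_on)
  have "n = card (a ` {..<n})"
    using inj by (simp add: card_image)
  also have "\<dots> \<le> card {..d}"
    using a(2) by (intro card_mono) auto
  finally have nd: "n \<le> d + 1"
    by simp
  have fact: "(of_nat (fact j) :: 'k) \<noteq> 0" if "j \<le> d" for j
    using that char by (auto simp: fact_prod of_nat_prod prod_zero_iff simp del: of_nat_mult)
  have p: "poly p (of_nat m) = (\<Sum>j<n. c j * of_nat (m choose j))" for m
    using nd fact by (simp add: p_def poly_sum poly_prod prod_diff_of_nat)
  have "degree p \<le> n - 1"
    unfolding p_def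
  proof (rule degree_sum_le)
    fix j assume "j \<in> {..<n}"
    then show "degree (smult (c j / of_nat (fact j)) (\<Prod>l<j. [:- of_nat l, 1 :: 'k:])) \<le> n - 1"
      using degree_prod_eq_sum_degree[of "{..<j}" "\<lambda>l. [:- of_nat l, 1 :: 'k:]"] degree_smult_le[of "c j / of_nat (fact j)" "\<Prod>l<j. [:- of_nat l, 1 :: 'k:]"]
      by auto
  qed simp
  moreover have "p = 0 \<or> n \<le> degree p"
  proof (rule disjCI)
    assume "\<not> n \<le> degree p"
    show "p = 0"
    proof (rule ccontr)
      assume nz: "p \<noteq> 0"
      have "inj_on (of_nat :: nat \<Rightarrow> 'k) {..d}"
      proof (rule linorder_inj_onI)
        fix x y :: nat assume xy: "x < y" "x \<in> {..d}" "y \<in> {..d}"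
        then have "y - x \<le> d" by simp
        with xy show "(of_nat x :: 'k) \<noteq> of_nat y"
          using char[of "y - x"] by (auto simp: of_nat_diff)
      qed auto
      then have "inj_on (\<lambda>i. of_nat (a i) :: 'k) {..<n}"
        using inj a(2) by (auto simp: inj_on_def)
      then have "n = card ((\<lambda>i. of_nat (a i) :: 'k) ` {..<n})"
        by (simp add: card_image)
      also have "\<dots> \<le> card {x. poly p x = 0}"
        using c nz by (intro card_mono poly_roots_finite) (auto simp: p)
      also have "\<dots> \<le> degree p"
        by (rule card_poly_roots_bound[OF nz])
      finally show False
        using \<open>\<not> n \<le> degree p\<close> by simp
    qed
  qed
  ultimately have p0: "p = 0"
    using i0(1) by linarith
  obtain k where k: "k < n" "c k \<noteq> 0" "\<And>j. j < k \<Longrightarrow> c j = 0"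
    using exists_least_iff[of "\<lambda>i. i < n \<and> c i \<noteq> 0"] i0 by (metis order.strict_trans)
  \<comment> \<open>Evaluation at the least index \<open>k\<close> with
    \<open>c k \<noteq> 0\<close> isolates \<open>c k\<close>: earlier coefficients are zero by
    minimality, later binomial coefficients because \<open>j > k\<close>.\<close>
  have "(\<Sum>j<n. c j * of_nat (k choose j)) = (\<Sum>j<n. if j = k then c k else 0)"
    using k(3) by (intro sum.cong) (auto simp: binomial_eq_0 linorder_neq_iff)
  also have "\<dots> = c k"
    using k(1) by simp
  finally show False
    using p[of k] p0 k(2) by simp
qed

lemma ordered_basis_dim_bound:
  assumes "ordered_basis n S f" "S \<subseteq> Sym d"
  shows "n \<le> Suc d"
proof -
  obtain I where "I \<in> pluecker_index n d"
    using pluecker_nonzero[OF assms] by blast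
  then show ?thesis
    using card_mono[of "{..d}" I] by (auto simp: pluecker_index_def)
qed

text \<open>Multiplying by the inverse of the first \<open>n\<close> columns brings the frame to
  reduced echelon form.\<close>

lemma comb_inverse_coeffs:
  assumes C: "Matrix.mat n n (\<lambda>(i, j). cf d (f i) j) = C" and N: "N \<in> carrier_mat n n" "N * C = 1\<^sub>m n"
    and ij: "i < n" "j < n"
  shows "cf d (comb n N f i) j = (if i = j then 1 else 0)"
proof -
  have "cf d (comb n N f i) j = (N * C) $$ (i, j)"
    using N(1) ij unfolding cf_comb C[symmetric] by (auto simp: scalar_prod_def lessThan_atLeast0)
  then show ?thesis
    using N(2) ij by simp
qed

context place
begin

text \<open>
  The determinant is the value at \<open>s\<close> of a polynomial over \<open>k\<close>, which therefore does not vanish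
  at some constant \<open>c\<close>; the vanishing sequence at the point translated to \<open>[e\<^sub>2]\<close> by \<open>c\<close> is then
  \<open>0, \<dots>, r\<close>.
\<close>

lemma generic_limit:
  assumes inf: "infinite (UNIV :: 'k set)"
    and F: "ordered_basis (Suc r) S F" "S \<subseteq> Sym d"
    and det: "Determinant.det (Matrix.mat (Suc r) (Suc r)
      (\<lambda>(i, j). cf d (sym_act (mat2 1 s 0 1) (map_form \<iota> (F i))) j)) \<noteq> 0"
  shows "mono_span d (Suc r) (\<lambda>i. i) \<in> limit_set d r S"
proof -
  let ?n = "Suc r"
  have nd: "r \<le> d"
    using ordered_basis_dim_bound[OF F] by simp
  have FS: "F i \<in> Sym d" if "i < ?n" for i
    using ordered_basis_mem[OF F(1) that] F(2) by blast
  \<comment> \<open>By \<open>cf_unipotent\<close>, evaluating \<open>P i j\<close> at a constant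
    \<open>c\<close> gives the coefficients of the translates over \<open>k\<close>, and evaluating
    it at \<open>s\<close> gives the entries of the matrix in \<open>det\<close>. One polynomial
    \<open>D\<close> therefore serves both fields.\<close>
  define P where "P i j = (\<Sum>m\<le>d. monom (of_nat (m choose j) * cf d (F i) m) (m - j))" for i j
  define D where "D = Determinant.det (Matrix.mat ?n ?n (\<lambda>(i, j). P i j))"
  have eval: "poly D c = Determinant.det (Matrix.mat ?n ?n (\<lambda>(i, j). cf d (sym_act (mat2 1 c 0 1) (F i)) j))" for c
  proof -
    interpret E: subring_hom UNIV "\<lambda>p :: 'k poly. poly p c"
      by unfold_locales auto
    have "poly D c = Determinant.det (map_mat (\<lambda>p. poly p c) (Matrix.mat ?n ?n (\<lambda>(i, j). P i j)))"
      unfolding D_def using E.det_mem_hom[of "Matrix.mat ?n ?n (\<lambda>(i, j). P i j)" ?n] by simp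
    also have "map_mat (\<lambda>p. poly p c) (Matrix.mat ?n ?n (\<lambda>(i, j). P i j)) =
        Matrix.mat ?n ?n (\<lambda>(i, j). cf d (sym_act (mat2 1 c 0 1) (F i)) j)"
      using nd FS by (intro eq_matI) (auto simp: P_def poly_sum poly_monom cf_unipotent mult_ac)
    finally show ?thesis .
  qed
  have "D \<noteq> 0"
  proof
    assume "D = 0"
    interpret E: subring_hom UNIV "\<lambda>p. poly (map_poly \<iota> p) s"
      by (rule subring_hom_poly_eval) (rule const_hom)
    have "poly (map_poly \<iota> D) s = Determinant.det (map_mat (\<lambda>p. poly (map_poly \<iota> p) s) (Matrix.mat ?n ?n (\<lambda>(i, j). P i j)))"
      unfolding D_def using E.det_mem_hom[of "Matrix.mat ?n ?n (\<lambda>(i, j). P i j)" ?n] by simp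
    also have "map_mat (\<lambda>p. poly (map_poly \<iota> p) s) (Matrix.mat ?n ?n (\<lambda>(i, j). P i j)) =
        Matrix.mat ?n ?n (\<lambda>(i, j). cf d (sym_act (mat2 1 s 0 1) (map_form \<iota> (F i))) j)"
    proof (intro eq_matI; simp)
      fix i j assume ij: "i < ?n" "j < ?n"
      have m: "map_poly \<iota> (monom c k) = monom (\<iota> c) k" for c k
        by (rule map_poly_monom) (rule C.hom_zero)
      have "poly (map_poly \<iota> (P i j)) s = (\<Sum>m\<le>d. \<iota> (of_nat (m choose j) * cf d (F i) m) * s ^ (m - j))"
        unfolding P_def using E.hom_sum[of "{..d}"] by (simp add: m poly_monom)
      also have "\<dots> = cf d (sym_act (mat2 1 s 0 1) (map_form \<iota> (F i))) j"
        using ij nd cf_unipotent[OF C.map_form_Sym[OF FS[OF ij(1)]]]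
        by (simp add: C.hom_mult C.of_nat_mem_hom C.cf_map_form mult_ac)
      finally show "poly (map_poly \<iota> (P i j)) s = cf d (sym_act (mat2 1 s 0 1) (map_form \<iota> (F i))) j" .
    qed
    finally show False
      using det \<open>D = 0\<close> by simp
  qed
  then obtain c where c: "poly D c \<noteq> 0"
    using inf poly_roots_finite[of D] by (metis (mono_tags, lifting) UNIV_eq_I finite_subset mem_Collect_eq subsetI)
  let ?u = "mat2 1 c 0 1"
  let ?f = "\<lambda>i. sym_act ?u (F i)"
  let ?C = "Matrix.mat ?n ?n (\<lambda>(i, j). cf d (?f i) j)"
  have inv: "invertible ?u"
    by (simp add: invertible_mat2)
  have ob: "ordered_basis ?n (sym_act ?u ` S) ?f"
    by (rule ordered_basis_sym_act[OF F(1) inv])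
  have sub: "sym_act ?u ` S \<subseteq> Sym d"
    using F(2) sym_act_Sym by blast
  \<comment> \<open>Inverting the leading block gives forms in the translate whose orders at
    \<open>[e\<^sub>2]\<close> are exactly \<open>0, \<dots>, r\<close>.\<close>
  obtain N where N: "N \<in> carrier_mat ?n ?n" "N * ?C = 1\<^sub>m ?n"
    using inverse_mat[of ?C ?n] c eval by auto
  have "mono_span d ?n (\<lambda>i. i) \<in> limit_set d r (sym_act ?u ` S)"
  proof (rule monomial_limit[OF ob sub])
    show "strict_mono_on {..<?n} (\<lambda>i. i)"
      by (simp add: strict_mono_on_def)
    fix i assume i: "i < ?n"
    have "cf d (comb ?n N ?f i) j = (if i = j then 1 else 0)" if "j < ?n" for j
      by (rule comb_inverse_coeffs[OF refl N i that])
    then have "lowest d (comb ?n N ?f i) i"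
      using i nd by (auto simp: lowest_def)
    moreover have "comb ?n N ?f i \<in> sym_act ?u ` S"
      using comb_mem[of _ ?n ?f, OF ordered_basis_subspace[OF ob] ordered_basis_mem[OF ob]] by blast
    ultimately show "comb ?n N ?f i \<in> sym_act ?u ` S \<and> lowest d (comb ?n N ?f i) i"
      by blast
  qed
  then show ?thesis
    unfolding limit_set_eq[OF inv] .
qed

end

section \<open>Limits of the translates of a subspace\<close>

context place
begin

text \<open>All subspaces \<open>S\<close> are treated at once, so that a constant right factor of
  \<open>g\<close> can be removed by passing to a translate of \<open>S\<close>.\<close>

definition has_limits :: "nat \<Rightarrow> nat \<Rightarrow> 'K ^ 2 ^ 2 \<Rightarrow> bool" where
  "has_limits d r g \<longleftrightarrow> (\<forall>S f. S \<subseteq> Sym d \<longrightarrow> ordered_basis (Suc r) S f \<longrightarrow>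
     (\<exists>T\<in>limit_set d r S. specializes (Suc r) (\<lambda>i. sym_act g (map_form \<iota> (f i))) T))"

lemma emb_Sym: "S \<subseteq> Sym d \<Longrightarrow> ordered_basis n S f \<Longrightarrow> i < n \<Longrightarrow> map_form \<iota> (f i) \<in> Sym d"
  using ordered_basis_mem C.map_form_Sym by blast

lemma has_limits_one: "has_limits d r (mat2 1 0 0 1)"
  unfolding has_limits_def
proof (intro allI impI)
  fix S :: "'k poly poly set" and f assume S: "S \<subseteq> Sym d" "ordered_basis (Suc r) S f"
  have "specializes (Suc r) (\<lambda>i. sym_act (mat2 1 0 0 1) (map_form \<iota> (f i))) S"
    unfolding specializes_def mat2_one[symmetric] sym_act_id using S(2)
    by (intro bexI[of _ "1\<^sub>m (Suc r)"]) (auto simp: comb_one emb_forms_in red_emb elim!: ordered_basis_cong)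
  then show "\<exists>T\<in>limit_set d r S. specializes (Suc r) (\<lambda>i. sym_act (mat2 1 0 0 1) (map_form \<iota> (f i))) T"
    using limit_set_self by blast
qed

lemma has_limits_left:
  fixes k :: "'K ^ 2 ^ 2"
  assumes h: "\<And>i j. k $ i $ j \<in> V" "invertible (map_mat2 h k)" and g: "has_limits d r g"
  shows "has_limits d r (k ** g)"
  unfolding has_limits_def
proof (intro allI impI)
  fix S :: "'k poly poly set" and f assume S: "S \<subseteq> Sym d" "ordered_basis (Suc r) S f"
  obtain T where T: "T \<in> limit_set d r S" "specializes (Suc r) (\<lambda>i. sym_act g (map_form \<iota> (f i))) T"
    using g S unfolding has_limits_def by blast
  have "specializes (Suc r) (\<lambda>i. sym_act k (sym_act g (map_form \<iota> (f i)))) (sym_act (map_mat2 h k) ` T)"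
    by (rule specializes_act[OF h _ T(2), of d]) (use S emb_Sym sym_act_Sym in blast)
  then show "\<exists>T\<in>limit_set d r S. specializes (Suc r) (\<lambda>i. sym_act (k ** g) (map_form \<iota> (f i))) T"
    unfolding sym_act_compose using limit_set_act[OF h(2) T(1)] by blast
qed

lemma has_limits_right:
  assumes w: "invertible w" and g: "has_limits d r g"
  shows "has_limits d r (g ** map_mat2 \<iota> w)"
  unfolding has_limits_def
proof (intro allI impI)
  fix S :: "'k poly poly set" and f assume S: "S \<subseteq> Sym d" "ordered_basis (Suc r) S f"
  let ?S = "sym_act w ` S" and ?f = "\<lambda>i. sym_act w (f i)"
  have "?S \<subseteq> Sym d"
    using S(1) sym_act_Sym by blast
  then obtain T where T: "T \<in> limit_set d r ?S" "specializes (Suc r) (\<lambda>i. sym_act g (map_form \<iota> (?f i))) T"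
    using g ordered_basis_sym_act[OF S(2) w] unfolding has_limits_def by blast
  have e: "sym_act g (map_form \<iota> (?f i)) = sym_act (g ** map_mat2 \<iota> w) (map_form \<iota> (f i))" if "i < Suc r" for i
  proof -
    have "f i \<in> Sym d"
      using ordered_basis_mem[OF S(2) that] S(1) by blast
    then have "map_form \<iota> (?f i) = sym_act (map_mat2 \<iota> w) (map_form \<iota> (f i))"
      using C.sym_act_mem_hom[of w "f i" d] by (simp add: forms_in_def)
    then show ?thesis
      by (simp add: sym_act_compose)
  qed
  show "\<exists>T\<in>limit_set d r S. specializes (Suc r) (\<lambda>i. sym_act (g ** map_mat2 \<iota> w) (map_form \<iota> (f i))) T"
    using specializes_cong[OF T(2) e] T(1) unfolding limit_set_eq[OF w] by blast
qed

lemma sym_act_scalar: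
  assumes "F \<in> Sym d"
  shows "sym_act (mat2 (l * a) (l * b) (l * c) (l * e)) F = form_scale (l ^ d) (sym_act (mat2 a b c e) F)"
proof -
  have v: "lin (vector [l * x, l * y]) = form_scale l (lin (vector [x, y]))" for x y
    by (simp add: lin_vector form.scale_right_distrib)
  have "form_scale (l ^ (d - m)) (form_scale (l ^ m) G) = form_scale (l ^ d) G" if "m \<le> d" for m G
    using that by (simp flip: power_add)
  then show ?thesis
    unfolding sym_act_expand[OF assms] form.scale_sum_right mat2_axis v
    by (intro sum.cong) (auto simp: form_scale_power form_scale_mult mult_ac simp flip: power_add)
qed

lemma has_limits_scalar:
  assumes "l \<noteq> 0" and g: "has_limits d r (mat2 a b c e)"
  shows "has_limits d r (mat2 (l * a) (l * b) (l * c) (l * e))"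
  unfolding has_limits_def
proof (intro allI impI)
  fix S :: "'k poly poly set" and f assume S: "S \<subseteq> Sym d" "ordered_basis (Suc r) S f"
  obtain T where T: "T \<in> limit_set d r S" "specializes (Suc r) (\<lambda>i. sym_act (mat2 a b c e) (map_form \<iota> (f i))) T"
    using g S unfolding has_limits_def by blast
  let ?f = "\<lambda>i. sym_act (mat2 (l * a) (l * b) (l * c) (l * e)) (map_form \<iota> (f i))"
  have "specializes (Suc r) (\<lambda>i. form_scale (inverse (l ^ d)) (?f i)) T"
    by (rule specializes_cong[OF T(2)]) (use assms(1) in \<open>simp add: sym_act_scalar[OF emb_Sym[OF S]]\<close>)
  then have "specializes (Suc r) ?f T"
    by (rule specializes_scale[rotated]) (use assms(1) in auto)
  then show "\<exists>T\<in>limit_set d r S. specializes (Suc r) ?f T"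
    using T(1) by blast
qed

text \<open>In a basis adapted to the point \<open>[e\<^sub>2]\<close>, the small diagonal matrix
  drives every form to its lowest monomial.\<close>

lemma has_limits_diag_small:
  assumes s: "s \<in> V" "h s = 0" "s \<noteq> 0"
  shows "has_limits d r (mat2 1 0 0 s)"
  unfolding has_limits_def
proof (intro allI impI)
  fix S :: "'k poly poly set" and f assume S: "S \<subseteq> Sym d" "ordered_basis (Suc r) S f"
  obtain a F where F: "strict_mono_on {..<Suc r} a" "\<And>i. i < Suc r \<Longrightarrow> lowest d (F i) (a i)"
      "\<And>i. i < Suc r \<Longrightarrow> cf d (F i) (a i) = 1" and ob: "ordered_basis (Suc r) S F"
    by (rule adapted_basis[OF S(2,1)]) (rule that; assumption)
  have "specializes (Suc r) (\<lambda>i. sym_act (mat2 1 0 0 s) (map_form \<iota> (F i))) (mono_span d (Suc r) a)"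
    by (rule specializes_diag[OF F(1) emb_Sym[OF S(1) ob] emb_forms_in _ _ _ s])
      (use F(2,3) in \<open>auto simp: C.cf_map_form C.hom_zero lowest_def hom_const\<close>)
  then have "specializes (Suc r) (\<lambda>i. sym_act (mat2 1 0 0 s) (map_form \<iota> (f i))) (mono_span d (Suc r) a)"
    by (rule specializes_basis_change[OF S(2) ob])
  moreover have "mono_span d (Suc r) a \<in> limit_set d r S"
    using monomial_limit[OF S(2,1) F(1), of F] F(2) ordered_basis_mem[OF ob] by blast
  ultimately show "\<exists>T\<in>limit_set d r S. specializes (Suc r) (\<lambda>i. sym_act (mat2 1 0 0 s) (map_form \<iota> (f i))) T"
    by blast
qed

text \<open>
  The one-parameter degeneration of \<open>S\<close> to a monomial subspace is followed by a translation, which moves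
  the latter away from its two special points, and by a second degeneration of smaller order.
\<close>

lemma has_limits_double:
  assumes char: "\<And>m. 0 < m \<Longrightarrow> m \<le> d \<Longrightarrow> (of_nat m :: 'k) \<noteq> 0" and inf: "infinite (UNIV :: 'k set)"
    and s: "s \<in> V" "h s = 0" "s \<noteq> 0" and t: "t \<in> V" "h t = 0" "t \<noteq> 0"
  shows "has_limits d r (mat2 1 s 0 (s * t))"
  unfolding has_limits_def
proof (intro allI impI)
  fix S :: "'k poly poly set" and f assume S: "S \<subseteq> Sym d" "ordered_basis (Suc r) S f"
  let ?n = "Suc r"
  obtain a F where a: "strict_mono_on {..<?n} a" and low: "\<And>i. i < ?n \<Longrightarrow> lowest d (F i) (a i)"
      and one: "\<And>i. i < ?n \<Longrightarrow> cf d (F i) (a i) = 1" and ob: "ordered_basis ?n S F"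
    by (rule adapted_basis[OF S(2,1)]) (rule that; assumption)
  have nd: "r \<le> d"
    using ordered_basis_dim_bound[OF S(2,1)] by simp
  have ad: "a i \<le> d" if "i < ?n" for i
    using low[OF that] by (simp add: lowest_def)
  let ?E = "\<lambda>i. map_form \<iota> (F i)"
  note E = emb_Sym[OF S(1) ob]
  \<comment> \<open>The matrix is diag(1, t) times (1, 1; 0, 1) times diag(1, s). \<open>G\<close>
    is the frame after the factor on the right, divided by powers of \<open>s\<close> so as to be
    integral; \<open>H\<close> is its translate by the middle factor, and \<open>K\<close> a
    normalization of \<open>H\<close> to which diag(1, t) is applied.\<close>
  define G where "G i = form_scale (inverse s ^ a i) (sym_act (mat2 1 0 0 s) (?E i))" for i
  have G: "G i \<in> Sym d" "G i \<in> forms_in V" "map_form h (G i) = monoform d (a i)" if "i < ?n" for i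
    using diag_form[OF E[OF that] emb_forms_in ad[OF that] _ s] low[OF that] one[OF that]
    by (auto simp: G_def lowest_def C.cf_map_form C.hom_zero hom_const C.hom_one hom_one)
  define H where "H i = sym_act (mat2 1 1 0 1) (G i)" for i
  have u: "(mat2 1 1 0 1 :: 'K ^ 2 ^ 2) $ i $ j \<in> V" for i j
    by (simp add: mat2_def one_mem zero_mem)
  have H: "H i \<in> Sym d" "H i \<in> forms_in V"
      "map_form h (H i) = sym_act (mat2 1 1 0 1) (monoform d (a i))" if "i < ?n" for i
    using sym_act_mem_hom[OF u G(1,2)[OF that]] sym_act_Sym[OF G(1)[OF that]] G(3)[OF that]
    by (auto simp: H_def map_mat2_mat2 hom_one hom_zero)
  define C where "C = Matrix.mat ?n ?n (\<lambda>(i, j). cf d (H i) j)"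
  have C: "C \<in> carrier_mat ?n ?n"
    by (simp add: C_def)
  have C_mem: "C $$ (i, j) \<in> V" if "i < ?n" "j < ?n" for i j
    using that by (simp add: C_def cf_mem[OF H(2)])
  \<comment> \<open>\<open>H i\<close> reduces to the unipotent translate of a monomial, whose
    coefficients are binomial coefficients.\<close>
  have "map_mat h C = Matrix.mat ?n ?n (\<lambda>(i, j). of_nat (a i choose j))"
  proof (rule eq_matI; simp add: C_def)
    fix i j assume ij: "i < ?n" "j < ?n"
    have "h (cf d (H i) j) = cf d (sym_act (mat2 1 1 0 1) (monoform d (a i))) j"
      using H(3)[OF ij(1)] cf_map_form[of d "H i" j] by simp
    also have "\<dots> = (\<Sum>m\<le>d. of_nat (m choose j) * (if m = a i then 1 else 0))"
      using ij nd cf_unipotent[OF monoform_Sym[OF ad[OF ij(1)]], of j 1] by (simp add: cf_monoform)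
    also have "\<dots> = (\<Sum>m\<le>d. if m = a i then of_nat (a i choose j) else 0)"
      by (intro sum.cong) auto
    finally show "h (cf d (H i) j) = of_nat (a i choose j)"
      using ad[OF ij(1)] by simp
  qed
  then have hdet: "h (Determinant.det C) \<noteq> 0"
    using det_mem_hom[OF C C_mem] binomial_det_nonzero[OF char a ad] by simp
  have det: "Determinant.det C \<in> V" "Determinant.det C \<noteq> 0"
    using det_mem_hom[OF C C_mem] hdet hom_zero by auto
  obtain N where N: "N \<in> carrier_mat ?n ?n" "N * C = 1\<^sub>m ?n" "Determinant.det N \<noteq> 0"
      "N = inverse (Determinant.det C) \<cdot>\<^sub>m adj_mat C"
    using inverse_mat[OF C det(2)] by blast
  \<comment> \<open>As the determinant of \<open>C\<close> is a unit of \<open>V\<close>, its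
    inverse times the adjugate has entries in \<open>V\<close>; this keeps the normalized frame
    \<open>K\<close> integral.\<close>
  have N_mem: "N $$ (i, j) \<in> V" if "i < ?n" "j < ?n" for i j
  proof -
    have "cofactor C j i \<in> V"
      unfolding cofactor_def
    proof (intro mult_mem power_mem neg_mem one_mem)
      show "Determinant.det (mat_delete C j i) \<in> V"
        using det_mem_hom[of "mat_delete C j i" r] C C_mem by (auto simp: mat_delete_def)
    qed
    then show ?thesis
      using N(4) that C inverse_mem[OF det(1) hdet] by (simp add: adj_mat_def mult_mem)
  qed
  define K where "K = comb ?n N H"
  have K: "K i \<in> Sym d" "K i \<in> forms_in V" if "i < ?n" for i
    unfolding K_def using comb_mem[OF subspace_Sym H(1)] comb_mem_hom[OF N_mem H(2) N(1)] that by auto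
  have cfK: "cf d (K i) j = (if i = j then 1 else 0)" if "i < ?n" "j < ?n" for i j
    unfolding K_def by (rule comb_inverse_coeffs[OF C_def[symmetric] N(1,2) that])
  have "specializes ?n (\<lambda>i. sym_act (mat2 1 0 0 t) (K i)) (mono_span d ?n (\<lambda>i. i))"
    by (rule specializes_diag[OF _ K _ _ _ t]) (use nd in \<open>auto simp: strict_mono_on_def cfK hom_one\<close>)
  then have "specializes ?n (comb ?n N (\<lambda>i. sym_act (mat2 1 0 0 t) (H i))) (mono_span d ?n (\<lambda>i. i))"
    by (simp add: K_def sym_act_comb)
  then have "specializes ?n (\<lambda>i. sym_act (mat2 1 0 0 t) (H i)) (mono_span d ?n (\<lambda>i. i))"
    by (rule specializes_comb[OF N(1,3)])
  moreover have "sym_act (mat2 1 0 0 t) (H i) = form_scale (inverse s ^ a i) (sym_act (mat2 1 s 0 (s * t)) (?E i))" for i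
    by (simp add: H_def G_def sym_act_scale sym_act_compose mat2_mult mult.commute)
  ultimately have "specializes ?n (\<lambda>i. sym_act (mat2 1 s 0 (s * t)) (?E i)) (mono_span d ?n (\<lambda>i. i))"
    using specializes_scale[of ?n "\<lambda>i. inverse s ^ a i"] s(3) by simp
  then have "specializes ?n (\<lambda>i. sym_act (mat2 1 s 0 (s * t)) (map_form \<iota> (f i))) (mono_span d ?n (\<lambda>i. i))"
    by (rule specializes_basis_change[OF S(2) ob])
  moreover have "mono_span d ?n (\<lambda>i. i) \<in> limit_set d r S"
  proof (rule generic_limit[OF inf ob S(1), of s])
    let ?D = "Matrix.mat ?n ?n (\<lambda>(i, j). cf d (sym_act (mat2 1 s 0 1) (?E i)) j)"
    \<comment> \<open>Both (1, 1; 0, 1) diag(1, s) and diag(1, s) (1, s; 0, 1) equal (1, s; 0, s).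
      Hence \<open>C\<close> arises from \<open>?D\<close> by scaling rows and columns with powers
      of \<open>s\<close>, and would be singular if \<open>?D\<close> were.\<close>
    have D: "C $$ (i, j) = inverse s ^ a i * (s ^ j * ?D $$ (i, j))" if "i < ?n" "j < ?n" for i j
    proof -
      have "H i = form_scale (inverse s ^ a i) (sym_act (mat2 1 0 0 s) (sym_act (mat2 1 s 0 1) (?E i)))"
        by (simp add: H_def G_def sym_act_scale sym_act_compose mat2_mult)
      then show ?thesis
        using that nd by (simp add: C_def cf_scale cf_diag[OF sym_act_Sym[OF E[OF that(1)]]])
    qed
    show "Determinant.det ?D \<noteq> 0"
    proof
      assume "Determinant.det ?D = 0"
      then obtain c i where c: "i < ?n" "c i \<noteq> 0" "\<forall>j<?n. (\<Sum>i<?n. c i * ?D $$ (i, j)) = 0"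
        using det_eq_0_left_kernel[of ?D ?n] by auto
      have "(\<Sum>i<?n. c i * s ^ a i * C $$ (i, j)) = 0" if j: "j < ?n" for j
      proof -
        have "c i * s ^ a i * C $$ (i, j) = s ^ j * (c i * ?D $$ (i, j))" if "i < ?n" for i
        proof -
          have "s ^ a i * (inverse s ^ a i * x) = x" for x
            using s(3) by (simp add: power_inverse)
          then show ?thesis
            unfolding D[OF that j] by (simp only: mult.assoc mult.left_commute[of _ "s ^ j"])
        qed
        then have "(\<Sum>i<?n. c i * s ^ a i * C $$ (i, j)) = s ^ j * (\<Sum>i<?n. c i * ?D $$ (i, j))"
          unfolding sum_distrib_left by (intro sum.cong) auto
        then show ?thesis
          using c(3) j by simp
      qed
      moreover have "c i * s ^ a i \<noteq> 0"
        using c(2) s(3) by simp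
      ultimately have "Determinant.det C = 0"
        unfolding det_eq_0_left_kernel[OF C] using c(1) by (intro exI[of _ "\<lambda>i. c i * s ^ a i"]) auto
      then show False
        using det(2) by simp
    qed
  qed
  ultimately show "\<exists>T\<in>limit_set d r S. specializes ?n (\<lambda>i. sym_act (mat2 1 s 0 (s * t)) (map_form \<iota> (f i))) T"
    by blast
qed

end

section \<open>Elimination for an arbitrary invertible matrix\<close>

context place
begin

lemma outside_inverse:
  assumes "x \<notin> V"
  shows "inverse x \<in> V" "h (inverse x) = 0" "x \<noteq> 0"
  using valuation[OF assms] inverse_mem[of "inverse x"] assms zero_mem by auto

lemma mat2_mem: "\<lbrakk>a \<in> V; b \<in> V; c \<in> V; e \<in> V\<rbrakk> \<Longrightarrow> (mat2 a b c e) $ i $ j \<in> V"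
  by (simp add: mat2_def)

lemma has_limits_mult_left:
  assumes "a \<in> V" "b \<in> V" "c \<in> V" "e \<in> V" "h a * h e - h b * h c \<noteq> 0" "has_limits d r g"
  shows "has_limits d r (mat2 a b c e ** g)"
  using assms mat2_mem by (intro has_limits_left) (auto simp: map_mat2_mat2 invertible_mat2)

lemma has_limits_swap: 
  assumes "has_limits d r (mat2 a b c e)"
  shows "has_limits d r (mat2 c e a b)" "has_limits d r (mat2 b a e c)"
proof -
  show "has_limits d r (mat2 c e a b)"
    using has_limits_mult_left[of 0 1 1 0, OF _ _ _ _ _ assms]
    by (simp add: zero_mem one_mem hom_one hom_zero mat2_mult)
  show "has_limits d r (mat2 b a e c)"
    using has_limits_right[OF _ assms, of "mat2 0 1 1 0"]
    by (simp add: map_mat2_mat2 C.hom_one C.hom_zero invertible_mat2 mat2_mult)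
qed

text \<open>For \<open>t\<close> outside \<open>V\<close>, dividing by \<open>t\<close> and
  exchanging both rows and columns leads back to the small entry \<open>inverse t\<close>.\<close>

lemma has_limits_diag:
  assumes "t \<noteq> 0"
  shows "has_limits d r (mat2 1 0 0 t)"
proof (cases "t \<in> V")
  case True
  show ?thesis
  proof (cases "h t = 0")
    case True
    then show ?thesis
      using has_limits_diag_small[OF \<open>t \<in> V\<close>] assms by simp
  next
    case False
    then show ?thesis
      using has_limits_mult_left[of 1 0 0 t, OF _ _ _ _ _ has_limits_one[of d r]] \<open>t \<in> V\<close>
      by (simp add: zero_mem one_mem hom_one hom_zero mat2_mult)
  qed
next
  case False
  then have "has_limits d r (mat2 1 0 0 (inverse t))"
    using outside_inverse[OF False] by (intro has_limits_diag_small) auto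
  then have "has_limits d r (mat2 (inverse t) 0 0 1)"
    using has_limits_swap by blast
  then show ?thesis
    using has_limits_scalar[OF assms, of d r "inverse t" 0 0 1] assms by simp
qed

text \<open>Gaussian elimination with row operations over \<open>V\<close> and column operations
  over \<open>k\<close>. Of two mutually inverse quotients of entries at least one lies in
  \<open>V\<close>, and this decides which operation is available.\<close>

lemma has_limits_invertible:
  assumes char: "\<And>m. 0 < m \<Longrightarrow> m \<le> d \<Longrightarrow> (of_nat m :: 'k) \<noteq> 0" and inf: "infinite (UNIV :: 'k set)"
    and "invertible g"
  shows "has_limits d r g"
proof -
  have quot: "has_limits d r (mat2 1 q 0 t)" if "t \<noteq> 0" "q / t \<in> V" for q t
    using has_limits_mult_left[of 1 "q / t" 0 1, OF _ _ _ _ _ has_limits_diag[OF that(1)]] that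
    by (simp add: zero_mem one_mem hom_one hom_zero mat2_mult)
  have small: "has_limits d r (mat2 1 q 0 t)" if q: "q \<in> V" "h q = 0" and t: "t \<noteq> 0" for q t
  proof (cases "q / t \<in> V")
    case True
    then show ?thesis using quot t by blast
  next
    case False
    then have "t / q \<in> V" "h (t / q) = 0" "q \<noteq> 0"
      using outside_inverse[OF False] by auto
    \<comment> \<open>The parameters are \<open>s = q\<close> and \<open>t / q\<close>, both in the
      maximal ideal; their product is the lower right entry.\<close>
    then have "has_limits d r (mat2 1 q 0 (q * (t / q)))"
      using t q by (intro has_limits_double[OF char inf]) auto
    then show ?thesis
      using \<open>q \<noteq> 0\<close> by simp
  qed
  have upper: "has_limits d r (mat2 1 q 0 t)" if t: "t \<noteq> 0" for q t
  proof (cases "q / t \<in> V")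
    case True
    then show ?thesis using quot t by blast
  next
    case qt: False
    then have tq: "t / q \<in> V" "h (t / q) = 0" "q \<noteq> 0"
      using outside_inverse[OF qt] by auto
    show ?thesis
    proof (cases "q \<in> V")
      case True
      \<comment> \<open>Subtracting the residue of \<open>q\<close> is a column operation with a
        constant coefficient, and the remainder lies in the maximal ideal.\<close>
      let ?q = "q - \<iota> (h q)"
      have "has_limits d r (mat2 1 ?q 0 t)"
        using True t by (intro small) (simp_all add: diff_mem hom_diff const_mem hom_const)
      then show ?thesis
        using has_limits_right[of "mat2 1 (h q) 0 1" d r "mat2 1 ?q 0 t"]
        by (simp add: map_mat2_mat2 C.hom_one C.hom_zero invertible_mat2 mat2_mult)
    next
      case False
      note q = outside_inverse[OF False]
      \<comment> \<open>Dividing the matrix by \<open>q\<close> and exchanging columns gives (1,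
        1/q; t/q, 0). Clearing \<open>t / q\<close> by a row operation over \<open>V\<close> leaves
        the double degeneration with parameters \<open>1/q\<close> and \<open>-t/q\<close>, both
        small.\<close>
      have "has_limits d r (mat2 1 (inverse q) 0 (inverse q * (- (t / q))))"
        using q tq t by (intro has_limits_double[OF char inf]) (simp_all add: neg_mem hom_neg)
      then have "has_limits d r (mat2 (inverse q) 1 (inverse q * (- (t / q))) 0)"
        by (rule has_limits_swap)
      from has_limits_mult_left[of 1 0 "t / q" 1, OF _ _ _ _ _ this]
      have "has_limits d r (mat2 (inverse q) 1 0 (t / q))"
        using tq by (simp add: zero_mem one_mem hom_one hom_zero mat2_mult mult.commute)
      then show ?thesis
        using has_limits_scalar[OF q(3), of d r "inverse q" 1 0 "t / q"] q(3) by simp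
    qed
  qed
  have pivot: "has_limits d r (mat2 a b c e)" if det: "a * e - b * c \<noteq> 0" and a: "a \<noteq> 0" "c / a \<in> V" for a b c e
  proof -
    have "e - c / a * b \<noteq> 0"
      using det a(1) by (auto simp: field_simps)
    then have "has_limits d r (mat2 1 (b / a) 0 ((e - c / a * b) / a))"
      using a(1) by (intro upper) simp
    then have "has_limits d r (mat2 a b 0 (e - c / a * b))"
      using has_limits_scalar[OF a(1), of d r 1 "b / a" 0 "(e - c / a * b) / a"] a(1) by simp
    from has_limits_mult_left[of 1 0 "c / a" 1, OF _ _ _ _ _ this]
    show ?thesis
      using a by (simp add: zero_mem one_mem hom_one hom_zero mat2_mult)
  qed
  obtain a b c e where g: "g = mat2 a b c e"
    using mat2_eq by blast
  then have det: "a * e - b * c \<noteq> 0"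
    using assms(3) by (simp add: invertible_mat2)
  show ?thesis
  proof (cases "a \<noteq> 0 \<and> c / a \<in> V")
    case True
    then show ?thesis using pivot det g by blast
  next
    case False
    \<comment> \<open>If the first row cannot be the pivot row, the second can: either
      \<open>a = 0\<close> and the determinant forces \<open>c \<noteq> 0\<close>, or
      \<open>c / a\<close> lies outside \<open>V\<close>, so that its inverse lies inside.\<close>
    have "c \<noteq> 0 \<and> a / c \<in> V"
      using False det outside_inverse[of "c / a"] zero_mem by (cases "a = 0") auto
    moreover have "c * b - e * a \<noteq> 0"
      using det by (simp add: algebra_simps)
    ultimately have "has_limits d r (mat2 c e a b)"
      using pivot by blast
    then show ?thesis
      unfolding g by (rule has_limits_swap)
  qed
qed

end

section \<open>The generic matrix\<close>

text \<open>\<open>e\<close> substitutes the entries of \<open>g0\<close> for the four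
  indeterminates. Substitution makes sense only on polynomials, hence the subring \<open>A\<close>
  of the fraction field. The determinant of \<open>g\<close> is nonzero because it takes the value 1
  at the identity matrix.\<close>

lemma generic_matrix:
  obtains \<iota> :: "'k::field \<Rightarrow> 'k poly poly poly poly fract" and g
  where "subring_hom UNIV \<iota>" "invertible g"
    "\<And>g0. \<exists>A e. field_subring_hom A e \<and> (\<forall>c. \<iota> c \<in> A \<and> e (\<iota> c) = c) \<and>
       (\<forall>i j. g $ i $ j \<in> A) \<and> map_mat2 e g = g0"
proof -
  define \<iota> where "\<iota> c = to_fract [:[:[:[:c:]:]:]:]" for c :: 'k
  define g where "g = mat2 (to_fract [:0, 1:]) (to_fract [:[:0, 1:]:]) (to_fract [:[:[:0, 1:]:]:]) (to_fract [:[:[:[:0, 1 :: 'k:]:]:]:])"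
  define A where "A = range (to_fract :: 'k poly poly poly poly \<Rightarrow> _)"
  have mem: "to_fract p \<in> A" for p
    by (simp add: A_def)
  have \<iota>: "subring_hom UNIV \<iota>"
    by unfold_locales (simp_all add: \<iota>_def one_pCons flip: to_fract_add to_fract_mult to_fract_1)
  have sp: "\<exists>e. field_subring_hom A e \<and> (\<forall>c. e (\<iota> c) = c) \<and> map_mat2 e g = g0" for g0
  proof -
    obtain a b c z where g0: "g0 = mat2 a b c (z :: 'k)"
      using mat2_eq by blast
    define ev where "ev F = poly (poly (poly (poly F [:[:[:a:]:]:]) [:[:b:]:]) [:c:]) z" for F
    \<comment> \<open>Polynomials embed injectively into the fractions, so on \<open>A\<close> this
      is evaluation of the unique polynomial representing \<open>y\<close>.\<close>
    define e where "e y = ev (THE p. to_fract p = y)" for y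
    have e: "e (to_fract p) = ev p" for p
      by (simp add: e_def to_fract_eq_iff)
    have "field_subring_hom A e"
    proof (unfold field_subring_hom_def, unfold_locales)
      show "1 \<in> A" "e 1 = 1"
        using e[of 1] mem[of 1] by (simp_all add: ev_def)
    next
      fix x y assume "x \<in> A" "y \<in> A"
      then obtain p q where pq: "x = to_fract p" "y = to_fract q"
        by (auto simp: A_def)
      show "x + y \<in> A" "e (x + y) = e x + e y"
        using mem[of "p + q"] e[of "p + q"] by (simp_all add: pq e) (simp_all add: ev_def)
      show "x * y \<in> A" "e (x * y) = e x * e y"
        using mem[of "p * q"] e[of "p * q"] by (simp_all add: pq e) (simp_all add: ev_def)
    next
      fix x assume "x \<in> A"
      then obtain p where "x = to_fract p"
        by (auto simp: A_def)
      then show "- x \<in> A"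
        using mem[of "- p"] by simp
    qed
    moreover have "map_mat2 e g = g0"
      by (simp add: g_def map_mat2_mat2 e ev_def g0)
    moreover have "e (\<iota> c) = c" for c
      by (simp add: \<iota>_def e ev_def)
    ultimately show ?thesis
      by blast
  qed
  have ent: "g $ i $ j \<in> A" for i j
    by (simp add: g_def mat2_def mem)
  obtain e where e: "field_subring_hom A e" "map_mat2 e g = mat2 1 0 0 (1 :: 'k)"
    using sp by blast
  interpret field_subring_hom A e by fact
  obtain p q u v where g: "g = mat2 p q u v"
    using mat2_eq by blast
  have mems: "p \<in> A" "q \<in> A" "u \<in> A" "v \<in> A"
    using ent[of 1 1] ent[of 1 2] ent[of 2 1] ent[of 2 2] by (simp_all add: g)
  have vals: "e p = 1" "e q = 0" "e u = 0" "e v = 1"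
    using e(2) by (auto simp: g map_mat2_mat2 Finite_Cartesian_Product.vec_eq_iff forall_2)
  have "e (p * v - q * u) = 1"
    by (simp add: hom_diff hom_mult mult_mem mems vals)
  then have "invertible g"
    unfolding g invertible_mat2 using hom_zero by auto
  moreover have "\<iota> c \<in> A" for c
    by (simp add: \<iota>_def mem)
  ultimately show ?thesis
    using that[of \<iota> g] \<iota> sp ent by metis
qed

section \<open>The closure of an orbit\<close>

lemma mpoly_eval_hom_one:
  assumes "\<iota> 0 = 0"
  shows "mpoly_eval_hom \<iota> 1 x = \<iota> 1"
  using mpoly_eval_hom_single[of \<iota> 0 1 x] assms by (simp add: power_prod_def)

lemma homogeneous_basis_independent:
  assumes P: "homogeneous_in X P" and f: "ordered_basis n T f" and f': "ordered_basis n T f'"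
    and nz: "mpoly_eval P (pluecker n d f) \<noteq> 0"
  shows "mpoly_eval P (pluecker n d f') \<noteq> 0"
proof -
  obtain e where e: "homogeneous_degree X e P"
    using P by (auto simp: homogeneous_in_iff)
  obtain M where M: "M \<in> carrier_mat n n" "\<And>i. i < n \<Longrightarrow> f i = comb n M f' i"
    using ordered_basis_coords[of n T f' f, OF f' ordered_basis_mem[OF f]] by blast
  have "pluecker n d f = (\<lambda>I. Determinant.det M * pluecker n d f' I)"
    using pluecker_cong[of n f "comb n M f'" d] M(2) pluecker_comb[OF M(1), of d f'] by auto
  then have "mpoly_eval P (pluecker n d f) = Determinant.det M ^ e * mpoly_eval P (pluecker n d f')"
    using mpoly_eval_hom_scale[OF e, of "\<lambda>c. c" "Determinant.det M" "pluecker n d f'"]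
    by (simp add: mpoly_eval_hom_id)
  then show ?thesis
    using nz by auto
qed

lemma openin_zariski: "openin (zariski_Gr n d) U \<longleftrightarrow>
    generate_topology_on {principal_open n d P | P. homogeneous_in (pluecker_index n d) P} U"
  by (simp add: zariski_Gr_def openin_topology_generated_by_iff)

lemma openin_principal_open:
  "homogeneous_in (pluecker_index n d) P \<Longrightarrow> openin (zariski_Gr n d) (principal_open n d P)"
  unfolding openin_zariski by (rule generate_topology_on.Basis) blast

lemma topspace_zariski:
  assumes "n > 0"
  shows "topspace (zariski_Gr n d) = (Grassmannian n (Sym d) :: 'k::field poly poly set set)"
proof
  show "topspace (zariski_Gr n d) \<subseteq> (Grassmannian n (Sym d) :: 'k poly poly set set)"
    by (auto simp: zariski_Gr_def topology_generated_by_topspace principal_open_def)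
  show "(Grassmannian n (Sym d) :: 'k poly poly set set) \<subseteq> topspace (zariski_Gr n d)"
  proof
    fix T :: "'k poly poly set" assume T: "T \<in> Grassmannian n (Sym d)"
    let ?P = "Poly_Mapping.single 0 1 :: (nat set \<Rightarrow>\<^sub>0 nat) \<Rightarrow>\<^sub>0 'k"
    have "mpoly_eval ?P x = 1" for x
      unfolding mpoly_eval_hom_id[symmetric] by (simp add: mpoly_eval_hom_one)
    then have "T \<in> principal_open n d ?P"
      using T Grassmannian_ordered_basis[OF T assms] unfolding principal_open_def by force
    moreover have "homogeneous_in (pluecker_index n d) ?P"
      using homogeneous_degree_const homogeneous_in_iff by blast
    ultimately show "T \<in> topspace (zariski_Gr n d)"
      using openin_principal_open openin_subset by blast
  qed
qed

text \<open>Powers of one coordinate bring polynomials to a common degree; the first power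
  represents a ratio of coordinates.\<close>

lemma coordinate_power:
  assumes "subring_hom UNIV \<iota>" "I \<in> X"
  shows "homogeneous_degree X D (Poly_Mapping.single (Poly_Mapping.single I D) 1)"
    "mpoly_eval_hom \<iota> (Poly_Mapping.single (Poly_Mapping.single I D) 1) x = x I ^ D"
proof -
  interpret subring_hom UNIV \<iota> by fact
  show "homogeneous_degree X D (Poly_Mapping.single (Poly_Mapping.single I D) 1)"
    using assms(2) by (cases "D = 0") (auto simp: homogeneous_degree_def)
  show "mpoly_eval_hom \<iota> (Poly_Mapping.single (Poly_Mapping.single I D) 1) x = x I ^ D"
    by (cases "D = 0") (simp_all add: mpoly_eval_hom_single mpoly_eval_hom_one hom_zero hom_one power_prod_def)
qed

lemma subring_hom_id: "subring_hom UNIV (\<lambda>c. c)"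
  by unfold_locales auto

section \<open>Normal forms for the subspaces in the limit set\<close>

lemma basis2_matrix:
  fixes w1 w2 :: "'k::field ^ 2"
  assumes "is_basis2 w1 w2"
  obtains w :: "'k ^ 2 ^ 2" where "invertible w" "w *v axis 1 1 = w1" "w *v axis 2 1 = w2"
proof -
  let ?w = "mat2 (w1 $ 1) (w2 $ 1) (w1 $ 2) (w2 $ 2)"
  have e: "?w *v axis 1 1 = w1" "?w *v axis 2 1 = w2"
    by (simp_all add: mat2_axis Finite_Cartesian_Product.vec_eq_iff forall_2)
  have sub: "vec.subspace (range (\<lambda>x. ?w *v x))"
    unfolding vec.subspace_def
  proof (intro conjI ballI allI)
    show "0 \<in> range (\<lambda>x. ?w *v x)"
      by (rule range_eqI[of _ _ 0]) simp
    show "x + y \<in> range (\<lambda>x. ?w *v x)" if "x \<in> range (\<lambda>x. ?w *v x)" "y \<in> range (\<lambda>x. ?w *v x)" for x y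
      using that by (auto simp flip: matrix_vector_right_distrib)
    show "c *s x \<in> range (\<lambda>x. ?w *v x)" if "x \<in> range (\<lambda>x. ?w *v x)" for c x
      using that by (auto simp flip: vector_scalar_commute)
  qed
  have "{w1, w2} \<subseteq> range (\<lambda>x. ?w *v x)"
    using e by (metis insert_subset empty_subsetI rangeI)
  then have "surj (\<lambda>x. ?w *v x)"
    using vec.span_minimal[OF _ sub] assms unfolding is_basis2_def by blast
  then have "invertible ?w"
    unfolding matrix_right_invertible_surjective[symmetric] invertible_right_inverse[symmetric] .
  then show ?thesis
    using e by (rule that)
qed

lemma exists_move_to_e2:
  fixes v :: "'k::field ^ 2"
  assumes "v \<noteq> 0"
  obtains w :: "'k ^ 2 ^ 2" where "invertible w" "w *v v = axis 2 1"
proof (cases "v $ 1 = 0")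
  case True
  then have "v $ 2 \<noteq> 0"
    using assms by (auto simp: Finite_Cartesian_Product.vec_eq_iff forall_2)
  then show ?thesis
    using True by (intro that[of "mat2 1 0 0 (1 / v $ 2)"])
      (auto simp: invertible_mat2 Finite_Cartesian_Product.vec_eq_iff forall_2 matrix_vector_mult_def sum_2 axis_def)
next
  case False
  then show ?thesis
    by (intro that[of "mat2 (- (v $ 2)) (v $ 1) (1 / v $ 1) 0"])
      (auto simp: invertible_mat2 Finite_Cartesian_Product.vec_eq_iff forall_2 matrix_vector_mult_def sum_2 axis_def)
qed

text \<open>Once \<open>v\<close> is moved to \<open>e\<^sub>2\<close>, orders of vanishing are
  lowest indices. Forms realizing the sequence are then independent, and there are as many of them
  as the dimension of \<open>S\<close>.\<close>

lemma vanishing_sequence_basis: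
  fixes v :: "'k::field ^ 2"
  assumes S: "ordered_basis (Suc r) S f" "S \<subseteq> Sym d" and v: "v \<noteq> 0" "vanishing_sequence r S v a"
  obtains w :: "'k ^ 2 ^ 2" and F where "invertible w" "ordered_basis (Suc r) (sym_act w ` S) F" "strict_mono_on {..<Suc r} a"
    "\<And>i. i < Suc r \<Longrightarrow> lowest d (F i) (a i)" "sym_act w ` S \<subseteq> Sym d"
proof -
  obtain w :: "'k ^ 2 ^ 2" where w: "invertible w" "w *v v = axis 2 1"
    by (rule exists_move_to_e2[OF v(1)])
  let ?S = "sym_act w ` S"
  have sub: "?S \<subseteq> Sym d"
    using S(2) sym_act_Sym by blast
  have vs: "vanishing_sequence r ?S (axis 2 1) a"
    using vanishing_sequence_act[OF w(1) v(2)] w(2) by simp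
  then have a: "strict_mono_on {..<Suc r} a"
    by (simp add: vanishing_sequence_def lessThan_Suc_atMost)
  have "\<exists>F\<in>?S. lowest d F (a i)" if "i < Suc r" for i
    using vs that sub vanishes_to_order_e2 unfolding vanishing_sequence_def by (metis less_Suc_eq_le subsetD)
  then obtain F where F: "\<And>i. i < Suc r \<Longrightarrow> F i \<in> ?S" "\<And>i. i < Suc r \<Longrightarrow> lowest d (F i) (a i)"
    by metis
  have "ordered_basis (Suc r) ?S F"
    by (rule ordered_basis_indepI[OF ordered_basis_sym_act[OF S(1) w(1)] F(1) lowest_indep[OF a F(2)]])
  then show ?thesis
    using that w(1) a F(2) sub by blast
qed

lemma monomial_subspace_image:
  assumes w: "w *v axis 1 1 = w1" "w *v axis 2 1 = w2" "invertible w"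
    and a: "strict_mono_on {..<Suc r} a" "\<And>i. i < Suc r \<Longrightarrow> a i \<le> d"
  shows "monomial_subspace d r a w1 w2 = sym_act w ` mono_span d (Suc r) a"
proof -
  have "ordered_basis (Suc r) (sym_act w ` mono_span d (Suc r) a) (\<lambda>i. sym_act w (form_scale 1 (monoform d (a i))))"
    by (rule ordered_basis_sym_act[OF mono_span_basis[OF a] w(3)]) auto
  then show ?thesis
    unfolding ordered_basis_def monomial_subspace_def
    by (simp add: monoform_def sym_act_mult sym_act_power sym_act_lin w lessThan_Suc_atMost)
qed

lemma limit_set_cases:
  fixes S :: "'k::field poly poly set"
  assumes S: "ordered_basis (Suc r) S f" "S \<subseteq> Sym d" and T: "T \<in> limit_set d r S"
  obtains (orbit) g where "invertible g" "T = sym_act g ` S"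
  | (degenerate) g and w :: "'k ^ 2 ^ 2" and a F where "invertible g" "invertible w" "ordered_basis (Suc r) (sym_act w ` S) F"
      "strict_mono_on {..<Suc r} a" "\<And>i. i < Suc r \<Longrightarrow> lowest d (F i) (a i)" "sym_act w ` S \<subseteq> Sym d"
      "T = sym_act g ` mono_span d (Suc r) a"
  using T
proof (cases rule: limit_setE)
  case 1
  then show ?thesis
    using orbit GL2_orbitE by blast
next
  case (2 a v w1 w2)
  obtain w :: "'k ^ 2 ^ 2" and F where w: "invertible w" "ordered_basis (Suc r) (sym_act w ` S) F" "strict_mono_on {..<Suc r} a"
    "\<And>i. i < Suc r \<Longrightarrow> lowest d (F i) (a i)" "sym_act w ` S \<subseteq> Sym d"
    by (rule vanishing_sequence_basis[OF S 2(1,2)]) (rule that; assumption)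
  obtain k :: "'k ^ 2 ^ 2" where k: "invertible k" "k *v axis 1 1 = w1" "k *v axis 2 1 = w2"
    by (rule basis2_matrix[OF 2(3)])
  obtain g where g: "invertible g" "T = sym_act g ` monomial_subspace d r a w1 w2"
    using 2(4) by (rule GL2_orbitE)
  have "T = sym_act (g ** k) ` mono_span d (Suc r) a"
    using g(2) monomial_subspace_image[OF k(2,3,1) w(3)] w(4) by (simp add: lowest_def sym_act_image_compose)
  then show ?thesis
    using degenerate[OF invertible_mult[OF g(1) k(1)] w] by blast
qed

lemma limit_set_Grassmannian:
  assumes S: "ordered_basis (Suc r) S f" "S \<subseteq> Sym d" and T: "T \<in> limit_set d r S"
  shows "T \<in> Grassmannian (Suc r) (Sym d)"
  using assms
proof (cases rule: limit_set_cases)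
  case (orbit g)
  then show ?thesis
    using ordered_basis_Grassmannian[OF ordered_basis_sym_act[OF S(1) orbit(1)], of "Sym d"] S(2) sym_act_Sym by blast
next
  case (degenerate g w a F)
  have ad: "a i \<le> d" if "i < Suc r" for i
    using degenerate(5)[OF that] by (simp add: lowest_def)
  have ob: "ordered_basis (Suc r) (mono_span d (Suc r) a) (\<lambda>i. form_scale 1 (monoform d (a i)))"
    by (rule mono_span_basis[OF degenerate(4) ad]) auto
  have "mono_span d (Suc r) a \<subseteq> Sym d"
    unfolding mono_span_def using ad monoform_Sym by (intro form.span_minimal subspace_Sym) auto
  then have "T \<subseteq> Sym d"
    using degenerate(7) sym_act_Sym by blast
  then show ?thesis
    using ordered_basis_Grassmannian[OF ordered_basis_sym_act[OF ob degenerate(1)]] degenerate(7) by simp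
qed

text \<open>
  The curve of translates is extended to \<open>c = 0\<close> by rescaling its frame; the values of a homogeneous
  polynomial in the Pluecker coordinates along it form a polynomial in \<open>c\<close>.
\<close>

lemma degeneration_curve:
  fixes k :: "'k::alg_closed_field ^ 2 ^ 2"
  assumes k: "invertible k" and F: "ordered_basis (Suc r) S F" "S \<subseteq> Sym d"
    and a: "strict_mono_on {..<Suc r} a" "\<And>i. i < Suc r \<Longrightarrow> lowest d (F i) (a i)"
    and U: "openin (zariski_Gr (Suc r) d) U" "sym_act k ` mono_span d (Suc r) a \<in> U"
  shows "finite {c. c \<noteq> 0 \<and> sym_act (k ** mat2 1 0 0 c) ` S \<notin> U}"
proof -
  let ?n = "Suc r"
  let ?T = "sym_act k ` mono_span d ?n a"
  have FS: "F i \<in> Sym d" if "i < ?n" for i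
    using ordered_basis_mem[OF F(1) that] F(2) by blast
  have ad: "a i \<le> d" and nz: "cf d (F i) (a i) \<noteq> 0" and z: "m < a i \<Longrightarrow> cf d (F i) m = 0" if "i < ?n" for i m
    using a(2)[OF that] by (auto simp: lowest_def)
  \<comment> \<open>For \<open>c \<noteq> 0\<close> this is diag(1, c) applied to \<open>F i\<close>
    and divided by \<open>c ^ a i\<close>, written without negative powers so that it extends to
    \<open>c = 0\<close>. Where \<open>m - a i\<close> is truncated, the coefficient of
    \<open>F i\<close> vanishes.\<close>
  define G where "G c i = (\<Sum>m\<le>d. form_scale (c ^ (m - a i) * cf d (F i) m) (monoform d m))" for c i
  have G_Sym: "G c i \<in> Sym d" for c i
    unfolding G_def by (rule Sym_sum) (simp add: Sym_scale monoform_Sym)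
  have cfG: "cf d (G c i) m = c ^ (m - a i) * cf d (F i) m" if "m \<le> d" for c i m
    using that by (simp add: G_def cf_sum_monoform)
  have G_scale: "G c i = form_scale (inverse c ^ a i) (sym_act (mat2 1 0 0 c) (F i))" if "c \<noteq> 0" "i < ?n" for c i
  proof (rule Sym_eqI[OF G_Sym])
    show "form_scale (inverse c ^ a i) (sym_act (mat2 1 0 0 c) (F i)) \<in> Sym d"
      using FS that by (intro Sym_scale sym_act_Sym) auto
    fix m assume m: "m \<le> d"
    show "cf d (G c i) m = cf d (form_scale (inverse c ^ a i) (sym_act (mat2 1 0 0 c) (F i))) m"
    proof (cases "m < a i")
      case True
      then show ?thesis
        using z[OF that(2) True] m by (simp add: cfG cf_scale cf_diag[OF FS[OF that(2)]])
    next
      case False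
      then show ?thesis
        using m that(1) by (simp add: cfG cf_scale cf_diag[OF FS[OF that(2)]] power_diff field_simps)
    qed
  qed
  \<comment> \<open>At \<open>c = 0\<close> the convention \<open>0 ^ 0 = 1\<close> leaves precisely
    the lowest term.\<close>
  have G0: "G 0 i = form_scale (cf d (F i) (a i)) (monoform d (a i))" if "i < ?n" for i
    by (rule Sym_eqI[OF G_Sym]) (use that ad z in \<open>auto simp: cfG cf_scale cf_monoform Sym_scale monoform_Sym power_0_left\<close>)
  define f where "f c i = sym_act k (G c i)" for c i
  have f0: "ordered_basis ?n ?T (f 0)"
  proof (rule ordered_basis_cong)
    show "ordered_basis ?n ?T (\<lambda>i. sym_act k (form_scale (cf d (F i) (a i)) (monoform d (a i))))"
      by (rule ordered_basis_sym_act[OF mono_span_basis[OF a(1) ad nz] k])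
  qed (simp add: f_def G0)
  have fc: "ordered_basis ?n (sym_act (k ** mat2 1 0 0 c) ` S) (f c)" if c: "c \<noteq> 0" for c
  proof -
    have inv: "invertible (k ** mat2 1 0 0 c)"
      using c by (intro invertible_mult k) (simp add: invertible_mat2)
    have ob: "ordered_basis ?n (sym_act (k ** mat2 1 0 0 c) ` S) (\<lambda>i. sym_act (k ** mat2 1 0 0 c) (F i))"
      by (rule ordered_basis_sym_act[OF F(1) inv])
    have fe: "f c i = form_scale (inverse c ^ a i) (sym_act (k ** mat2 1 0 0 c) (F i))" if "i < ?n" for i
      using G_scale[OF c that] by (simp add: f_def sym_act_scale sym_act_compose)
    show ?thesis
    proof (rule ordered_basis_indepI[OF ob])
      show "f c i \<in> sym_act (k ** mat2 1 0 0 c) ` S" if "i < ?n" for i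
        unfolding fe[OF that] using ordered_basis_mem[OF ob that]
        by (rule form.subspace_scale[OF ordered_basis_subspace[OF ob]])
      have "lowest d (G c i) (a i)" if "i < ?n" for i
        using a(2)[OF that] by (auto simp: lowest_def cfG)
      then have "frame_indep ?n (G c)"
        by (rule lowest_indep[OF a(1)])
      from ordered_basis_sym_act[OF ordered_basis_frame[OF this] k]
      show "frame_indep ?n (f c)"
        unfolding f_def by (rule ordered_basis_indep)
    qed
  qed
  define q where "q i m = (\<Sum>l\<le>d. monom (cf d (F i) l * cf d (sym_act k (monoform d l)) m) (l - a i))" for i m
  have q: "cf d (f c i) m = poly (q i m) c" for c i m
    by (simp add: f_def G_def q_def sym_act_sum sym_act_scale cf_sum cf_scale poly_sum poly_monom mult_ac)
  define Q where "Q I = Determinant.det (Matrix.mat ?n ?n (\<lambda>(i, j). q i (sorted_list_of_set I ! j)))" for I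
  have Q: "pluecker ?n d (f c) I = poly (Q I) c" for c I
  proof -
    interpret E: subring_hom UNIV "\<lambda>p :: 'k poly. poly p c"
      by unfold_locales auto
    have "map_mat (\<lambda>p. poly p c) (Matrix.mat ?n ?n (\<lambda>(i, j). q i (sorted_list_of_set I ! j))) =
        Matrix.mat ?n ?n (\<lambda>(i, j). cf d (f c i) (sorted_list_of_set I ! j))"
      by (rule eq_matI) (auto simp: q)
    then show ?thesis
      unfolding Q_def pluecker_mat
      using E.det_mem_hom[of "Matrix.mat ?n ?n (\<lambda>(i, j). q i (sorted_list_of_set I ! j))" ?n] by simp
  qed
  \<comment> \<open>Having only finitely many exceptional \<open>c\<close> passes to intersections
    and to unions with a member containing the limit, so a principal open set decides.\<close>
  from U(1)[unfolded openin_zariski] U(2) show ?thesis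
  proof (induction U rule: generate_topology_on.induct)
    case Empty
    then show ?case by simp
  next
    case (Int A B)
    then have "finite ({c. c \<noteq> 0 \<and> sym_act (k ** mat2 1 0 0 c) ` S \<notin> A} \<union>
        {c. c \<noteq> 0 \<and> sym_act (k ** mat2 1 0 0 c) ` S \<notin> B})"
      by simp
    then show ?case
      by (rule rev_finite_subset) auto
  next
    case (UN K)
    then obtain A where "A \<in> K" "?T \<in> A"
      by blast
    then have "finite {c. c \<noteq> 0 \<and> sym_act (k ** mat2 1 0 0 c) ` S \<notin> A}"
      using UN by blast
    then show ?case
      by (rule rev_finite_subset) (use \<open>A \<in> K\<close> in auto)
  next
    case (Basis A)
    then obtain P where A: "A = principal_open ?n d P" and P: "homogeneous_in (pluecker_index ?n d) P"
      by blast
    obtain f' where "ordered_basis ?n ?T f'" "mpoly_eval P (pluecker ?n d f') \<noteq> 0"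
      using Basis(2) unfolding A principal_open_def by blast
    then have P0: "mpoly_eval P (pluecker ?n d (f 0)) \<noteq> 0"
      using homogeneous_basis_independent[OF P _ f0] by blast
    define R where "R = mpoly_eval_hom (\<lambda>c. [:c:]) P Q"
    have R: "mpoly_eval P (pluecker ?n d (f c)) = poly R c" for c
    proof -
      interpret E: subring_hom UNIV "\<lambda>p :: 'k poly. poly p c"
        by unfold_locales auto
      have "poly R c = mpoly_eval_hom (\<lambda>c. c) P (\<lambda>I. poly (Q I) c)"
        unfolding R_def using E.mpoly_eval_hom_mem_hom[of "\<lambda>c. [:c:]" "\<lambda>c. c" Q P] by simp
      also have "(\<lambda>I. poly (Q I) c) = pluecker ?n d (f c)"
        by (simp add: Q fun_eq_iff)
      finally show ?thesis
        by (simp add: mpoly_eval_hom_id)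
    qed
    \<comment> \<open>The value of \<open>R\<close> at 0 is that of \<open>P\<close> at the limit,
      which lies in the principal open set; the exceptional \<open>c\<close> are therefore roots of
      a nonzero polynomial.\<close>
    have "R \<noteq> 0"
      using P0 R[of 0] by auto
    then have "finite {c. poly R c = 0}"
      by (rule poly_roots_finite)
    moreover have "sym_act (k ** mat2 1 0 0 c) ` S \<in> A" if "c \<noteq> 0" "poly R c \<noteq> 0" for c
    proof -
      have "sym_act (k ** mat2 1 0 0 c) ` S \<subseteq> Sym d"
        using F(2) sym_act_Sym by blast
      then show ?thesis
        unfolding A principal_open_def using fc[OF that(1)] that(2) R[of c] ordered_basis_Grassmannian[OF fc[OF that(1)]] by force
    qed
    ultimately show ?case
      by (rule_tac rev_finite_subset) auto
  qed
qed

lemma limit_set_subset_closure: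
  fixes S :: "'k::alg_closed_field poly poly set"
  assumes S: "ordered_basis (Suc r) S f" "S \<subseteq> Sym d"
  shows "limit_set d r S \<subseteq> zariski_Gr (Suc r) d closure_of GL2_orbit S"
proof
  fix T assume T: "T \<in> limit_set d r S"
  have top: "T \<in> topspace (zariski_Gr (Suc r) d)"
    using limit_set_Grassmannian[OF S T] by (simp add: topspace_zariski)
  show "T \<in> zariski_Gr (Suc r) d closure_of GL2_orbit S"
    unfolding in_closure_of
  proof (intro conjI top allI impI)
    fix U assume U: "T \<in> U \<and> openin (zariski_Gr (Suc r) d) U"
    from S T show "\<exists>y. y \<in> GL2_orbit S \<and> y \<in> U"
    proof (cases rule: limit_set_cases)
      case (orbit g)
      then show ?thesis
        using U GL2_orbitI by blast
    next
      case (degenerate g w a F)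
      have "finite {c. c \<noteq> 0 \<and> sym_act (g ** mat2 1 0 0 c) ` sym_act w ` S \<notin> U}"
        using degeneration_curve[OF degenerate(1,3,6,4,5)] U degenerate(7) by blast
      \<comment> \<open>Adding 0 to the finite exceptional set forces the chosen \<open>c\<close> to
        be nonzero, so that the point found lies in the orbit.\<close>
      then have "finite (insert 0 {c. c \<noteq> 0 \<and> sym_act (g ** mat2 1 0 0 c) ` sym_act w ` S \<notin> U})"
        by simp
      then obtain c :: 'k where c: "c \<noteq> 0" "sym_act (g ** mat2 1 0 0 c) ` sym_act w ` S \<in> U"
        using infinite_alg_closed_field ex_new_if_finite by blast
      have "invertible (g ** mat2 1 0 0 c ** w)"
        using c(1) degenerate(1,2) by (intro invertible_mult) (simp_all add: invertible_mat2)
      then show ?thesis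
        using c(2) GL2_orbitI unfolding sym_act_image_compose by blast
    qed
  qed
qed

lemma closure_subset_limit_set:
  fixes S :: "'k::alg_closed_field poly poly set"
  assumes char: "\<And>m. 0 < m \<Longrightarrow> m \<le> d \<Longrightarrow> (of_nat m :: 'k) \<noteq> 0"
    and S: "ordered_basis (Suc r) S f" "S \<subseteq> Sym d"
  shows "zariski_Gr (Suc r) d closure_of GL2_orbit S \<subseteq> limit_set d r S"
proof
  let ?n = "Suc r"
  let ?X = "pluecker_index ?n d"
  fix T assume T: "T \<in> zariski_Gr ?n d closure_of GL2_orbit S"
  then have TG: "T \<in> Grassmannian ?n (Sym d)"
    using topspace_zariski[of ?n d] by (auto simp: in_closure_of)
  then have TS: "T \<subseteq> Sym d"
    by (simp add: Grassmannian_def)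
  obtain \<tau> where \<tau>: "ordered_basis ?n T \<tau>"
    using Grassmannian_ordered_basis[OF TG] by blast
  obtain \<iota> :: "'k \<Rightarrow> 'k poly poly poly poly fract" and g :: "'k poly poly poly poly fract ^ 2 ^ 2"
    where \<iota>: "subring_hom UNIV \<iota>" and g: "invertible g"
    and spec: "\<And>g0. \<exists>A e. field_subring_hom A e \<and> (\<forall>c. \<iota> c \<in> A \<and> e (\<iota> c) = c) \<and>
       (\<forall>i j. g $ i $ j \<in> A) \<and> map_mat2 e g = g0"
    by (rule generic_matrix) (rule that; assumption)
  interpret \<iota>: field_subring_hom UNIV \<iota>
    unfolding field_subring_hom_def by (rule \<iota>)
  define \<phi> where "\<phi> = pluecker ?n d (\<lambda>i. sym_act g (map_form \<iota> (f i)))"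
  have fS: "f i \<in> Sym d" if "i < ?n" for i
    using ordered_basis_mem[OF S(1) that] S(2) by blast
  \<comment> \<open>If \<open>P\<close> did not vanish at \<open>T\<close>, the open set it defines
    would meet the orbit in a translate by some \<open>g0\<close>. Specializing \<open>g\<close> to
    \<open>g0\<close> carries the value of \<open>P\<close> at \<open>\<phi>\<close>, which is zero,
    to a nonzero value.\<close>
  have vanish: "mpoly_eval P (pluecker ?n d \<tau>) = 0"
    if P: "homogeneous_in ?X P" "mpoly_eval_hom \<iota> P \<phi> = 0" for P
  proof (rule ccontr)
    assume "mpoly_eval P (pluecker ?n d \<tau>) \<noteq> 0"
    then have "T \<in> principal_open ?n d P"
      using TG \<tau> by (auto simp: principal_open_def)
    then obtain S' where S': "S' \<in> GL2_orbit S" "S' \<in> principal_open ?n d P"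
      using T openin_principal_open[OF P(1)] unfolding in_closure_of by blast
    obtain g0 where g0: "invertible g0" "S' = sym_act g0 ` S"
      using S'(1) by (rule GL2_orbitE)
    let ?f = "\<lambda>i. sym_act g0 (f i)"
    have nz: "mpoly_eval P (pluecker ?n d ?f) \<noteq> 0"
      using S'(2) homogeneous_basis_independent[OF P(1) _ ordered_basis_sym_act[OF S(1) g0(1)]] g0(2)
      by (auto simp: principal_open_def)
    obtain A :: "'k poly poly poly poly fract set" and e where A: "field_subring_hom A e"
        "\<And>c. \<iota> c \<in> A" "\<And>c. e (\<iota> c) = c" "\<And>i j. (g $ i) $ j \<in> A" "map_mat2 e g = g0"
      using spec[of g0] by blast
    interpret A: field_subring_hom A e by fact
    have "sym_act g (map_form \<iota> (f i)) \<in> forms_in A \<and> map_form e (sym_act g (map_form \<iota> (f i))) = ?f i"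
      if i: "i < ?n" for i
    proof -
      have "map_form \<iota> (f i) \<in> forms_in A" "map_form e (map_form \<iota> (f i)) = f i"
        by (auto simp: forms_in_def poly_eq_iff \<iota>.coeff_map_form A.coeff_map_form A(2,3))
      then show ?thesis
        using A.sym_act_mem_hom[OF A(4) \<iota>.map_form_Sym[OF fS[OF i]]] A(5) by simp
    qed
    then have "\<phi> I \<in> A \<and> e (\<phi> I) = pluecker ?n d ?f I" for I
      unfolding \<phi>_def using A.pluecker_mem_hom[of ?n "\<lambda>i. sym_act g (map_form \<iota> (f i))" d I]
        pluecker_cong[of ?n "\<lambda>i. map_form e (sym_act g (map_form \<iota> (f i)))" ?f d I] by simp
    then have "e (mpoly_eval_hom \<iota> P \<phi>) = mpoly_eval P (pluecker ?n d ?f)"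
      using A.mpoly_eval_hom_mem_hom[of \<iota> "\<lambda>c. c" \<phi> P] A(2,3) by (simp add: mpoly_eval_hom_id)
    then show False
      using nz P(2) A.hom_zero by simp
  qed
  obtain J where J: "J \<in> ?X" "pluecker ?n d \<tau> J \<noteq> 0"
    using pluecker_nonzero[OF \<tau> TS] by blast
  define t where "t = pluecker ?n d \<tau>"
  have tJ: "t J \<noteq> 0"
    using J(2) by (simp add: t_def)
  let ?c = "\<lambda>I D. Poly_Mapping.single (Poly_Mapping.single I D) (1 :: 'k)"
  note c_hom = coordinate_power(1)[OF subring_hom_id]
  note c_K = coordinate_power(2)[OF \<iota>]
  note c_k = coordinate_power(2)[OF subring_hom_id]
  let ?e = "mpoly_eval_hom (\<lambda>c :: 'k. c)"
  have vanish': "?e P t = 0" if "homogeneous_degree ?X D P" "mpoly_eval_hom \<iota> P \<phi> = 0" for P D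
    using vanish[of P] that homogeneous_in_iff unfolding mpoly_eval_hom_id t_def by blast
  have \<phi>J: "\<phi> J \<noteq> 0"
  proof
    assume "\<phi> J = 0"
    then have "mpoly_eval_hom \<iota> (?c J 1) \<phi> = 0"
      using c_K[OF J(1), of 1 \<phi>] by simp
    then have "?e (?c J 1) t = 0"
      by (rule vanish'[OF c_hom[OF J(1)]])
    then show False
      using c_k[OF J(1), of 1 t] tJ by simp
  qed
  \<comment> \<open>The ratios of \<open>P\<close> to the power of coordinate \<open>J\<close> of
    the same degree, evaluated at \<open>\<phi>\<close> and at \<open>t\<close>. These are the
    functions on the affine chart where coordinate \<open>J\<close> is nonzero;
    \<open>vanish'\<close> makes the relation single-valued.\<close>
  define G where "G = {(x, y). \<exists>D P. homogeneous_degree ?X D P \<and>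
    mpoly_eval_hom \<iota> P \<phi> = \<phi> J ^ D * x \<and> ?e P t = t J ^ D * y}"
  have GI: "(x, y) \<in> G" if "homogeneous_degree ?X D P" "mpoly_eval_hom \<iota> P \<phi> = \<phi> J ^ D * x"
    "?e P t = t J ^ D * y" for x y D P
    using that by (auto simp: G_def)
  note ev_K = mpoly_eval_hom_add[OF \<iota>] mpoly_eval_hom_mult[OF \<iota>]
  note ev_k = mpoly_eval_hom_add[OF subring_hom_id] mpoly_eval_hom_mult[OF subring_hom_id]
  have const: "(\<iota> c, c) \<in> G" for c
    by (rule GI[OF homogeneous_degree_const[of _ c]])
      (simp_all add: mpoly_eval_hom_single \<iota>.hom_zero power_prod_def)
  have G_mult: "(x * x', y * y') \<in> G" if xy: "(x, y) \<in> G" "(x', y') \<in> G" for x y x' y'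
  proof -
    obtain D P D' P' where P: "homogeneous_degree ?X D P" "mpoly_eval_hom \<iota> P \<phi> = \<phi> J ^ D * x" "?e P t = t J ^ D * y"
      "homogeneous_degree ?X D' P'" "mpoly_eval_hom \<iota> P' \<phi> = \<phi> J ^ D' * x'" "?e P' t = t J ^ D' * y'"
      using xy by (auto simp: G_def)
    show ?thesis
      by (rule GI[OF homogeneous_degree_mult[OF P(1,4)]]) (simp_all add: ev_K ev_k P power_add mult_ac)
  qed
  have G_add: "(x + x', y + y') \<in> G" if xy: "(x, y) \<in> G" "(x', y') \<in> G" for x y x' y'
  proof -
    obtain D P D' P' where P: "homogeneous_degree ?X D P" "mpoly_eval_hom \<iota> P \<phi> = \<phi> J ^ D * x" "?e P t = t J ^ D * y"
      "homogeneous_degree ?X D' P'" "mpoly_eval_hom \<iota> P' \<phi> = \<phi> J ^ D' * x'" "?e P' t = t J ^ D' * y'"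
      using xy by (auto simp: G_def)
    \<comment> \<open>Before addition, each polynomial is multiplied by the power of coordinate
      \<open>J\<close> that the other lacks, which leaves the ratios unchanged.\<close>
    have "homogeneous_degree ?X (D + D') (P * ?c J D' + ?c J D * P')"
      by (intro homogeneous_degree_add homogeneous_degree_mult P c_hom J)
    then show ?thesis
      by (rule GI) (simp_all add: ev_K ev_k P c_K[OF J(1)] c_k[OF J(1)] power_add algebra_simps)
  qed
  have hG: "hom_graph G"
  proof
    show "(1, 1) \<in> G"
      using const[of 1] by (simp add: \<iota>.hom_one)
    show "(x + x', y + y') \<in> G" "(x * x', y * y') \<in> G" if "(x, y) \<in> G" "(x', y') \<in> G" for x y x' y'
      using G_add G_mult that by blast+
    show "(- x, - y) \<in> G" if "(x, y) \<in> G" for x y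
      using G_mult[OF const[of "- 1"] that] by (simp add: \<iota>.hom_neg \<iota>.hom_one)
    show "y = 0" if "(0, y) \<in> G" for y
      using that vanish' tJ by (auto simp: G_def)
  qed
  obtain V h where V: "place V h \<iota>" and ext: "\<And>x y. (x, y) \<in> G \<Longrightarrow> x \<in> V \<and> h x = y"
    by (rule place_extension[OF hG \<iota> const]) (rule that; assumption)
  interpret place V h \<iota> by fact
  have "has_limits d r g"
    by (rule has_limits_invertible[OF char infinite_alg_closed_field g])
  then obtain T' where T': "T' \<in> limit_set d r S" "specializes ?n (\<lambda>i. sym_act g (map_form \<iota> (f i))) T'"
    using S unfolding has_limits_def by blast
  obtain \<mu> b where b: "ordered_basis ?n T' b" "\<And>I. \<mu> * \<phi> I \<in> V \<and> h (\<mu> * \<phi> I) = pluecker ?n d b I"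
    using specializes_pluecker[OF T'(2), of d] unfolding \<phi>_def by blast
  have T'S: "T' \<subseteq> Sym d"
    using limit_set_Grassmannian[OF S T'(1)] by (simp add: Grassmannian_def)
  \<comment> \<open>Both \<open>\<mu> * \<phi> J\<close> and the ratio
    \<open>\<phi> I / \<phi> J\<close> lie in \<open>V\<close>, and the latter reduces to
    \<open>t I / t J\<close>. The factor of proportionality therefore does not depend on
    \<open>I\<close>.\<close>
  have "pluecker ?n d b I = (h (\<mu> * \<phi> J) / t J) * pluecker ?n d \<tau> I" if I: "I \<in> ?X" for I
  proof -
    have "(\<phi> I / \<phi> J, t I / t J) \<in> G"
      by (rule GI[OF c_hom[OF I, of 1]]) (simp_all add: c_K[OF I] c_k[OF I] \<phi>J tJ)
    then have "\<phi> I / \<phi> J \<in> V" "h (\<phi> I / \<phi> J) = t I / t J"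
      using ext by auto
    moreover have "\<mu> * \<phi> I = \<mu> * \<phi> J * (\<phi> I / \<phi> J)"
      using \<phi>J by simp
    ultimately have "h (\<mu> * \<phi> I) = h (\<mu> * \<phi> J) * (t I / t J)"
      using b(2)[of J] hom_mult by metis
    then show ?thesis
      using b(2)[of I] by (simp add: t_def)
  qed
  then have "T = T'"
    by (rule pluecker_proportional[OF \<tau> TS b(1) T'S])
  then show "T \<in> limit_set d r S"
    using T'(1) by simp
qed

text \<open>The choice of basis \<open>w1\<close>, \<open>w2\<close> does not affect the orbit,
  which depends only on the set of the \<open>a i\<close>; this is one of the finitely many subsets
  of \<open>{..d}\<close>.\<close>

lemma finite_limit_orbits:
  fixes S :: "'k::field poly poly set"
  assumes S: "ordered_basis (Suc r) S f" "S \<subseteq> Sym d"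
  shows "finite {GL2_orbit (monomial_subspace d r a (w1 :: 'k ^ 2) w2) | a w1 w2.
     (\<exists>v. v \<noteq> 0 \<and> vanishing_sequence r S v a) \<and> is_basis2 w1 w2}"
proof (rule finite_subset)
  let ?O = "\<lambda>A. GL2_orbit (form.span (monoform d ` A))"
  show "finite (?O ` Pow {..d})"
    by simp
  show "{GL2_orbit (monomial_subspace d r a (w1 :: 'k ^ 2) w2) | a w1 w2.
     (\<exists>v. v \<noteq> 0 \<and> vanishing_sequence r S v a) \<and> is_basis2 w1 w2} \<subseteq> ?O ` Pow {..d}"
  proof
    fix X assume "X \<in> {GL2_orbit (monomial_subspace d r a (w1 :: 'k ^ 2) w2) | a w1 w2.
      (\<exists>v. v \<noteq> 0 \<and> vanishing_sequence r S v a) \<and> is_basis2 w1 w2}"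
    then obtain a w1 w2 v where X: "X = GL2_orbit (monomial_subspace d r a w1 w2)"
      and v: "v \<noteq> 0" "vanishing_sequence r S v a" and w: "is_basis2 w1 w2"
      by blast
    obtain u :: "'k ^ 2 ^ 2" and F where "ordered_basis (Suc r) (sym_act u ` S) F"
        and a: "strict_mono_on {..<Suc r} a" "\<And>i. i < Suc r \<Longrightarrow> lowest d (F i) (a i)"
      by (rule vanishing_sequence_basis[OF S v]) (rule that; assumption)
    have ad: "a i \<le> d" if "i < Suc r" for i
      using a(2)[OF that] by (simp add: lowest_def)
    obtain k :: "'k ^ 2 ^ 2" where k: "invertible k" "k *v axis 1 1 = w1" "k *v axis 2 1 = w2"
      by (rule basis2_matrix[OF w])
    have "GL2_orbit (monomial_subspace d r a w1 w2) = GL2_orbit (mono_span d (Suc r) a)"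
      using monomial_subspace_image[OF k(2,3,1) a(1) ad] GL2_orbit_eq[OF k(1)] by simp
    also have "\<dots> = ?O (a ` {..<Suc r})"
      by (simp add: mono_span_def image_image)
    finally show "X \<in> ?O ` Pow {..d}"
      unfolding X using ad by (intro image_eqI[of _ _ "a ` {..<Suc r}"]) auto
  qed
qed

theorem theorem1p4:
  fixes S :: "'k::alg_closed_field poly poly set" and d r :: nat
  assumes "CHAR('k) = 0 \<or> CHAR('k) > d"
    and "S \<in> Grassmannian (r + 1) (Sym d)"
  shows "let orbits = insert (GL2_orbit S)
           {GL2_orbit (monomial_subspace d r a w1 w2) | a w1 w2.
              (\<exists>v. v \<noteq> 0 \<and> vanishing_sequence r S v a) \<and> is_basis2 w1 w2}
         in finite orbits \<and> zariski_Gr (r + 1) d closure_of GL2_orbit S = \<Union> orbits"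
proof -
  obtain f where f: "ordered_basis (Suc r) S f"
    using Grassmannian_ordered_basis[OF assms(2)] by auto
  have S: "S \<subseteq> Sym d"
    using assms(2) by (simp add: Grassmannian_def)
  \<comment> \<open>A positive characteristic dividing \<open>m\<close> would be at most
    \<open>m\<close>, hence at most \<open>d\<close>.\<close>
  have char: "(of_nat m :: 'k) \<noteq> 0" if "0 < m" "m \<le> d" for m
    using assms(1) that by (auto simp: of_nat_eq_0_iff_char_dvd dest: dvd_imp_le)
  have "zariski_Gr (Suc r) d closure_of GL2_orbit S = limit_set d r S"
    using closure_subset_limit_set[OF char f S] limit_set_subset_closure[OF f S] by blast
  then show ?thesis
    using finite_limit_orbits[OF f S] by (simp add: limit_set_def Let_def)
qed

end
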